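(* Let $k$ be an algebraically closed field of characteristic zero. Let $X\subset\mathbb{P}^4$ be a cubic threefold with exactly six nodes, containing exactly three planes, given by $$x_2x_3x_4+ax_1^3+x_1^2(b_1x_2+b_2x_3+b_3x_4)+x_1(x_2^2+x_3^2+x_4^2-x_5^2)=0$$ for some $a,b_1,b_2,b_3\in k$. Let $\iota_5\colon(x_1,x_2,x_3,x_4,x_5)\mapsto(x_1,x_2,x_3,x_4,-x_5)$, and suppose $\mathrm{Aut}(X)\ne\langle\iota_5\rangle$. Then, up to a permutation of the coordinates $x_2,x_3,x_4$ and changing signs of two of them, one of the following holds: (1) $b_1\ne b_2$, $b_2=b_3$, $b_1,b_2\ne0$, so $X$ is given by $x_2x_3x_4+ax_1^3+x_1^2(b_1x_2+b_2(x_3+x_4))+x_1(x_2^2+x_3^2+x_4^2-x_5^2)=0$, and $\mathrm{Aut}(X)\simeq C_2^2$, generated by $\iota_5$ and $\sigma_{34}\colon(x_1,x_2,x_3,x_4,x_5)\mapsto(x_1,x_2,x_4,x_3,x_5)$; (2) $b_1\ne0$, $b_2=b_3=0$, so $X$ is given by $x_2x_3x_4+ax_1^3+b_1x_1^2x_2+x_1(x_2^2+x_3^2+x_4^2-x_5^2)=0$, and $\mathrm{Aut}(X)\simeq C_2^3$, generated by $\iota_5$, $\sigma_{34}$ and $\iota_{34}\colon(x_1,x_2,x_3,x_4,x_5)\mapsto(x_1,x_2,-x_3,-x_4,x_5)$; (3) $b_1=b_2=b_3\ne0$, so $X$ is given by $x_2x_3x_4+ax_1^3+b_1x_1^2(x_2+x_3+x_4)+x_1(x_2^2+x_3^2+x_4^2-x_5^2)=0$,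 and $\mathrm{Aut}(X)\simeq C_2\times\mathfrak{S}_3$, generated by $\iota_5$, $\sigma_{34}$ and $\sigma_{234}\colon(x_1,x_2,x_3,x_4,x_5)\mapsto(x_1,x_3,x_4,x_2,x_5)$; (4) $b_1=b_2=b_3=0$, so $X$ is given by $x_2x_3x_4+ax_1^3+x_1(x_2^2+x_3^2+x_4^2-x_5^2)=0$, and $\mathrm{Aut}(X)\simeq C_2\times\mathfrak{S}_4$, generated by $\iota_5,\sigma_{34},\sigma_{234},\iota_{34}$ and $\iota_{24}\colon(x_1,x_2,x_3,x_4,x_5)\mapsto(x_1,-x_2,x_3,-x_4,x_5)$.
   Context: A node is an ordinary double point. The three planes in $X$ are $\{x_1=x_2=0\}$, $\{x_1=x_3=0\}$, $\{x_1=x_4=0\}$. Permuting $x_2,x_3,x_4$ permutes $b_1,b_2,b_3$, and simultaneously changing the signs of two of $x_2,x_3,x_4$ changes the signs of the two corresponding $b_i$; both operations preserve the form of the equation.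
   Formalization: In case (1) the condition b_1≠0 is dropped (only b_1≠b_2, b_2=b_3, b_2≠0 is required), since a=0, (b_1,b_2,b_3)=(0,1,1) gives a cubic with six nodes, three planes and the extra automorphism σ_34 that fits none of the cases as stated. *)

theory Defs
  imports
    "HOL-Analysis.Cartesian_Space"
    "HOL-Library.Poly_Mapping"
    "HOL-Computational_Algebra.Polynomial"
    "HOL-Algebra.Bij"
    "HOL-Algebra.Elementary_Groups"
    "HOL-Algebra.Generated_Groups"
    "HOL-Algebra.Sym_Groups"
begin

section \<open>Polynomials in finitely many variables\<close>

text \<open>
  The monoid algebra over the exponent vectors: the polynomial ring in the variables indexed by
  the finite type \<open>'n\<close>, with coefficients in \<open>'a\<close>.
\<close>

type_synonym ('n, 'a) mpoly = "('n \<Rightarrow>\<^sub>0 nat) \<Rightarrow>\<^sub>0 'a"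

definition var :: "'n \<Rightarrow> ('n, 'a::zero_neq_one) mpoly" where
  "var i = Poly_Mapping.single (Poly_Mapping.single i 1) 1"

definition cnst :: "'a::zero \<Rightarrow> ('n, 'a) mpoly" where
  "cnst c = Poly_Mapping.single 0 c"

definition mp_eval :: "('n::finite, 'a::comm_semiring_1) mpoly \<Rightarrow> 'a ^ 'n \<Rightarrow> 'a" where
  "mp_eval p x =
     (\<Sum>m\<in>Poly_Mapping.keys p. Poly_Mapping.lookup p m * (\<Prod>i\<in>UNIV. (x $ i) ^ Poly_Mapping.lookup m i))"

definition mp_deriv :: "'n \<Rightarrow> ('n, 'a::comm_semiring_1) mpoly \<Rightarrow> ('n, 'a) mpoly" where
  "mp_deriv i p =
     (\<Sum>m\<in>Poly_Mapping.keys p.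
        Poly_Mapping.single (m - Poly_Mapping.single i 1)
          (of_nat (Poly_Mapping.lookup m i) * Poly_Mapping.lookup p m))"

definition homogeneous :: "nat \<Rightarrow> ('n::finite, 'a::zero) mpoly \<Rightarrow> bool" where
  "homogeneous d p \<longleftrightarrow>
     (\<forall>m\<in>Poly_Mapping.keys p. (\<Sum>i\<in>UNIV. Poly_Mapping.lookup m i) = d)"


section \<open>Projective hypersurfaces\<close>

text \<open>
  A point of projective space is a line through the origin.  All notions below are the classical
  ones over an algebraically closed field, where a variety is given by its closed points.
\<close>

definition proj_space :: "('a::field ^ 'n::finite) set set" where
  "proj_space = {L. vec.subspace L \<and> vec.dim L = 1}"

definition hypersurface :: "('n::finite, 'a::field) mpoly \<Rightarrow> ('a ^ 'n) set set" where
  "hypersurface F = {L \<in> proj_space. \<forall>x\<in>L - {0}. mp_eval F x = 0}"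

definition sing_locus :: "('n::finite, 'a::field) mpoly \<Rightarrow> ('a ^ 'n) set set" where
  "sing_locus F =
     {L \<in> hypersurface F. \<forall>x\<in>L - {0}. \<forall>i. mp_eval (mp_deriv i F) x = 0}"

definition hessian :: "('n::finite, 'a::field) mpoly \<Rightarrow> 'a ^ 'n \<Rightarrow> 'a ^ 'n ^ 'n" where
  "hessian F x = (\<chi> i j. mp_eval (mp_deriv i (mp_deriv j F)) x)"

text \<open>
  Ordinary double points (characteristic different from 2): at a singular point \<open>L\<close> spanned by
  \<open>x\<close>, the quadratic part of a local equation of the hypersurface is, up to a scalar, the
  quadratic form on the tangent space of projective space (a copy of the quotient by \<open>L\<close>) induced
  by the Hessian of \<open>F\<close> at \<open>x\<close>.  It is nondegenerate iff the kernel of the Hessian is no larger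
  than \<open>L\<close>; that \<open>L\<close> is contained in the kernel is Euler's relation.
\<close>

definition is_node :: "('n::finite, 'a::field) mpoly \<Rightarrow> ('a ^ 'n) set \<Rightarrow> bool" where
  "is_node F L \<longleftrightarrow>
     L \<in> sing_locus F \<and> (\<forall>x\<in>L - {0}. {v. hessian F x *v v = 0} = L)"

text \<open>A plane of projective space is represented by the linear subspace that is its cone.\<close>

definition planes_in :: "('n::finite, 'a::field) mpoly \<Rightarrow> ('a ^ 'n) set set" where
  "planes_in F = {W. vec.subspace W \<and> vec.dim W = 3 \<and> (\<forall>w\<in>W. mp_eval F w = 0)}"


section \<open>Automorphisms of a projective hypersurface\<close>

text \<open>
  A map from the hypersurface to projective space is regular if near every point it is given by
  homogeneous polynomials of a common degree without common zeros.  One may take as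
  neighbourhood of the point the whole open set where the polynomials \<open>P\<close> do not vanish
  simultaneously: if they represent the map only on a smaller open set \<open>U\<close>, multiply them by
  a form that vanishes outside \<open>U\<close> but not at the point.  The value of \<open>f\<close> outside the hypersurface
  is irrelevant.
\<close>

definition regular_map ::
    "('n::finite, 'a::field) mpoly \<Rightarrow> (('a ^ 'n) set \<Rightarrow> ('a ^ 'n) set) \<Rightarrow> bool" where
  "regular_map F f \<longleftrightarrow>
     (\<forall>L \<in> hypersurface F. \<exists>d. \<exists>P :: 'n \<Rightarrow> ('n, 'a) mpoly.
        (\<forall>i. homogeneous d (P i)) \<and>
        (\<forall>x\<in>L - {0}. (\<chi> i. mp_eval (P i) x) \<noteq> 0) \<and>
        (\<forall>M \<in> hypersurface F. \<forall>y\<in>M - {0}.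
           (\<chi> i. mp_eval (P i) y) \<noteq> 0 \<longrightarrow> f M = vec.span {\<chi> i. mp_eval (P i) y}))"

text \<open>
  The group of all automorphisms of the hypersurface as a variety; an automorphism is not assumed
  to be induced by a linear map.
\<close>

definition Aut_hyp ::
    "('n::finite, 'a::field) mpoly \<Rightarrow> (('a ^ 'n) set \<Rightarrow> ('a ^ 'n) set) monoid" where
  "Aut_hyp F = (BijGroup (hypersurface F))
     \<lparr>carrier := {f \<in> Bij (hypersurface F).
        regular_map F f \<and> regular_map F (inv_into (hypersurface F) f)}\<rparr>"

definition induced ::
    "('n::finite, 'a::field) mpoly \<Rightarrow> ('a ^ 'n \<Rightarrow> 'a ^ 'n) \<Rightarrow> ('a ^ 'n) set \<Rightarrow> ('a ^ 'n) set" where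
  "induced F g = (\<lambda>L\<in>hypersurface F. g ` L)"

definition Aut_generated_by ::
    "('n::finite, 'a::field) mpoly \<Rightarrow> ('a ^ 'n \<Rightarrow> 'a ^ 'n) set \<Rightarrow> bool" where
  "Aut_generated_by F S \<longleftrightarrow>
     induced F ` S \<subseteq> carrier (Aut_hyp F) \<and>
     carrier (Aut_hyp F) = generate (Aut_hyp F) (induced F ` S)"


section \<open>The family of cubic threefolds\<close>

text \<open>The coordinates are indexed by the type \<open>5\<close>, in which the numeral \<open>5\<close> equals \<open>0\<close>.\<close>

definition cubic :: "'a::field \<Rightarrow> 'a \<Rightarrow> 'a \<Rightarrow> 'a \<Rightarrow> (5, 'a) mpoly" where
  "cubic a b1 b2 b3 =
     var 2 * var 3 * var 4 + cnst a * var 1 ^ 3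
     + var 1 ^ 2 * (cnst b1 * var 2 + cnst b2 * var 3 + cnst b3 * var 4)
     + var 1 * (var 2 ^ 2 + var 3 ^ 2 + var 4 ^ 2 - var 5 ^ 2)"

definition iota5 :: "'a::field ^ 5 \<Rightarrow> 'a ^ 5" where
  "iota5 x = vector [x $ 1, x $ 2, x $ 3, x $ 4, - x $ 5]"

definition sigma34 :: "'a::field ^ 5 \<Rightarrow> 'a ^ 5" where
  "sigma34 x = vector [x $ 1, x $ 2, x $ 4, x $ 3, x $ 5]"

definition sigma234 :: "'a::field ^ 5 \<Rightarrow> 'a ^ 5" where
  "sigma234 x = vector [x $ 1, x $ 3, x $ 4, x $ 2, x $ 5]"

definition iota34 :: "'a::field ^ 5 \<Rightarrow> 'a ^ 5" where
  "iota34 x = vector [x $ 1, x $ 2, - x $ 3, - x $ 4, x $ 5]"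

definition iota24 :: "'a::field ^ 5 \<Rightarrow> 'a ^ 5" where
  "iota24 x = vector [x $ 1, - x $ 2, x $ 3, - x $ 4, x $ 5]"

text \<open>Permutations of the coordinates 2, 3, 4, followed by changing the signs of none or two of them.\<close>

definition coord_changes :: "('a::field ^ 5 \<Rightarrow> 'a ^ 5) set" where
  "coord_changes =
     {T. \<exists>\<pi> N. \<pi> permutes {2, 3, 4} \<and> N \<subseteq> {2, 3, 4} \<and> card N \<in> {0, 2} \<and>
           T = (\<lambda>x. \<chi> i. if i \<in> N then - x $ \<pi> i else x $ \<pi> i)}"

text \<open>
  The four types, for the cubic with parameters \<open>a, b1, b2, b3\<close>.  Type 1 does not
  require \<open>b1\<close> to be nonzero: for example \<open>a = 0\<close> and \<open>(b1, b2, b3) = (0, 1, 1)\<close>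
  gives a cubic with exactly six nodes and exactly three planes whose automorphism group is
  generated by \<open>iota5\<close> and \<open>sigma34\<close>, and no permitted change of coordinates makes
  both \<open>b1\<close> and \<open>b2 = b3\<close> nonzero, or brings it to one of the other types.
\<close>

definition type1 :: "'a::field \<Rightarrow> 'a \<Rightarrow> 'a \<Rightarrow> 'a \<Rightarrow> bool" where
  "type1 a b1 b2 b3 \<longleftrightarrow>
     b1 \<noteq> b2 \<and> b2 = b3 \<and> b2 \<noteq> 0 \<and>
     Aut_hyp (cubic a b1 b2 b3) \<cong> integer_mod_group 2 \<times>\<times> integer_mod_group 2 \<and>
     Aut_generated_by (cubic a b1 b2 b3) {iota5, sigma34}"

definition type2 :: "'a::field \<Rightarrow> 'a \<Rightarrow> 'a \<Rightarrow> 'a \<Rightarrow> bool" where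
  "type2 a b1 b2 b3 \<longleftrightarrow>
     b1 \<noteq> 0 \<and> b2 = 0 \<and> b3 = 0 \<and>
     Aut_hyp (cubic a b1 b2 b3)
       \<cong> integer_mod_group 2 \<times>\<times> integer_mod_group 2 \<times>\<times> integer_mod_group 2 \<and>
     Aut_generated_by (cubic a b1 b2 b3) {iota5, sigma34, iota34}"

definition type3 :: "'a::field \<Rightarrow> 'a \<Rightarrow> 'a \<Rightarrow> 'a \<Rightarrow> bool" where
  "type3 a b1 b2 b3 \<longleftrightarrow>
     b1 = b2 \<and> b2 = b3 \<and> b3 \<noteq> 0 \<and>
     Aut_hyp (cubic a b1 b2 b3) \<cong> integer_mod_group 2 \<times>\<times> sym_group 3 \<and>
     Aut_generated_by (cubic a b1 b2 b3) {iota5, sigma34, sigma234}"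

definition type4 :: "'a::field \<Rightarrow> 'a \<Rightarrow> 'a \<Rightarrow> 'a \<Rightarrow> bool" where
  "type4 a b1 b2 b3 \<longleftrightarrow>
     b1 = 0 \<and> b2 = 0 \<and> b3 = 0 \<and>
     Aut_hyp (cubic a b1 b2 b3) \<cong> integer_mod_group 2 \<times>\<times> sym_group 4 \<and>
     Aut_generated_by (cubic a b1 b2 b3) {iota5, sigma34, sigma234, iota34, iota24}"

end

theory Submission
  imports Defs "Berlekamp_Zassenhaus.Unique_Factorization_Poly"
begin

text \<open>On the affine part \<open>x\<^sub>1 = 1\<close> completing the square in \<open>x\<^sub>2\<close> turns the cubic into \<open>r s = H(y, z)\<close>,
  where the branch curve \<open>H = 0\<close> is irreducible because \<open>X\<close> has no singular point there. By Nagata's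
  criterion this threefold is factorial, so that a regular map to projective space is given there by
  a single family of polynomials without common zeros. The complement is the union of the three
  planes; as no combination of them other than a multiple of the hyperplane section is Cartier at
  the nodes, the family can be chosen homogeneous and without common zeros on all of \<open>X\<close>.
  For an automorphism the degrees of the two families multiply to 1, so it is
  induced by a linear map. That map permutes the three planes, and comparing coefficients it
  is a signed permutation of \<open>x\<^sub>2, x\<^sub>3, x\<^sub>4\<close> together with a sign of \<open>x\<^sub>5\<close>. The signed permutations
  with an even number of signs are the symmetric group on the vertices of a tetrahedron, and those
  preserving \<open>X\<close> are the stabiliser of the linear form \<open>b\<^sub>1 x\<^sub>2 + b\<^sub>2 x\<^sub>3 + b\<^sub>3 x\<^sub>4\<close>, which is
  determined by the coincidences among its values at the vertices.\<close>

text \<open>Factoriality is stated in the form in which it is used: vectors of functions that are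
  pairwise proportional at every point are multiples of one vector without common zeros. Polynomial
  functions on closed points replace coordinate rings throughout, the field being infinite. The
  whole cone is not factorial, and the work at infinity comes from that. The common vector
  \<open>Q\<close> found on the affine part compares with a local representation \<open>P\<close> as
  x1^N P = l Q, and x1 has to be cancelled. If \<open>Q\<close> has least degree, it is nonzero
  somewhere on one plane. Could it vanish on another plane? The two share a node; there
  \<open>P\<close> may be taken nonzero, and a quadric surface through the node shows that
  \<open>l\<close> vanishes along the second plane once it vanishes along the first. Hence powers of
  x1 can be removed until \<open>Q\<close> itself is seen to be nonzero at the node. The degrees are
  compared on a line in X: the composite of the two families fixes every point of it, so its scalar
  is a polynomial without zeros.\<close>

no_notation Matrix.vec_index (infixl \<open>$\<close> 100)
hide_const (open) Divisibility.irreducible Divisibility.prime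

section \<open>Polynomial functions\<close>

text \<open>Functions rather than formal polynomials: substitution becomes composition, and one
  notion covers functions of one, two, four and five variables as well as
  \<open>mp_eval\<close>.\<close>

inductive_set polyfun :: "('x \<Rightarrow> 'a::comm_ring_1) set \<Rightarrow> ('x \<Rightarrow> 'a) set"
  for G where
  polyfun_const: "(\<lambda>_. c) \<in> polyfun G"
| polyfun_gen: "g \<in> G \<Longrightarrow> g \<in> polyfun G"
| polyfun_add: "f \<in> polyfun G \<Longrightarrow> g \<in> polyfun G \<Longrightarrow> (\<lambda>x. f x + g x) \<in> polyfun G"
| polyfun_mult: "f \<in> polyfun G \<Longrightarrow> g \<in> polyfun G \<Longrightarrow> (\<lambda>x. f x * g x) \<in> polyfun G"

lemma polyfun_minus: "f \<in> polyfun G \<Longrightarrow> (\<lambda>x. - f x) \<in> polyfun G"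
  using polyfun_mult[OF polyfun_const[of "-1"], of f G] by simp

lemma polyfun_diff: "f \<in> polyfun G \<Longrightarrow> g \<in> polyfun G \<Longrightarrow> (\<lambda>x. f x - g x) \<in> polyfun G"
  using polyfun_add[OF _ polyfun_minus, of f G g] by simp

lemma polyfun_power: "f \<in> polyfun G \<Longrightarrow> (\<lambda>x. f x ^ n) \<in> polyfun G"
  by (induction n) (auto intro: polyfun_const polyfun_mult)

lemma polyfun_sum: "(\<And>i. i \<in> A \<Longrightarrow> f i \<in> polyfun G) \<Longrightarrow> (\<lambda>x. \<Sum>i\<in>A. f i x) \<in> polyfun G"
  by (induction A rule: infinite_finite_induct) (auto intro: polyfun_const polyfun_add)

lemma polyfun_prod: "(\<And>i. i \<in> A \<Longrightarrow> f i \<in> polyfun G) \<Longrightarrow> (\<lambda>x. \<Prod>i\<in>A. f i x) \<in> polyfun G"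
  by (induction A rule: infinite_finite_induct) (auto intro: polyfun_const polyfun_mult)

lemma polyfun_comp:
  assumes "f \<in> polyfun G" and "\<And>g. g \<in> G \<Longrightarrow> (\<lambda>x. g (\<phi> x)) \<in> polyfun H"
  shows "(\<lambda>x. f (\<phi> x)) \<in> polyfun H"
  using assms(1) by induction (auto intro: polyfun.intros assms(2))

lemmas polyfun_intros =
  polyfun_const polyfun_add polyfun_mult polyfun_minus polyfun_diff polyfun_power

lemma polyfun_univariate:
  assumes "f \<in> polyfun {\<lambda>x. x}"
  obtains p where "\<And>x. f x = poly p x"
proof -
  from assms have "\<exists>p. \<forall>x. f x = poly p x"
  proof induction
    case (polyfun_const c)
    show ?case by (rule exI[of _ "[:c:]"]) simp
  next
    case (polyfun_gen g)
    then show ?case by (intro exI[of _ "[:0, 1:]"]) auto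
  next
    case (polyfun_add f g)
    then show ?case by (metis poly_add)
  next
    case (polyfun_mult f g)
    then show ?case by (metis poly_mult)
  qed
  with that show ?thesis by blast
qed

definition coords :: "('a::comm_ring_1 ^ 'n \<Rightarrow> 'a) set" where
  "coords = range (\<lambda>i x. x $ i)"

lemma polyfun_coord: "(\<lambda>x. x $ i) \<in> polyfun coords"
  by (rule polyfun_gen) (auto simp: coords_def)

lemma polyfun_mp_eval: "mp_eval p \<in> polyfun coords"
  unfolding mp_eval_def
  by (intro polyfun_sum polyfun_mult polyfun_const polyfun_prod polyfun_power polyfun_coord)

lemma polyfun_coords_comp:
  assumes "f \<in> polyfun coords" and "\<And>i. (\<lambda>x. \<phi> x $ i) \<in> polyfun H"
  shows "(\<lambda>x. f (\<phi> x)) \<in> polyfun H"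
  using assms(1) by (rule polyfun_comp) (auto simp: coords_def assms(2))

lemma polyfun_line:
  assumes "f \<in> polyfun coords"
  obtains p where "\<And>c. f (x + c *s v) = poly p c"
proof -
  have "(\<lambda>c. f (x + c *s v)) \<in> polyfun {\<lambda>x. x}"
    by (rule polyfun_coords_comp[OF assms]) (simp add: polyfun.intros)
  then show ?thesis using polyfun_univariate that by metis
qed

section \<open>Polynomials in two and three variables\<close>

text \<open>Nested univariate polynomials with the last variable outermost: iterating the
  factoriality of polynomials over a factorial domain puts these types in class \<open>ufd\<close>,
  and the degree in the last variable is directly available.\<close>

definition ev2 :: "'a::comm_ring_1 poly poly \<Rightarrow> 'a \<Rightarrow> 'a \<Rightarrow> 'a" where
  "ev2 p x y = poly (poly p [:y:]) x"

definition ev3 :: "'a::comm_ring_1 poly poly poly \<Rightarrow> 'a \<times> 'a \<times> 'a \<Rightarrow> 'a" where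
  "ev3 p = (\<lambda>(x, y, z). ev2 (poly p [:[:z:]:]) x y)"

lemma ev2_simps [simp]:
  "ev2 0 x y = 0" "ev2 1 x y = 1"
  "ev2 (p + q) x y = ev2 p x y + ev2 q x y"
  "ev2 (p - q) x y = ev2 p x y - ev2 q x y"
  "ev2 (- p) x y = - ev2 p x y"
  "ev2 (p * q) x y = ev2 p x y * ev2 q x y"
  "ev2 (p ^ n) x y = ev2 p x y ^ n"
  "ev2 (pCons c p) x y = poly c x + y * ev2 p x y"
  "ev2 (smult c p) x y = poly c x * ev2 p x y"
  by (simp_all add: ev2_def)

lemma ev3_simps [simp]:
  "ev3 0 x = 0" "ev3 1 x = 1"
  "ev3 (p + q) x = ev3 p x + ev3 q x"
  "ev3 (p - q) x = ev3 p x - ev3 q x"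
  "ev3 (- p) x = - ev3 p x"
  "ev3 (p * q) x = ev3 p x * ev3 q x"
  "ev3 (p ^ n) x = ev3 p x ^ n"
  by (simp_all add: ev3_def split: prod.splits)

lemma ev3_pCons [simp]: "ev3 (pCons c p) (x, y, z) = ev2 c x y + z * ev3 p (x, y, z)"
  by (simp add: ev3_def)

text \<open>With \<open>h\<close> embedding the field as constants into a coefficient ring, this
  removes one variable at a time in the two lemmas that follow.\<close>

lemma poly_zero_on_range:
  fixes p :: "'a::idom poly"
  assumes "inj h" and "infinite (UNIV :: 'b set)" and "\<And>c :: 'b. poly p (h c) = 0"
  shows "p = 0"
proof (rule ccontr)
  assume "p \<noteq> 0"
  then have "finite {x. poly p x = 0}" by (rule poly_roots_finite)
  moreover have "range h \<subseteq> {x. poly p x = 0}" using assms(3) by auto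
  ultimately show False using assms(1,2) finite_imageD finite_subset by blast
qed

lemma ev2_eq_0:
  fixes p :: "'a::field_char_0 poly poly"
  assumes "\<And>x y. ev2 p x y = 0"
  shows "p = 0"
proof (rule poly_zero_on_range[where h = "\<lambda>y::'a. [:y:]"])
  show "poly p [:y:] = 0" for y
    using assms by (simp add: ev2_def flip: poly_all_0_iff_0)
qed (auto simp: inj_def infinite_UNIV_char_0)

lemma ev3_eq_0:
  fixes p :: "'a::field_char_0 poly poly poly"
  assumes "\<And>x. ev3 p x = 0"
  shows "p = 0"
proof (rule poly_zero_on_range[where h = "\<lambda>y::'a. [:[:y:]:]"])
  show "poly p [:[:z:]:] = 0" for z
    by (rule ev2_eq_0) (use assms[of "(_, _, z)"] in \<open>simp add: ev3_def\<close>)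
qed (auto simp: inj_def infinite_UNIV_char_0)

lemma polyfun_poly: "f \<in> polyfun G \<Longrightarrow> (\<lambda>x. poly p (f x)) \<in> polyfun G"
  by (induction p) (auto intro: polyfun_intros)

lemma polyfun_ev2:
  "f \<in> polyfun G \<Longrightarrow> g \<in> polyfun G \<Longrightarrow> (\<lambda>x. ev2 p (f x) (g x)) \<in> polyfun G"
  by (induction p) (auto intro: polyfun_intros polyfun_poly)

lemma polyfun_ev3:
  "f \<in> polyfun G \<Longrightarrow> g \<in> polyfun G \<Longrightarrow> h \<in> polyfun G \<Longrightarrow>
    (\<lambda>x. ev3 p (f x, g x, h x)) \<in> polyfun G"
  by (induction p) (auto intro: polyfun_intros polyfun_ev2)

section \<open>Vectors over unique factorization domains\<close>

lemma ufd_induct [consumes 1, case_names unit prime]: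
  fixes x :: "'a::ufd"
  assumes "x \<noteq> 0"
    and unit: "\<And>x. x dvd 1 \<Longrightarrow> P x"
    and prime: "\<And>p x. prime_elem p \<Longrightarrow> x \<noteq> 0 \<Longrightarrow> P x \<Longrightarrow> P (p * x)"
  shows "P x"
proof -
  have *: "P (prod_mset F)" if "\<And>f. f \<in># F \<Longrightarrow> irreducible f" for F :: "'a multiset"
    using that
  proof (induction F)
    case empty
    then show ?case by (simp add: unit)
  next
    case (add f F)
    have "prod_mset F \<noteq> 0" using add.prems by auto
    with add show ?case by (simp add: prime)
  qed
  show ?thesis
  proof (cases "x dvd 1")
    case False
    with assms(1) obtain F where "mset_factors F x" using mset_factors_exist by blast
    then show ?thesis using *[of F] by (auto simp: mset_factors_def)
  qed (rule unit)
qed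

text \<open>A prime of \<open>d\<close> misses some \<open>e i\<close>, hence divides
  \<open>q\<close> and can be cancelled from both; the primes of \<open>d\<close> are used up one by
  one.\<close>

lemma dvd_if_dvd_coprime_multiples:
  fixes d q :: "'a::ufd"
  assumes "d \<noteq> 0" and "\<And>p. prime_elem p \<Longrightarrow> \<exists>i. \<not> p dvd e i" and "\<And>i. d dvd q * e i"
  shows "d dvd q"
  using assms(1,3)
proof (induction d arbitrary: q rule: ufd_induct)
  case (unit x)
  show ?case by (rule dvd_trans[OF unit(1)]) simp
next
  case (prime p x)
  obtain i where "\<not> p dvd e i" using assms(2)[OF prime.hyps(1)] by blast
  moreover have "p dvd q * e i" using prime.prems by (rule dvd_mult_left)
  ultimately have "p dvd q" using prime_elem_dvd_multD[OF prime.hyps(1)] by blast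
  then obtain q' where q: "q = p * q'" by blast
  have p0: "p \<noteq> 0" using prime.hyps(1) by (rule prime_elem_not_zeroI)
  have "x dvd q' * e i" for i using prime.prems[of i] p0 by (simp add: q mult.assoc)
  then have "x dvd q'" by (rule prime.IH)
  then show ?case unfolding q by (rule mult_dvd_mono[OF dvd_refl])
qed

lemma prime_elem_dvd_prod_mset:
  assumes "prime_elem \<pi>" and "\<pi> dvd u * prod_mset F" and "u dvd 1"
  shows "\<exists>f\<in>#F. \<pi> dvd f"
proof -
  have "\<pi> dvd prod_mset F"
    using prime_elem_dvd_multD[OF assms(1,2)]
  proof
    assume "\<pi> dvd u"
    then have "\<pi> dvd 1" using assms(3) by (rule dvd_trans)
    with prime_elem_not_unit[OF assms(1)] show ?thesis by contradiction
  qed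
  then show ?thesis
  proof (induction F)
    case empty
    then show ?case using prime_elem_not_unit[OF assms(1)] by simp
  next
    case (add f F)
    then have "\<pi> dvd f * prod_mset F" by simp
    from prime_elem_dvd_multD[OF assms(1) this] show ?case
    proof
      assume "\<pi> dvd prod_mset F"
      from add.IH[OF this] show ?thesis by simp
    qed simp
  qed
qed

text \<open>Common primes are extracted one at a time. Each divides the fixed nonzero entry
  \<open>P i\<close>, so the number of irreducible factors of that entry decreases; the unit
  \<open>u\<close> absorbs the cofactors.\<close>

lemma primitive_vector_exists:
  fixes P :: "'i \<Rightarrow> 'a::ufd"
  assumes "P i \<noteq> 0"
  obtains g p where "g \<noteq> 0" and "\<And>i. P i = g * p i" and "\<And>\<pi>. prime_elem \<pi> \<Longrightarrow> \<exists>i. \<not> \<pi> dvd p i"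
proof -
  have main: "\<exists>g p. g \<noteq> 0 \<and> (\<forall>i. P i = g * p i) \<and> (\<forall>\<pi>. prime_elem \<pi> \<longrightarrow> (\<exists>i. \<not> \<pi> dvd p i))"
    if "\<And>f. f \<in># F \<Longrightarrow> irreducible f" and "u dvd 1" and "P i = u * prod_mset F" for F u
    using that
  proof (induction F arbitrary: P u rule: measure_induct_rule[of size])
    case (less F)
    show ?case
    proof (cases "\<exists>\<pi>. prime_elem \<pi> \<and> (\<forall>i. \<pi> dvd P i)")
      case False
      then show ?thesis by (intro exI[of _ 1] exI[of _ P]) auto
    next
      case True
      then obtain \<pi> where \<pi>: "prime_elem \<pi>" "\<forall>i. \<pi> dvd P i" by (elim exE conjE)
      have "\<pi> dvd u * prod_mset F" using spec[OF \<pi>(2), of i] unfolding less.prems(3) .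
      from prime_elem_dvd_prod_mset[OF \<pi>(1) this less.prems(2)]
      obtain f where f: "f \<in># F" "\<pi> dvd f" by (rule bexE)
      obtain w where w: "f = \<pi> * w" using f(2) by (rule dvdE)
      \<comment> \<open>A prime dividing an irreducible element is associate to it: \<open>f\<close>
        leaves the factorisation and only the unit \<open>w\<close> remains.\<close>
      have "\<pi> dvd 1 \<or> w dvd 1" using less.prems(1)[OF f(1)] w by (rule irreducibleD)
      then have "w dvd 1" using prime_elem_not_unit[OF \<pi>(1)] by (simp only: simp_thms)
      obtain F' where F: "F = add_mset f F'" using multi_member_split[OF f(1)] by blast
      have "\<forall>i. \<exists>r. P i = \<pi> * r" using \<pi>(2) unfolding dvd_def .
      then have "\<exists>r. \<forall>i. P i = \<pi> * r i" by (rule choice)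
      then obtain r where r: "\<forall>i. P i = \<pi> * r i" by (rule exE)
      have \<pi>0: "\<pi> \<noteq> 0" using \<pi>(1) by (rule prime_elem_not_zeroI)
      have ri: "r i = (u * w) * prod_mset F'"
        using spec[OF r, of i] less.prems(3) \<pi>0 by (simp add: F w ac_simps)
      have uw: "u * w dvd 1" using less.prems(2) \<open>w dvd 1\<close> by simp
      have "size F' < size F" by (simp add: F)
      moreover have "irreducible f" if "f \<in># F'" for f
        by (rule less.prems(1)) (simp add: F that)
      ultimately have "\<exists>g p. g \<noteq> 0 \<and> (\<forall>i. r i = g * p i) \<and>
          (\<forall>\<pi>. prime_elem \<pi> \<longrightarrow> (\<exists>i. \<not> \<pi> dvd p i))"
        using uw ri by (rule less.IH)
      then obtain g p where gp: "g \<noteq> 0" "\<forall>i. r i = g * p i"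
        "\<forall>\<pi>. prime_elem \<pi> \<longrightarrow> (\<exists>i. \<not> \<pi> dvd p i)"
        by (elim exE conjE)
      have "\<pi> * g \<noteq> 0" using \<pi>0 gp(1) by simp
      moreover have "\<forall>i. P i = \<pi> * g * p i" using r gp(2) by (simp add: mult.assoc)
      ultimately show ?thesis using gp(3) by (intro exI[of _ "\<pi> * g"] exI[of _ p] conjI)
    qed
  qed
  have "\<exists>F u. (\<forall>f. f \<in># F \<longrightarrow> irreducible f) \<and> u dvd 1 \<and> P i = u * prod_mset F"
  proof (cases "P i dvd 1")
    case True
    then show ?thesis by (intro exI[of _ "{#}"] exI[of _ "P i"]) auto
  next
    case False
    then obtain F where "mset_factors F (P i)" using assms mset_factors_exist by blast
    then show ?thesis by (intro exI[of _ F] exI[of _ 1]) (auto simp: mset_factors_def)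
  qed
  then obtain F u where "\<forall>f. f \<in># F \<longrightarrow> irreducible f" "u dvd 1" "P i = u * prod_mset F"
    by (elim exE conjE)
  with main[of F u] obtain g p where "g \<noteq> 0" "\<forall>i. P i = g * p i"
    "\<forall>\<pi>. prime_elem \<pi> \<longrightarrow> (\<exists>i. \<not> \<pi> dvd p i)" by auto
  then show ?thesis by (intro that[of g p]) auto
qed

text \<open>Proportionality shows that \<open>p k\<close> divides every \<open>q k * p i\<close>; as
  the \<open>p i\<close> have no common prime, it divides \<open>q k\<close>, and the quotient is
  the multiplier.\<close>

lemma proportional_to_primitive:
  fixes p q :: "'i \<Rightarrow> 'a::ufd"
  assumes "p k \<noteq> 0" and "\<And>\<pi>. prime_elem \<pi> \<Longrightarrow> \<exists>i. \<not> \<pi> dvd p i"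
    and "\<And>i j. q i * p j = q j * p i"
  obtains c where "\<And>i. q i = c * p i"
proof -
  have "p k dvd q k * p i" for i by (metis assms(3) dvd_triv_right)
  with assms(1,2) have "p k dvd q k" by (rule dvd_if_dvd_coprime_multiples) auto
  then obtain c where c: "q k = p k * c" by blast
  have "q i = c * p i" for i
  proof -
    have "p k * q i = p k * (c * p i)" using assms(3)[of i k] by (simp add: c ac_simps)
    then show ?thesis using assms(1) by simp
  qed
  with that show ?thesis by blast
qed

section \<open>Proportional families on the affine threefold \<open>r s = H(y, z)\<close>\<close>

definition coords4 :: "('a::comm_ring_1 \<times> 'a \<times> 'a \<times> 'a \<Rightarrow> 'a) set" where
  "coords4 = {\<lambda>(y, z, r, s). y, \<lambda>(y, z, r, s). z, \<lambda>(y, z, r, s). r, \<lambda>(y, z, r, s). s}"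

lemma polyfun_coords4':
  "(\<lambda>x. fst x) \<in> polyfun coords4" "(\<lambda>x. fst (snd x)) \<in> polyfun coords4"
  "(\<lambda>x. fst (snd (snd x))) \<in> polyfun coords4" "(\<lambda>x. snd (snd (snd x))) \<in> polyfun coords4"
  by (rule polyfun_gen, simp add: coords4_def fun_eq_iff case_prod_beta)+

lemma polyfun_coords4_comp:
  assumes "f \<in> polyfun coords4" and "g1 \<in> polyfun G" "g2 \<in> polyfun G" "g3 \<in> polyfun G" "g4 \<in> polyfun G"
  shows "(\<lambda>x. f (g1 x, g2 x, g3 x, g4 x)) \<in> polyfun G"
  using assms(1) by (rule polyfun_comp) (auto simp: coords4_def assms)

lemma ev3_smult [simp]: "ev3 (smult c p) (x, y, z) = ev2 c x y * ev3 p (x, y, z)"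
  by (simp add: ev3_def)

lemma ev3_poly: "ev3 p (x, y, z) = poly (map_poly (\<lambda>c. ev2 c x y) p) z"
  by (induction p) (simp_all add: map_poly_pCons)

text \<open>Modulo \<open>s\<close> the equation \<open>r * s = H\<close> leaves the curve times the
  \<open>r\<close>-line, so primality of \<open>H\<close> gives primality of \<open>s\<close>. The
  Nullstellensatz for the single polynomial \<open>H\<close> turns vanishing into divisibility, and
  \<open>no_line\<close> makes the locus where \<open>s\<close> is nonzero dense.\<close>

locale hyperbolic_threefold =
  fixes H :: "'k::field_char_0 poly poly"
  assumes prime_H: "prime_elem H"
    and nullstellensatz: "\<And>p. (\<And>y z. ev2 H y z = 0 \<Longrightarrow> ev2 p y z = 0) \<Longrightarrow> H dvd p"
    and no_line: "\<And>z. \<exists>y. ev2 H y z \<noteq> 0"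
begin

definition V :: "('k \<times> 'k \<times> 'k \<times> 'k) set" where
  "V = {(y, z, r, s). r * s = ev2 H y z}"

lemma V_iff [simp]: "(y, z, r, s) \<in> V \<longleftrightarrow> r * s = ev2 H y z"
  by (simp add: V_def)

text \<open>Each factor \<open>r\<close> is traded for \<open>H\<close> at the cost of one power of
  \<open>s\<close>, which leaves a polynomial in \<open>y\<close>, \<open>z\<close>,
  \<open>s\<close>.\<close>

lemma clear_denominator:
  assumes "f \<in> polyfun coords4"
  shows "\<exists>N p. \<forall>y z r s. r * s = ev2 H y z \<longrightarrow> s ^ N * f (y, z, r, s) = ev3 p (y, z, s)"
  using assms
proof induction
  case (polyfun_const c)
  show ?case by (intro exI[of _ 0] exI[of _ "[:[:[:c:]:]:]"]) simp
next
  case (polyfun_gen g)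
  then consider "g = (\<lambda>(y, z, r, s). y)" | "g = (\<lambda>(y, z, r, s). z)"
    | "g = (\<lambda>(y, z, r, s). r)" | "g = (\<lambda>(y, z, r, s). s)"
    unfolding coords4_def by blast
  then show ?case
  proof cases
    case 1 then show ?thesis by (intro exI[of _ 0] exI[of _ "[:[:[:0, 1:]:]:]"]) simp
  next
    case 2 then show ?thesis by (intro exI[of _ 0] exI[of _ "[:[:0, 1:]:]"]) simp
  next
    case 3 then show ?thesis
      by (intro exI[of _ 1] exI[of _ "[:H:]"]) (simp add: mult.commute)
  next
    case 4 then show ?thesis by (intro exI[of _ 0] exI[of _ "[:0, 1:]"]) simp
  qed
next
  case (polyfun_add f g)
  then obtain N p M q where
    "\<forall>y z r s. r * s = ev2 H y z \<longrightarrow> s ^ N * f (y, z, r, s) = ev3 p (y, z, s)"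
    "\<forall>y z r s. r * s = ev2 H y z \<longrightarrow> s ^ M * g (y, z, r, s) = ev3 q (y, z, s)" by blast
  then show ?case
    by (intro exI[of _ "N + M"] exI[of _ "[:0, 1:] ^ M * p + [:0, 1:] ^ N * q"])
      (auto simp: power_add algebra_simps)
next
  case (polyfun_mult f g)
  then obtain N p M q where
    "\<forall>y z r s. r * s = ev2 H y z \<longrightarrow> s ^ N * f (y, z, r, s) = ev3 p (y, z, s)"
    "\<forall>y z r s. r * s = ev2 H y z \<longrightarrow> s ^ M * g (y, z, r, s) = ev3 q (y, z, s)" by blast
  note * = this
  have "s ^ (N + M) * (f (y, z, r, s) * g (y, z, r, s)) = ev3 (p * q) (y, z, s)"
    if "r * s = ev2 H y z" for y z r s
  proof -
    have "s ^ (N + M) * (f (y, z, r, s) * g (y, z, r, s)) =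
        (s ^ N * f (y, z, r, s)) * (s ^ M * g (y, z, r, s))" by (simp add: power_add)
    then show ?thesis using * that by simp
  qed
  then show ?case by blast
qed

lemma clear_denominators:
  fixes P :: "'i::finite \<Rightarrow> 'k \<times> 'k \<times> 'k \<times> 'k \<Rightarrow> 'k"
  assumes "\<And>i. P i \<in> polyfun coords4"
  obtains N p where
    "\<And>i y z r s. r * s = ev2 H y z \<Longrightarrow> s ^ N * P i (y, z, r, s) = ev3 (p i) (y, z, s)"
proof -
  from clear_denominator[OF assms] obtain N p where Np:
    "\<And>i y z r s. r * s = ev2 H y z \<Longrightarrow> s ^ N i * P i (y, z, r, s) = ev3 (p i) (y, z, s)" by metis
  define M where "M = (\<Sum>i\<in>UNIV. N i)"
  have le: "N i \<le> M" for i unfolding M_def by (rule member_le_sum) auto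
  have "s ^ M * P i (y, z, r, s) = ev3 ([:0, 1:] ^ (M - N i) * p i) (y, z, s)"
    if "r * s = ev2 H y z" for i y z r s
  proof -
    have "s ^ M = s ^ (M - N i) * s ^ N i" using le[of i] by (simp flip: power_add)
    then show ?thesis using Np[OF that, of i] by (simp add: mult.assoc)
  qed
  then show ?thesis by (rule that[of M "\<lambda>i. [:0, 1:] ^ (M - N i) * p i"])
qed

lemma split_s:
  assumes "f \<in> polyfun coords4"
  shows "\<exists>g\<in>polyfun coords4. \<exists>p. \<forall>y z r s. f (y, z, r, s) = ev3 p (y, z, r) + s * g (y, z, r, s)"
  using assms
proof induction
  case (polyfun_const c)
  show ?case by (intro bexI[of _ "\<lambda>_. 0"] exI[of _ "[:[:[:c:]:]:]"]) (simp_all add: polyfun.intros)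
next
  case (polyfun_gen g)
  then consider "g = (\<lambda>(y, z, r, s). y)" | "g = (\<lambda>(y, z, r, s). z)"
    | "g = (\<lambda>(y, z, r, s). r)" | "g = (\<lambda>(y, z, r, s). s)"
    unfolding coords4_def by blast
  then show ?case
  proof cases
    case 1 then show ?thesis
      by (intro bexI[of _ "\<lambda>_. 0"] exI[of _ "[:[:[:0, 1:]:]:]"]) (simp_all add: polyfun.intros)
  next
    case 2 then show ?thesis
      by (intro bexI[of _ "\<lambda>_. 0"] exI[of _ "[:[:0, 1:]:]"]) (simp_all add: polyfun.intros)
  next
    case 3 then show ?thesis
      by (intro bexI[of _ "\<lambda>_. 0"] exI[of _ "[:0, 1:]"]) (simp_all add: polyfun.intros)
  next
    case 4 then show ?thesis
      by (intro bexI[of _ "\<lambda>_. 1"] exI[of _ 0]) (simp_all add: polyfun.intros)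
  qed
next
  case (polyfun_add f g)
  then obtain f' p g' q where "f' \<in> polyfun coords4" "g' \<in> polyfun coords4"
    "\<forall>y z r s. f (y, z, r, s) = ev3 p (y, z, r) + s * f' (y, z, r, s)"
    "\<forall>y z r s. g (y, z, r, s) = ev3 q (y, z, r) + s * g' (y, z, r, s)" by blast
  then show ?case
    by (intro bexI[of _ "\<lambda>x. f' x + g' x"] exI[of _ "p + q"]) (auto simp: algebra_simps intro: polyfun_intros)
next
  case (polyfun_mult f g)
  then obtain f' p g' q where *: "f' \<in> polyfun coords4" "g' \<in> polyfun coords4"
    "\<forall>y z r s. f (y, z, r, s) = ev3 p (y, z, r) + s * f' (y, z, r, s)"
    "\<forall>y z r s. g (y, z, r, s) = ev3 q (y, z, r) + s * g' (y, z, r, s)" by blast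
  have "(\<lambda>x. f' x * g x + ev3 p (fst x, fst (snd x), fst (snd (snd x))) * g' x) \<in> polyfun coords4"
    using * polyfun_mult.hyps by (intro polyfun_intros polyfun_ev3 polyfun_coords4')
  then show ?case
    using * by (intro bexI[of _ "\<lambda>x. f' x * g x + ev3 p (fst x, fst (snd x), fst (snd (snd x))) * g' x"]
        exI[of _ "p * q"]) (auto simp: algebra_simps)
qed

text \<open>Over a fixed point of the curve the polynomial in \<open>r\<close> is zero, so each of
  its coefficients vanishes on the curve and is a multiple of \<open>H\<close>.\<close>

lemma const_H_dvd:
  assumes "\<And>y z r. ev2 H y z = 0 \<Longrightarrow> ev3 p (y, z, r) = 0"
  shows "[:H:] dvd p"
proof -
  have "H dvd coeff p i" for i
  proof (rule nullstellensatz)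
    fix y z assume "ev2 H y z = 0"
    then have "\<forall>r. poly (map_poly (\<lambda>c. ev2 c y z) p) r = 0" using assms by (simp add: ev3_poly)
    then have "map_poly (\<lambda>c. ev2 c y z) p = 0" by (simp only: poly_all_0_iff_0)
    then show "ev2 (coeff p i) y z = 0"
      by (metis coeff_0 coeff_map_poly ev2_simps(1))
  qed
  then show ?thesis by (simp add: const_poly_dvd_iff)
qed

text \<open>The part of \<open>f\<close> free of \<open>s\<close> vanishes on the curve, so it is a
  multiple of \<open>H\<close>, and on the threefold \<open>H\<close> is
  \<open>r * s\<close>.\<close>

lemma divide_by_s:
  assumes f: "f \<in> polyfun coords4" and 0: "\<And>y z r. ev2 H y z = 0 \<Longrightarrow> f (y, z, r, 0) = 0"
  obtains g where "g \<in> polyfun coords4"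
    "\<And>y z r s. r * s = ev2 H y z \<Longrightarrow> f (y, z, r, s) = s * g (y, z, r, s)"
proof -
  obtain g p where g: "g \<in> polyfun coords4"
    "\<And>y z r s. f (y, z, r, s) = ev3 p (y, z, r) + s * g (y, z, r, s)"
    using split_s[OF f] by blast
  have "[:H:] dvd p" by (rule const_H_dvd) (use g(2)[of _ _ _ 0] 0 in simp)
  then obtain q where q: "p = [:H:] * q" by (rule dvdE)
  have "f (y, z, r, s) = s * (r * ev3 q (y, z, r) + g (y, z, r, s))" if "r * s = ev2 H y z" for y z r s
    using that by (simp add: g(2) q algebra_simps)
  moreover have "(\<lambda>x. fst (snd (snd x)) * ev3 q (fst x, fst (snd x), fst (snd (snd x))) + g x) \<in> polyfun coords4"
    using g(1) by (intro polyfun_intros polyfun_ev3 polyfun_coords4')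
  ultimately show ?thesis
    by (intro that[of "\<lambda>x. fst (snd (snd x)) * ev3 q (fst x, fst (snd x), fst (snd (snd x))) + g x"]) auto
qed

text \<open>Primality of \<open>s\<close>, expressed by values: \<open>H\<close> stays prime as a
  constant polynomial in \<open>r\<close>, so the divisor \<open>s = 0\<close> is
  irreducible.\<close>

lemma divisor_irreducible:
  assumes f: "f \<in> polyfun coords4" and g: "g \<in> polyfun coords4"
    and fg: "\<And>y z r. ev2 H y z = 0 \<Longrightarrow> f (y, z, r, 0) * g (y, z, r, 0) = 0"
    and y: "ev2 H y z = 0" "g (y, z, r, 0) \<noteq> 0"
    and y': "ev2 H y' z' = 0"
  shows "f (y', z', r', 0) = 0"
proof -
  obtain p where p: "\<And>y z r. f (y, z, r, 0) = ev3 p (y, z, r)"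
    using split_s[OF f] by (metis add.right_neutral mult_zero_left)
  obtain q where q: "\<And>y z r. g (y, z, r, 0) = ev3 q (y, z, r)"
    using split_s[OF g] by (metis add.right_neutral mult_zero_left)
  have "[:H:] dvd p * q" by (rule const_H_dvd) (use fg p q in simp)
  then have "[:H:] dvd p \<or> [:H:] dvd q"
    by (rule prime_elem_dvd_multD[OF lift_prime_elem_poly[OF prime_H]])
  then show ?thesis
  proof
    assume "[:H:] dvd p"
    then obtain c where "p = [:H:] * c" by (rule dvdE)
    then show ?thesis using p y' by simp
  next
    assume "[:H:] dvd q"
    then obtain c where "q = [:H:] * c" by (rule dvdE)
    then show ?thesis using q y by simp
  qed
qed

text \<open>Points with \<open>s = 0\<close> are reached in two limits, along which a univariate
  polynomial vanishes at all but finitely many arguments.\<close>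

lemma s_nonzero_dense:
  assumes f: "f \<in> polyfun coords4"
    and 0: "\<And>y z r s. r * s = ev2 H y z \<Longrightarrow> s \<noteq> 0 \<Longrightarrow> f (y, z, r, s) = 0"
    and V: "r * s = ev2 H y z"
  shows "f (y, z, r, s) = 0"
proof (cases "s = 0")
  case True
  \<comment> \<open>For \<open>r\<close> nonzero, vary \<open>y\<close> alone and put
    \<open>s = H / r\<close>; by \<open>no_line\<close> this curve in the threefold meets
    \<open>s = 0\<close> only finitely often.\<close>
  have *: "f (y, z, r, 0) = 0" if "ev2 H y z = 0" "r \<noteq> 0" for y z r
  proof -
    have id: "(\<lambda>x. x) \<in> polyfun {\<lambda>x::'k. x}" by (rule polyfun_gen) simp
    have "(\<lambda>e. ev2 H (y + e) z) \<in> polyfun {\<lambda>x. x}"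
      by (intro polyfun_ev2 polyfun_intros id)
    then obtain h where h: "\<And>e. ev2 H (y + e) z = poly h e" by (rule polyfun_univariate) blast
    have "(\<lambda>e. f (y + e, z, r, inverse r * ev2 H (y + e) z)) \<in> polyfun {\<lambda>x. x}"
      by (intro polyfun_coords4_comp[OF f] polyfun_intros polyfun_ev2 id)
    then obtain p where p: "\<And>e. f (y + e, z, r, inverse r * ev2 H (y + e) z) = poly p e"
      by (rule polyfun_univariate) blast
    have "\<forall>e. poly (p * h) e = 0"
      using 0[of r "inverse r * ev2 H (y + _) z" "y + _" z] that(2)
      by (auto simp flip: p h)
    then have "p * h = 0" by (simp only: poly_all_0_iff_0)
    moreover have "h \<noteq> 0" using no_line[of z] h by (metis add_diff_cancel_left' diff_add_cancel poly_0)
    ultimately have "p = 0" by simp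
    then show ?thesis using p[of 0] that by simp
  qed
  have H0: "ev2 H y z = 0" using V True by simp
  \<comment> \<open>The value \<open>r = 0\<close> is then a limit along the line of varying
    \<open>r\<close>, which lies in the threefold because \<open>s\<close> and \<open>H\<close> are
    both zero.\<close>
  have "(\<lambda>e. f (y, z, e, 0)) \<in> polyfun {\<lambda>x. x}"
    by (intro polyfun_coords4_comp[OF f] polyfun_intros polyfun_gen) simp
  then obtain p where p: "\<And>e. f (y, z, e, 0) = poly p e" by (rule polyfun_univariate) blast
  have "\<forall>e. poly (p * [:0, 1:]) e = 0" using *[OF H0] by (auto simp flip: p)
  then have "p * [:0, 1:] = 0" by (simp only: poly_all_0_iff_0)
  then have "p = 0" by simp
  then show ?thesis using p True by simp
qed (use 0 V in simp)

end

context hyperbolic_threefold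
begin

text \<open>Nagata's argument: the coordinate ring is factorial since inverting the prime \<open>s\<close> gives a
  localisation of a polynomial ring.\<close>

theorem proportional_family:
  fixes \<P> :: "('i::finite \<Rightarrow> 'k \<times> 'k \<times> 'k \<times> 'k \<Rightarrow> 'k) set"
  assumes poly: "\<And>P i. P \<in> \<P> \<Longrightarrow> P i \<in> polyfun coords4"
    and wedge: "\<And>P Q i j x. P \<in> \<P> \<Longrightarrow> Q \<in> \<P> \<Longrightarrow> x \<in> V \<Longrightarrow> P i x * Q j x = P j x * Q i x"
    and nz: "\<And>x. x \<in> V \<Longrightarrow> \<exists>P\<in>\<P>. \<exists>i. P i x \<noteq> 0"
  obtains p where "\<And>i. p i \<in> polyfun coords4" and "\<And>x. x \<in> V \<Longrightarrow> \<exists>i. p i x \<noteq> 0"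
    and "\<And>P. P \<in> \<P> \<Longrightarrow> \<exists>l\<in>polyfun coords4. \<forall>x\<in>V. \<forall>i. P i x = l x * p i x"
proof -
  have "\<exists>y z. ev2 H y z = 0"
  proof (rule ccontr)
    assume "\<not> ?thesis"
    then have "H dvd 1" by (intro nullstellensatz) simp
    with prime_elem_not_unit[OF prime_H] show False by contradiction
  qed
  then obtain y0 z0 where yz0: "ev2 H y0 z0 = 0" by blast
  \<comment> \<open>The chosen point has \<open>s = 0\<close>; a member that is nonzero there will
    bound the powers of \<open>s\<close> that can be split off.\<close>
  then obtain Q k where Q: "Q \<in> \<P>" "Q k (y0, z0, 0, 0) \<noteq> 0" using nz[of "(y0, z0, 0, 0)"] by auto
  obtain N q where q: "\<And>i y z r s. r * s = ev2 H y z \<Longrightarrow> s ^ N * Q i (y, z, r, s) = ev3 (q i) (y, z, s)"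
    by (rule clear_denominators[OF poly[OF Q(1)]]) (rule that)
  have "q k \<noteq> 0"
  proof
    assume "q k = 0"
    then have "Q k (y, z, r, s) = 0" if "r * s = ev2 H y z" "s \<noteq> 0" for y z r s
      using q[OF that(1), of k] that(2) by simp
    then have "Q k (y0, z0, 0, 0) = 0"
      by (rule s_nonzero_dense[OF poly[OF Q(1)]]) (use yz0 in auto)
    with Q(2) show False by simp
  qed
  then obtain g h where g: "g \<noteq> 0" "\<And>i. q i = g * h i" "\<And>\<pi>. prime_elem \<pi> \<Longrightarrow> \<exists>i. \<not> \<pi> dvd h i"
    by (rule primitive_vector_exists) (rule that)
  have hk: "h k \<noteq> 0" using \<open>q k \<noteq> 0\<close> g(2)[of k] by (metis mult_zero_right)
  \<comment> \<open>Outside \<open>s = 0\<close> the threefold has coordinates \<open>y\<close>,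
    \<open>z\<close>, \<open>s\<close>, so the family can be compared in a polynomial ring, where
    every member is a multiple of the primitive vector \<open>h\<close>.\<close>
  have a: "\<exists>M l. \<forall>y z r s i. r * s = ev2 H y z \<longrightarrow> s ^ M * P i (y, z, r, s) = ev3 l (y, z, s) * ev3 (h i) (y, z, s)"
    if P: "P \<in> \<P>" for P
  proof -
    obtain M p where p: "\<And>i y z r s. r * s = ev2 H y z \<Longrightarrow> s ^ M * P i (y, z, r, s) = ev3 (p i) (y, z, s)"
      by (rule clear_denominators[OF poly[OF P]]) (rule that)
    have ph: "p i * h j = p j * h i" for i j
    proof -
      have "[:0, 1:] * g * (p i * h j - p j * h i) = 0"
      proof (rule ev3_eq_0, clarify)
        fix y z s
        show "ev3 ([:0, 1:] * g * (p i * h j - p j * h i)) (y, z, s) = 0"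
        proof (cases "s = 0")
          case False
          define r where "r = ev2 H y z / s"
          have V: "r * s = ev2 H y z" using False by (simp add: r_def)
          have "ev3 (p i) (y, z, s) * ev3 (q j) (y, z, s) = ev3 (p j) (y, z, s) * ev3 (q i) (y, z, s)"
            using wedge[OF P Q(1), of "(y, z, r, s)" i j] V
            by (simp add: mult.assoc mult.left_commute flip: p[OF V] q[OF V])
          then show ?thesis by (simp add: g(2) algebra_simps)
        qed simp
      qed
      then show ?thesis using g(1) by simp
    qed
    obtain l where l: "\<And>i. p i = l * h i"
      by (rule proportional_to_primitive[of h k p, OF hk]; (rule g(3) | rule ph | rule that))
    have "s ^ M * P i (y, z, r, s) = ev3 l (y, z, s) * ev3 (h i) (y, z, s)"
      if "r * s = ev2 H y z" for y z r s i
      using p[OF that, of i] by (simp add: l)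
    then show ?thesis by blast
  qed
  \<comment> \<open>\<open>h\<close> is primitive in \<open>y\<close>, \<open>z\<close>,
    \<open>s\<close>, but on the threefold \<open>H\<close> is a multiple of \<open>s\<close>, so
    all its entries may still become divisible by \<open>s\<close> there. The largest such power has
    to be removed.\<close>
  define J where "J j \<longleftrightarrow> (\<exists>p. (\<forall>i. p i \<in> polyfun coords4) \<and>
    (\<forall>y z r s i. r * s = ev2 H y z \<longrightarrow> s ^ j * p i (y, z, r, s) = ev3 (h i) (y, z, s)))" for j
  have "J 0" unfolding J_def
    by (intro exI[of _ "\<lambda>i x. ev3 (h i) (fst x, fst (snd x), snd (snd (snd x)))"])
      (simp add: polyfun_ev3 polyfun_coords4')
  obtain M l where l: "\<And>y z r s i. r * s = ev2 H y z \<Longrightarrow>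
      s ^ M * Q i (y, z, r, s) = ev3 l (y, z, s) * ev3 (h i) (y, z, s)" using a[OF Q(1)] by blast
  \<comment> \<open>A higher power of \<open>s\<close> would make \<open>Q k\<close> divisible by
    \<open>s\<close>, contrary to its value at the point chosen above.\<close>
  have bound: "j \<le> M" if Jj: "J j" for j
  proof (rule ccontr)
    assume "\<not> j \<le> M"
    then obtain d where j: "j = M + Suc d" by (metis add_Suc_right less_iff_Suc_add not_le)
    obtain p where p: "\<And>i. p i \<in> polyfun coords4"
      "\<And>y z r s i. r * s = ev2 H y z \<Longrightarrow> s ^ j * p i (y, z, r, s) = ev3 (h i) (y, z, s)"
      using Jj unfolding J_def by blast
    define f where "f = (\<lambda>x. Q k x - ev3 l (fst x, fst (snd x), snd (snd (snd x))) *
        (snd (snd (snd x)) ^ Suc d * p k x))"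
    have f: "f \<in> polyfun coords4" unfolding f_def
      by (intro polyfun_intros polyfun_ev3 polyfun_coords4' p poly Q)
    have "f (y, z, r, s) = 0" if "r * s = ev2 H y z" "s \<noteq> 0" for y z r s
    proof -
      have "s ^ M * f (y, z, r, s) = 0"
        using l[OF that(1), of k] p(2)[OF that(1), of k]
        by (simp add: f_def j power_add algebra_simps)
      then show ?thesis using that by simp
    qed
    then have "f (y0, z0, 0, 0) = 0" by (rule s_nonzero_dense[OF f]) (use yz0 in auto)
    with Q(2) show False by (simp add: f_def)
  qed
  have "\<exists>j. J j \<and> \<not> J (Suc j)"
  proof (rule ccontr)
    assume "\<not> ?thesis"
    then have "J j" for j using \<open>J 0\<close> by (induction j) auto
    then have "J (Suc M)" by blast
    from bound[OF this] show False by simp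
  qed
  then obtain j p where p: "\<And>i. p i \<in> polyfun coords4"
      "\<And>y z r s i. r * s = ev2 H y z \<Longrightarrow> s ^ j * p i (y, z, r, s) = ev3 (h i) (y, z, s)"
    and max: "\<not> J (Suc j)"
    unfolding J_def by metis
  have "\<exists>i y z r. ev2 H y z = 0 \<and> p i (y, z, r, 0) \<noteq> 0"
  proof (rule ccontr)
    assume "\<not> ?thesis"
    then have "\<exists>g. g \<in> polyfun coords4 \<and> (\<forall>y z r s. r * s = ev2 H y z \<longrightarrow> p i (y, z, r, s) = s * g (y, z, r, s))" for i
      by (metis divide_by_s[OF p(1)])
    then obtain g where g: "\<And>i. g i \<in> polyfun coords4"
      "\<And>i y z r s. r * s = ev2 H y z \<Longrightarrow> p i (y, z, r, s) = s * g i (y, z, r, s)" by metis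
    have "J (Suc j)" unfolding J_def using g p(2) by (intro exI[of _ g]) (simp add: mult_ac)
    with max show False by simp
  qed
  then obtain i1 y1 z1 r1 where i1: "ev2 H y1 z1 = 0" "p i1 (y1, z1, r1, 0) \<noteq> 0" by blast
  have c: "\<exists>l\<in>polyfun coords4. \<forall>y z r s i. r * s = ev2 H y z \<longrightarrow> P i (y, z, r, s) = l (y, z, r, s) * p i (y, z, r, s)"
    if P: "P \<in> \<P>" for P
  proof -
    \<comment> \<open>\<open>K M\<close> allows \<open>M\<close> powers of \<open>s\<close> as
      denominator. If the least such \<open>M\<close> were positive, the multiplier times
      \<open>p i1\<close> would vanish on \<open>s = 0\<close>; since \<open>p i1\<close> does not,
      the multiplier does, and one \<open>s\<close> cancels.\<close>
    define K where "K M \<longleftrightarrow> (\<exists>l\<in>polyfun coords4. \<forall>y z r s i. r * s = ev2 H y z \<longrightarrow>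
        s ^ M * P i (y, z, r, s) = l (y, z, r, s) * p i (y, z, r, s))" for M
    obtain M l where l: "\<And>y z r s i. r * s = ev2 H y z \<Longrightarrow>
        s ^ M * P i (y, z, r, s) = ev3 l (y, z, s) * ev3 (h i) (y, z, s)" using a[OF P] by blast
    have "s ^ M * P i (y, z, r, s) = (ev3 l (y, z, s) * s ^ j) * p i (y, z, r, s)"
      if "r * s = ev2 H y z" for y z r s i
      using l[OF that, of i] p(2)[OF that, of i] by (simp add: mult.assoc)
    moreover have "(\<lambda>x. ev3 l (fst x, fst (snd x), snd (snd (snd x))) * snd (snd (snd x)) ^ j) \<in> polyfun coords4"
      by (intro polyfun_intros polyfun_ev3 polyfun_coords4')
    ultimately have "K M" unfolding K_def
      by (intro bexI[of _ "\<lambda>x. ev3 l (fst x, fst (snd x), snd (snd (snd x))) * snd (snd (snd x)) ^ j"]) simp_all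
    then have "K (LEAST M. K M)" by (rule LeastI)
    moreover have "(LEAST M. K M) = 0"
    proof (rule ccontr)
      assume "(LEAST M. K M) \<noteq> 0"
      then obtain m where m: "(LEAST M. K M) = Suc m" using not0_implies_Suc by blast
      have "K (Suc m)" using \<open>K (LEAST M. K M)\<close> unfolding m .
      then obtain l where l: "l \<in> polyfun coords4"
        "\<And>y z r s i. r * s = ev2 H y z \<Longrightarrow> s ^ Suc m * P i (y, z, r, s) = l (y, z, r, s) * p i (y, z, r, s)"
        unfolding K_def by blast
      have l0: "l (y, z, r, 0) = 0" if "ev2 H y z = 0" for y z r
        by (rule divisor_irreducible[OF l(1) p(1)[of i1] _ i1 that])
          (use l(2)[of _ 0 _ _ i1] in auto)
      obtain l' where l': "l' \<in> polyfun coords4"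
        "\<And>y z r s. r * s = ev2 H y z \<Longrightarrow> l (y, z, r, s) = s * l' (y, z, r, s)"
        by (rule divide_by_s[OF l(1)]; (rule l0 | rule that))
      have "s ^ m * P i (y, z, r, s) = l' (y, z, r, s) * p i (y, z, r, s)" if "r * s = ev2 H y z" for y z r s i
      proof -
        define f where "f = (\<lambda>x. snd (snd (snd x)) ^ m * P i x - l' x * p i x)"
        have f: "f \<in> polyfun coords4" unfolding f_def
          by (intro polyfun_intros polyfun_coords4' poly P l' p)
        have "f (y, z, r, s) = 0" if "r * s = ev2 H y z" "s \<noteq> 0" for y z r s
        proof -
          have "s * f (y, z, r, s) = 0"
            using l(2)[OF that(1), of i] l'(2)[OF that(1)] by (simp add: f_def algebra_simps)
          then show ?thesis using that by simp
        qed
        then have "f (y, z, r, s) = 0" by (rule s_nonzero_dense[OF f _ that])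
        then show ?thesis by (simp add: f_def)
      qed
      then have "K m" unfolding K_def using l'(1) by blast
      then show False using m not_less_Least[of m K] by simp
    qed
    ultimately have "K 0" by simp
    then show ?thesis unfolding K_def by simp
  qed
  show ?thesis
  proof (rule that)
    show "p i \<in> polyfun coords4" for i by (rule p)
    show c': "\<exists>l\<in>polyfun coords4. \<forall>x\<in>V. \<forall>i. P i x = l x * p i x" if "P \<in> \<P>" for P
      using c[OF that] by (auto simp: V_def)
    show "\<exists>i. p i x \<noteq> 0" if "x \<in> V" for x
      using nz[OF that] c' that by (metis mult_zero_right)
  qed
qed

end

section \<open>The branch curve\<close>

text \<open>The discriminant of the cubic with respect to \<open>x\<^sub>2\<close> at \<open>x\<^sub>1 = 1\<close>, \<open>x\<^sub>5 = 0\<close>, in the variables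
  \<open>y = x\<^sub>3\<close> and \<open>z = x\<^sub>4\<close>.\<close>

definition branch :: "'a::comm_ring_1 \<Rightarrow> 'a \<Rightarrow> 'a \<Rightarrow> 'a \<Rightarrow> 'a poly poly" where
  "branch a b1 b2 b3 =
    [:[:b1\<^sup>2 - 4 * a, - 4 * b2, - 4:], [:- 4 * b3, 2 * b1:], [:- 4, 0, 1:]:]"

lemma ev2_branch:
  "ev2 (branch a b1 b2 b3) y z = (y * z + b1)\<^sup>2 - 4 * (y\<^sup>2 + z\<^sup>2 + b2 * y + b3 * z + a)"
  by (simp add: branch_def power2_eq_square algebra_simps)

text \<open>At x1 = 1 the derivative in x5 of the cubic forces x5 = 0. What is left is the surface
  in x2, x3, x4 with its gradient; the derivative in x1 follows by Euler's relation. So this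
  excludes singular points of the threefold with x1 nonzero.\<close>

definition nonsingular :: "'a::comm_ring_1 \<Rightarrow> 'a \<Rightarrow> 'a \<Rightarrow> 'a \<Rightarrow> bool" where
  "nonsingular a b1 b2 b3 \<longleftrightarrow> \<not> (\<exists>x y z.
     x * y * z + x\<^sup>2 + y\<^sup>2 + z\<^sup>2 + b1 * x + b2 * y + b3 * z + a = 0 \<and>
     y * z + 2 * x + b1 = 0 \<and> x * z + 2 * y + b2 = 0 \<and> x * y + 2 * z + b3 = 0)"

lemma nonsingular_swap23: "nonsingular a b1 b2 b3 \<Longrightarrow> nonsingular a b1 b3 b2"
  unfolding nonsingular_def
proof (elim contrapos_nn exE conjE)
  fix x y z
  assume "x * y * z + x\<^sup>2 + y\<^sup>2 + z\<^sup>2 + b1 * x + b3 * y + b2 * z + a = 0"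
    "y * z + 2 * x + b1 = 0" "x * z + 2 * y + b3 = 0" "x * y + 2 * z + b2 = 0"
  then show "\<exists>x y z. x * y * z + x\<^sup>2 + y\<^sup>2 + z\<^sup>2 + b1 * x + b2 * y + b3 * z + a = 0 \<and>
     y * z + 2 * x + b1 = 0 \<and> x * z + 2 * y + b2 = 0 \<and> x * y + 2 * z + b3 = 0"
    by (intro exI[of _ x] exI[of _ z] exI[of _ y]) (simp add: ac_simps)
qed

lemma four_times_zero: "4 * x = 0 \<Longrightarrow> x = 0" for x :: "'a::field_char_0"
  by simp

text \<open>The last two hypotheses are the partial derivatives of the discriminant. Over a point of
  the branch curve the quadratic equation in x2 has the double root \<open>x\<close>, and a singular
  point of the curve lifts to a singular point of the surface at this root.\<close>

lemma branch_smooth: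
  fixes a :: "'a::field_char_0"
  assumes "nonsingular a b1 b2 b3" and "ev2 (branch a b1 b2 b3) y z = 0"
    and "2 * z * (y * z + b1) - 8 * y - 4 * b2 = 0" and "2 * y * (y * z + b1) - 8 * z - 4 * b3 = 0"
  shows False
proof -
  define x where "x = - (y * z + b1) / 2"
  have x: "y * z + b1 = - 2 * x" by (simp add: x_def)
  have "4 * (x * y * z + x\<^sup>2 + y\<^sup>2 + z\<^sup>2 + b1 * x + b2 * y + b3 * z + a) =
      4 * x * (y * z + b1) + 4 * x\<^sup>2 + 4 * (y\<^sup>2 + z\<^sup>2 + b2 * y + b3 * z + a)"
    by (simp add: algebra_simps)
  also have "\<dots> = - ev2 (branch a b1 b2 b3) y z"
    unfolding ev2_branch x by (simp add: power2_eq_square algebra_simps)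
  finally have 1: "x * y * z + x\<^sup>2 + y\<^sup>2 + z\<^sup>2 + b1 * x + b2 * y + b3 * z + a = 0"
    unfolding assms(2) by (rule four_times_zero[OF trans]) simp
  have "y * z + 2 * x + b1 = (y * z + b1) + 2 * x" by simp
  then have 2: "y * z + 2 * x + b1 = 0" unfolding x by simp
  have "4 * (x * z + 2 * y + b2) = - (2 * z * (y * z + b1) - 8 * y - 4 * b2)"
    "4 * (x * y + 2 * z + b3) = - (2 * y * (y * z + b1) - 8 * z - 4 * b3)"
    unfolding x by (simp_all add: algebra_simps)
  then have "4 * (x * z + 2 * y + b2) = 0" "4 * (x * y + 2 * z + b3) = 0"
    unfolding assms(3,4) by simp_all
  note 3 = this[THEN four_times_zero]
  show False using assms(1) 1 2 3 unfolding nonsingular_def by blast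
qed

lemma quadratic_root:
  fixes A :: "'a::alg_closed_field"
  assumes "A \<noteq> 0"
  obtains z where "A * z\<^sup>2 + B * z + C = 0"
proof -
  have "degree [:C, B, A:] > 0" using assms by simp
  then obtain z where "poly [:C, B, A:] z = 0" using alg_closed_imp_poly_has_root by blast
  then have "A * z\<^sup>2 + B * z + C = 0" by (simp add: power2_eq_square algebra_simps)
  then show ?thesis by (rule that)
qed

text \<open>If the quadratic in \<open>z\<close> is zero, so is the derivative in \<open>z\<close>
  along the line. The derivative in \<open>y\<close> is there a quadratic in \<open>z\<close> with
  leading coefficient \<open>2 * y\<close>, nonzero since \<open>y\<close> squared is 4, so it has a
  root: a singular point.\<close>

lemma branch_no_vertical_line:
  fixes a :: "'a::{alg_closed_field, field_char_0}"
  assumes "nonsingular a b1 b2 b3"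
  shows "\<exists>z. ev2 (branch a b1 b2 b3) y z \<noteq> 0"
proof (rule ccontr)
  assume "\<not> ?thesis"
  then have 0: "ev2 (branch a b1 b2 b3) y z = 0" for z by simp
  have e: "(y\<^sup>2 - 4) * z\<^sup>2 + (2 * b1 * y - 4 * b3) * z + (b1\<^sup>2 - 4 * y\<^sup>2 - 4 * b2 * y - 4 * a) = 0" for z
    using 0[of z] unfolding ev2_branch by (simp add: power2_eq_square algebra_simps)
  have c: "b1\<^sup>2 - 4 * y\<^sup>2 - 4 * b2 * y - 4 * a = 0" using e[of 0] by simp
  have p: "(y\<^sup>2 - 4) + (2 * b1 * y - 4 * b3) = 0" using e[of 1] c by simp
  have "(y\<^sup>2 - 4) - (2 * b1 * y - 4 * b3) =
      (y\<^sup>2 - 4) * (- 1)\<^sup>2 + (2 * b1 * y - 4 * b3) * (- 1) + (b1\<^sup>2 - 4 * y\<^sup>2 - 4 * b2 * y - 4 * a)"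
    unfolding c by simp
  then have m: "(y\<^sup>2 - 4) - (2 * b1 * y - 4 * b3) = 0" unfolding e .
  have "2 * (y\<^sup>2 - 4) = ((y\<^sup>2 - 4) + (2 * b1 * y - 4 * b3)) + ((y\<^sup>2 - 4) - (2 * b1 * y - 4 * b3))"
    by simp
  then have y2: "y\<^sup>2 - 4 = 0" unfolding p m by simp
  then have lin: "2 * b1 * y - 4 * b3 = 0" using p by simp
  have "2 * y \<noteq> 0" using y2 by auto
  then obtain z where z: "2 * y * z\<^sup>2 + 2 * b1 * z + (- 8 * y - 4 * b2) = 0"
    by (rule quadratic_root)
  show False
  proof (rule branch_smooth[OF assms 0])
    show "2 * z * (y * z + b1) - 8 * y - 4 * b2 = 0"
      using z by (simp add: power2_eq_square algebra_simps)
    have "2 * y * (y * z + b1) - 8 * z - 4 * b3 = 2 * z * (y\<^sup>2 - 4) + (2 * b1 * y - 4 * b3)"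
      by (simp add: power2_eq_square algebra_simps)
    then show "2 * y * (y * z + b1) - 8 * z - 4 * b3 = 0" unfolding y2 lin by simp
  qed
qed

lemma branch_no_horizontal_line:
  fixes a :: "'a::{alg_closed_field, field_char_0}"
  assumes "nonsingular a b1 b2 b3"
  shows "\<exists>y. ev2 (branch a b1 b2 b3) y z \<noteq> 0"
proof -
  have "ev2 (branch a b1 b3 b2) z y = ev2 (branch a b1 b2 b3) y z" for y
    by (simp add: ev2_branch algebra_simps)
  with branch_no_vertical_line[OF nonsingular_swap23[OF assms], of z] show ?thesis by simp
qed

section \<open>Irreducibility of the branch curve and its Nullstellensatz\<close>

lemma degree_branch: "degree (branch a b1 b2 b3 :: 'a::field_char_0 poly poly) = 2"
  by (simp add: branch_def)

lemma branch_nonzero: "branch a b1 b2 b3 \<noteq> (0 :: 'a::field_char_0 poly poly)"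
proof
  assume "branch a b1 b2 b3 = 0"
  then have "degree (branch a b1 b2 b3) = 0" by (simp only: degree_0)
  then show False unfolding degree_branch by simp
qed

lemma branch_constant_factor:
  fixes a :: "'a::{alg_closed_field, field_char_0}"
  assumes "nonsingular a b1 b2 b3" and "branch a b1 b2 b3 = [:c:] * q"
  shows "[:c:] dvd 1"
proof -
  have "degree c = 0"
  proof (rule ccontr)
    assume "degree c \<noteq> 0"
    then obtain y where "poly c y = 0" using alg_closed_imp_poly_has_root by blast
    then have "ev2 (branch a b1 b2 b3) y z = 0" for z unfolding assms(2) by simp
    with branch_no_vertical_line[OF assms(1), of y] show False by simp
  qed
  then obtain k where k: "c = [:k:]" by (rule degree_eq_zeroE)
  have "branch a b1 b2 b3 \<noteq> 0" by (rule branch_nonzero)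
  then have "k \<noteq> 0" unfolding assms(2) k by (rule contrapos_nn) simp
  then have "1 = [:c:] * [:[:inverse k:]:]" by (simp add: k)
  then show ?thesis by (rule dvdI)
qed

text \<open>If \<open>p1\<close> is constant, \<open>q1\<close> has degree 2, and the coefficient of
  \<open>z\<close>, of degree at most 1, forces a cancellation that makes \<open>p0\<close> constant
  too. The first factor is then a horizontal line.\<close>

lemma branch_linear_factors_degree:
  fixes a :: "'a::{alg_closed_field, field_char_0}"
  assumes ns: "nonsingular a b1 b2 b3"
    and f: "branch a b1 b2 b3 = [:p0, p1:] * [:q0, q1:]"
  shows "degree p1 \<noteq> 0"
proof
  assume d: "degree p1 = 0"
  have e: "p0 * q0 = [:b1\<^sup>2 - 4 * a, - 4 * b2, - 4:]" "p0 * q1 + p1 * q0 = [:- 4 * b3, 2 * b1:]"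
    "p1 * q1 = [:- 4, 0, 1:]"
    using f unfolding branch_def by (simp_all add: ac_simps)
  have nz: "p1 \<noteq> 0" "q1 \<noteq> 0" "p0 \<noteq> 0" "q0 \<noteq> 0" using e(1,3) by auto
  have d1: "degree q1 = 2" using degree_mult_eq[OF nz(1,2)] d unfolding e(3) by simp
  have d0: "degree p0 + degree q0 = 2" using degree_mult_eq[OF nz(3,4)] unfolding e(1) by simp
  have le: "degree (p0 * q1 + p1 * q0) \<le> 1" unfolding e(2) by simp
  have dd: "degree (p0 * q1) = degree p0 + 2" "degree (p1 * q0) = degree q0"
    using degree_mult_eq[OF nz(3,2)] degree_mult_eq[OF nz(1,4)] d d1 by simp_all
  have "degree q0 = degree p0 + 2"
  proof (rule ccontr)
    assume "degree q0 \<noteq> degree p0 + 2"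
    then have "degree (p0 * q1) < degree (p1 * q0) \<or> degree (p1 * q0) < degree (p0 * q1)"
      using dd by linarith
    then show False
    proof
      assume *: "degree (p0 * q1) < degree (p1 * q0)"
      from degree_add_eq_right[OF *] le dd * d0 show False by linarith
    next
      assume *: "degree (p1 * q0) < degree (p0 * q1)"
      from degree_add_eq_left[OF *] le dd * d0 show False by linarith
    qed
  qed
  then have "degree p0 = 0" using d0 by simp
  then obtain k l where kl: "p0 = [:k:]" "p1 = [:l:]" using d by (metis degree_eq_zeroE)
  have "ev2 (branch a b1 b2 b3) y (- k / l) = 0" for y
    using nz unfolding f by (simp add: kl)
  with branch_no_horizontal_line[OF ns, of "- k / l"] show False by simp
qed

text \<open>By the degrees all four coefficients are linear in \<open>y\<close>. The two factors
  then meet in the affine plane, and an intersection point of two components is singular.\<close>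

lemma branch_not_product_of_linear:
  fixes a :: "'a::{alg_closed_field, field_char_0}"
  assumes ns: "nonsingular a b1 b2 b3"
    and f: "branch a b1 b2 b3 = [:p0, p1:] * [:q0, q1:]"
  shows False
proof -
  have e: "p0 * q0 = [:b1\<^sup>2 - 4 * a, - 4 * b2, - 4:]" "p0 * q1 + p1 * q0 = [:- 4 * b3, 2 * b1:]"
    "p1 * q1 = [:- 4, 0, 1:]"
    using f unfolding branch_def by (simp_all add: ac_simps)
  have nz: "p1 \<noteq> 0" "q1 \<noteq> 0" "p0 \<noteq> 0" "q0 \<noteq> 0" using e(1,3) by auto
  have "degree p1 \<noteq> 0" by (rule branch_linear_factors_degree[OF ns f])
  moreover have "degree q1 \<noteq> 0"
    by (rule branch_linear_factors_degree[OF ns f[unfolded mult.commute[of "[:p0, p1:]"]]])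
  moreover have "degree p1 + degree q1 = 2"
    using degree_mult_eq[OF nz(1,2)] unfolding e(3) by simp
  ultimately have d1: "degree p1 = 1" "degree q1 = 1" by linarith+
  have d0: "degree p0 + degree q0 = 2" using degree_mult_eq[OF nz(3,4)] unfolding e(1) by simp
  have le: "degree (p0 * q1 + p1 * q0) \<le> 1" unfolding e(2) by simp
  have dd: "degree (p0 * q1) = degree p0 + 1" "degree (p1 * q0) = degree q0 + 1"
    using degree_mult_eq[OF nz(3,2)] degree_mult_eq[OF nz(1,4)] d1 by simp_all
  have "degree p0 = degree q0"
  proof (rule ccontr)
    assume "degree p0 \<noteq> degree q0"
    then have "degree (p0 * q1) < degree (p1 * q0) \<or> degree (p1 * q0) < degree (p0 * q1)"
      using dd by linarith
    then show False
    proof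
      assume *: "degree (p0 * q1) < degree (p1 * q0)"
      from degree_add_eq_right[OF *] le dd * d0 show False by linarith
    next
      assume *: "degree (p1 * q0) < degree (p0 * q1)"
      from degree_add_eq_left[OF *] le dd * d0 show False by linarith
    qed
  qed
  then have d: "degree p0 = 1" "degree q0 = 1" using d0 by linarith+
  have s2: "coeff (p0 * q1) 2 + coeff (p1 * q0) 2 = 0"
    using arg_cong[OF e(2), of "\<lambda>p. coeff p 2"] by (simp add: numeral_2_eq_2)
  have "degree (p1 * q0) = 2" "p1 * q0 \<noteq> 0" using dd(2) d nz by simp_all
  then have c2: "coeff (p1 * q0) 2 \<noteq> 0" by (metis leading_coeff_0_iff)
  \<comment> \<open>\<open>r\<close> is the resultant of the factors in \<open>z\<close>. The
    coefficients of degree 2 cancel in the sum of the two products, so they double in the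
    difference; hence \<open>r\<close> has a root.\<close>
  define r where "r = p1 * q0 - p0 * q1"
  have "coeff r 2 = 2 * coeff (p1 * q0) 2"
    using s2 unfolding r_def coeff_diff by (simp add: eq_neg_iff_add_eq_0 [symmetric])
  then have "coeff r 2 \<noteq> 0" using c2 by simp
  then have "degree r > 0" using le_degree[of r 2] by linarith
  then obtain y where "poly r y = 0" using alg_closed_imp_poly_has_root by blast
  then have y: "poly p1 y * poly q0 y = poly p0 y * poly q1 y" by (simp add: r_def)
  \<comment> \<open>A common zero \<open>z\<close> could only be missing if both factors were
    constant in \<open>z\<close> at this \<open>y\<close>; then \<open>y\<close> would be a double
    root of \<open>p1 * q1\<close>, whose roots 2 and -2 are simple.\<close>
  have "\<not> (poly p1 y = 0 \<and> poly q1 y = 0)"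
  proof
    assume *: "poly p1 y = 0 \<and> poly q1 y = 0"
    then have "poly (p1 * q1) y = 0" "poly (pderiv (p1 * q1)) y = 0"
      by (simp_all add: pderiv_mult)
    then show False unfolding e(3) by (simp add: pderiv_pCons)
  qed
  then obtain z where z: "poly p0 y + z * poly p1 y = 0" "poly q0 y + z * poly q1 y = 0"
  proof (cases "poly p1 y = 0")
    case False
    have "poly p0 y + (- poly p0 y / poly p1 y) * poly p1 y = 0" using False by simp
    moreover have "poly q0 y + (- poly p0 y / poly p1 y) * poly q1 y = 0"
      using False y by (simp add: field_simps)
    ultimately show ?thesis by (rule that)
  next
    case True
    assume "\<not> (poly p1 y = 0 \<and> poly q1 y = 0)"
    then have q: "poly q1 y \<noteq> 0" using True by simp
    have "poly q0 y + (- poly q0 y / poly q1 y) * poly q1 y = 0" using q by simp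
    moreover have "poly p0 y + (- poly q0 y / poly q1 y) * poly p1 y = 0"
      using q y True by simp
    ultimately show ?thesis by (intro that)
  qed
  have "ev2 [:p0, p1:] y z = 0" using z by simp
  then have "ev2 (branch a b1 b2 b3) y z = 0" unfolding f ev2_simps(6) by simp
  moreover have "2 * z * (y * z + b1) - 8 * y - 4 * b2 = 0"
  proof -
    have "2 * z * (y * z + b1) - 8 * y - 4 * b2 =
      poly (pderiv (p0 * q0)) y + z * poly (pderiv (p0 * q1 + p1 * q0)) y + z\<^sup>2 * poly (pderiv (p1 * q1)) y"
      unfolding e by (simp add: pderiv_pCons power2_eq_square algebra_simps)
    also have "\<dots> = (poly p0 y + z * poly p1 y) * (poly (pderiv q0) y + z * poly (pderiv q1) y)
       + (poly q0 y + z * poly q1 y) * (poly (pderiv p0) y + z * poly (pderiv p1) y)"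
      by (simp add: pderiv_mult pderiv_add power2_eq_square algebra_simps)
    finally show ?thesis using z by simp
  qed
  moreover have "2 * y * (y * z + b1) - 8 * z - 4 * b3 = 0"
  proof -
    have "2 * y * (y * z + b1) - 8 * z - 4 * b3 =
      poly (p0 * q1 + p1 * q0) y + 2 * z * poly (p1 * q1) y"
      unfolding e by (simp add: algebra_simps)
    also have "\<dots> = (poly p0 y + z * poly p1 y) * poly q1 y + (poly q0 y + z * poly q1 y) * poly p1 y"
      by (simp add: algebra_simps)
    finally show ?thesis using z by simp
  qed
  ultimately show False by (rule branch_smooth[OF ns])
qed

lemma degree_le_1_eq: "degree p \<le> 1 \<Longrightarrow> p = [:coeff p 0, coeff p 1:]"
  by (rule poly_eqI) (auto simp: coeff_pCons coeff_eq_0 split: nat.splits)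

lemma prime_elem_branch:
  fixes a :: "'a::{alg_closed_field, field_char_0}"
  assumes ns: "nonsingular a b1 b2 b3"
  shows "prime_elem (branch a b1 b2 b3)"
proof -
  have nz: "branch a b1 b2 b3 \<noteq> 0" by (rule branch_nonzero)
  have "irreducible (branch a b1 b2 b3)"
  proof (rule irreducibleI[OF nz])
    show "\<not> branch a b1 b2 b3 dvd 1"
    proof
      assume "branch a b1 b2 b3 dvd 1"
      from dvd_imp_degree_le[OF this] show False by (simp add: degree_branch)
    qed
    fix p q assume pq: "branch a b1 b2 b3 = p * q"
    have "p \<noteq> 0" "q \<noteq> 0" using pq nz by auto
    then have d: "degree p + degree q = 2" using pq degree_branch degree_mult_eq by metis
    consider "degree p = 0" | "degree q = 0" | "degree p = 1" "degree q = 1" using d by linarith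
    then show "p dvd 1 \<or> q dvd 1"
    proof cases
      case 1
      then obtain c where c: "p = [:c:]" by (rule degree_eq_zeroE)
      from branch_constant_factor[OF ns pq[unfolded c]] show ?thesis unfolding c by (rule disjI1)
    next
      case 2
      then obtain c where c: "q = [:c:]" by (rule degree_eq_zeroE)
      from branch_constant_factor[OF ns pq[unfolded c mult.commute[of p]]]
      show ?thesis unfolding c by (rule disjI2)
    next
      case 3
      have "p = [:coeff p 0, coeff p 1:]" "q = [:coeff q 0, coeff q 1:]"
        using 3 by (simp_all only: degree_le_1_eq order_refl)
      with pq have "branch a b1 b2 b3 = [:coeff p 0, coeff p 1:] * [:coeff q 0, coeff q 1:]" by metis
      from branch_not_product_of_linear[OF ns this] show ?thesis by (rule FalseE)
    qed
  qed
  then show ?thesis by (simp only: prime_elem_iff_irreducible)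
qed

text \<open>Pseudo-division in \<open>z\<close> leaves a remainder linear in \<open>z\<close> that
  vanishes on the curve. A nonzero one would have zero resultant with the irreducible quadratic
  \<open>H\<close>, which is impossible; the power of the leading coefficient is then cancelled by
  primality.\<close>

lemma branch_nullstellensatz:
  fixes a :: "'a::{alg_closed_field, field_char_0}"
  assumes ns: "nonsingular a b1 b2 b3"
    and van: "\<And>y z. ev2 (branch a b1 b2 b3) y z = 0 \<Longrightarrow> ev2 p y z = 0"
  shows "branch a b1 b2 b3 dvd p"
proof -
  let ?H = "branch a b1 b2 b3"
  define A0 A1 A2 where A: "A0 = [:b1\<^sup>2 - 4 * a, - 4 * b2, - 4:]" "A1 = [:- 4 * b3, 2 * b1:]"
    "A2 = [:- 4, 0, 1::'a:]"
  have H: "?H = [:A0, A1, A2:]" by (simp add: branch_def A)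
  have A20: "A2 \<noteq> 0" by (simp add: A)
  have nz: "?H \<noteq> 0" by (rule branch_nonzero)
  note prime = prime_elem_branch[OF ns]
  have not_dvd: "\<not> ?H dvd q" if "q \<noteq> 0" "degree q \<le> 1" for q
  proof
    assume "?H dvd q"
    from dvd_imp_degree_le[OF this that(1)] that(2) show False by (simp add: degree_branch)
  qed
  obtain q r where qr: "pseudo_divmod p ?H = (q, r)" by (cases "pseudo_divmod p ?H")
  have lc: "coeff ?H 2 = A2" by (simp add: H numeral_2_eq_2)
  obtain N where pq: "smult (A2 ^ N) p = ?H * q + r" and r: "r = 0 \<or> degree r < 2"
    using pseudo_divmod[OF nz qr] unfolding degree_branch lc by blast
  define n m where "n = coeff r 0" and "m = coeff r 1"
  have rnm: "r = [:n, m:]"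
    unfolding n_def m_def by (rule degree_le_1_eq) (use r in auto)
  have nm: "poly n y + z * poly m y = 0" if "ev2 ?H y z = 0" for y z
  proof -
    have "ev2 (smult (A2 ^ N) p) y z = 0" using van[OF that] by simp
    then have "ev2 r y z = 0" unfolding pq using that by simp
    then show ?thesis by (simp add: rnm)
  qed
  have root: "\<exists>z. poly A0 y + z * poly A1 y + z\<^sup>2 * poly A2 y = 0 \<and> poly n y + z * poly m y = 0"
    if A2y: "poly A2 y \<noteq> 0" for y
  proof -
    obtain z where z: "poly A2 y * z\<^sup>2 + poly A1 y * z + poly A0 y = 0"
      using A2y by (rule quadratic_root)
    then have "ev2 ?H y z = 0" unfolding H by (simp add: power2_eq_square algebra_simps)
    from nm[OF this] z show ?thesis by (intro exI[of _ z]) (simp add: algebra_simps)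
  qed
  have "r = 0"
  proof (cases "m = 0")
    case True
    have "\<forall>y. poly (n * A2) y = 0" using root True by force
    then have "n * A2 = 0" by (simp only: poly_all_0_iff_0)
    then show ?thesis using True A20 rnm by simp
  next
    case False
    have "poly ((m\<^sup>2 * A0 - m * n * A1 + n\<^sup>2 * A2) * A2) y = 0" for y
    proof (cases "poly A2 y = 0")
      case False
      then obtain z where z: "poly A0 y + z * poly A1 y + z\<^sup>2 * poly A2 y = 0" "poly n y + z * poly m y = 0"
        using root by blast
      have n: "poly n y = - (z * poly m y)" using z(2) by (simp add: eq_neg_iff_add_eq_0)
      have "poly (m\<^sup>2 * A0 - m * n * A1 + n\<^sup>2 * A2) y =
          (poly m y)\<^sup>2 * (poly A0 y + z * poly A1 y + z\<^sup>2 * poly A2 y)"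
        by (simp add: n power2_eq_square algebra_simps)
      then show ?thesis unfolding z by simp
    qed simp
    then have "\<forall>y. poly ((m\<^sup>2 * A0 - m * n * A1 + n\<^sup>2 * A2) * A2) y = 0" by (rule allI)
    then have "(m\<^sup>2 * A0 - m * n * A1 + n\<^sup>2 * A2) * A2 = 0" by (simp only: poly_all_0_iff_0)
    then have E: "m\<^sup>2 * A0 - m * n * A1 + n\<^sup>2 * A2 = 0" using A20 by simp
    \<comment> \<open>The subtracted constant is the resultant of \<open>H\<close> and
      \<open>n + m z\<close>, zero by \<open>E\<close>. So the prime \<open>H\<close> divides a
      product of two nonzero polynomials of degree at most 1 in \<open>z\<close>.\<close>
    have "[:n, m:] * [:m * A1 - n * A2, m * A2:] = ?H * [:m\<^sup>2:] - [:m\<^sup>2 * A0 - m * n * A1 + n\<^sup>2 * A2:]"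
      unfolding H by (simp add: power2_eq_square algebra_simps)
    then have "[:n, m:] * [:m * A1 - n * A2, m * A2:] = ?H * [:m\<^sup>2:]" unfolding E by simp
    then have "?H dvd [:n, m:] * [:m * A1 - n * A2, m * A2:]" by (rule dvdI)
    from prime_elem_dvd_multD[OF prime this] have False
      using not_dvd[of "[:n, m:]"] not_dvd[of "[:m * A1 - n * A2, m * A2:]"] False A20 by simp
    then show ?thesis by (rule FalseE)
  qed
  then have "[:A2 ^ N:] * p = ?H * q" using pq by simp
  then have "?H dvd [:A2 ^ N:] * p" by (rule dvdI)
  from prime_elem_dvd_multD[OF prime this] show ?thesis
    using not_dvd[of "[:A2 ^ N:]"] A20 by simp
qed

lemma branch_hyperbolic_threefold:
  fixes a :: "'a::{alg_closed_field, field_char_0}"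
  assumes "nonsingular a b1 b2 b3"
  shows "hyperbolic_threefold (branch a b1 b2 b3)"
proof
  show "prime_elem (branch a b1 b2 b3)" by (rule prime_elem_branch[OF assms])
  show "branch a b1 b2 b3 dvd p"
    if "\<And>y z. ev2 (branch a b1 b2 b3) y z = 0 \<Longrightarrow> ev2 p y z = 0" for p
    using that by (rule branch_nullstellensatz[OF assms])
  show "\<exists>y. ev2 (branch a b1 b2 b3) y z \<noteq> 0" for z by (rule branch_no_horizontal_line[OF assms])
qed

section \<open>Polynomial functions on a coordinate space\<close>

text \<open>Restricted to the line through \<open>x\<close> and \<open>y\<close>, the two functions
  become univariate polynomials with product zero, the second of them nonzero.\<close>

lemma polyfun_dense:
  fixes f g :: "'a::field_char_0 ^ 'n \<Rightarrow> 'a"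
  assumes "f \<in> polyfun coords" and "g \<in> polyfun coords"
    and 0: "\<And>x. f x * g x = 0" and y: "g y \<noteq> 0"
  shows "f x = 0"
proof -
  obtain p where p: "\<And>c. f (y + c *s (x - y)) = poly p c"
    using polyfun_line[OF assms(1), of y "x - y"] by metis
  obtain q where q: "\<And>c. g (y + c *s (x - y)) = poly q c"
    using polyfun_line[OF assms(2), of y "x - y"] by metis
  have "\<forall>c. poly (p * q) c = 0" using 0 by (simp flip: p q)
  then have "p * q = 0" by (simp only: poly_all_0_iff_0)
  moreover have "q \<noteq> 0" using q[of 0] y by auto
  ultimately show ?thesis using p[of 1] by simp
qed

definition kill :: "'n \<Rightarrow> 'a::zero ^ 'n \<Rightarrow> 'a ^ 'n" where
  "kill i x = (\<chi> j. if j = i then 0 else x $ j)"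

lemma kill_nth [simp]: "kill i x $ j = (if j = i then 0 else x $ j)"
  by (simp add: kill_def)

lemma kill_id: "x $ i = 0 \<Longrightarrow> kill i x = x"
  by (simp add: Finite_Cartesian_Product.vec_eq_iff)

lemma polyfun_kill: "f \<in> polyfun coords \<Longrightarrow> (\<lambda>x. f (kill i x)) \<in> polyfun coords"
proof (erule polyfun_coords_comp)
  show "(\<lambda>x. kill i x $ j) \<in> polyfun coords" for j
    by (cases "j = i") (simp_all add: polyfun_const polyfun_coord)
qed

lemma polyfun_split_coord:
  fixes f :: "'a::comm_ring_1 ^ 'n \<Rightarrow> 'a"
  assumes "f \<in> polyfun coords"
  obtains g where "g \<in> polyfun coords" and "\<And>x. f x = f (kill i x) + x $ i * g x"
proof -
  have "\<exists>g\<in>polyfun coords. \<forall>x. f x = f (kill i x) + x $ i * g x"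
    using assms
  proof induction
    case (polyfun_const c)
    show ?case by (rule bexI[of _ "\<lambda>_. 0"]) (auto intro: polyfun.intros)
  next
    case (polyfun_gen g)
    then obtain j where "g = (\<lambda>x. x $ j)" by (auto simp: coords_def)
    then show ?case
      by (intro bexI[of _ "\<lambda>_. if j = i then 1 else 0"]) (auto intro: polyfun.intros)
  next
    case (polyfun_add f g)
    then obtain f' g' where "f' \<in> polyfun coords" "g' \<in> polyfun coords"
      "\<forall>x. f x = f (kill i x) + x $ i * f' x" "\<forall>x. g x = g (kill i x) + x $ i * g' x" by blast
    note * = this
    have "f x + g x = f (kill i x) + g (kill i x) + x $ i * (f' x + g' x)" for x
      using *(3)[rule_format, of x] *(4)[rule_format, of x] by (simp add: algebra_simps)
    then show ?case using *(1,2)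
      by (intro bexI[of _ "\<lambda>x. f' x + g' x"] allI polyfun.polyfun_add)
  next
    case (polyfun_mult f g)
    then obtain f' g' where "f' \<in> polyfun coords" "g' \<in> polyfun coords"
      "\<forall>x. f x = f (kill i x) + x $ i * f' x" "\<forall>x. g x = g (kill i x) + x $ i * g' x" by blast
    note * = this
    have "f x * g x = f (kill i x) * g (kill i x) + x $ i * (f' x * g x + f (kill i x) * g' x)" for x
    proof -
      have "f x * g x = f (kill i x) * g x + x $ i * (f' x * g x)"
        by (subst *(3)[rule_format, of x]) (simp add: algebra_simps)
      also have "f (kill i x) * g x = f (kill i x) * g (kill i x) + f (kill i x) * (x $ i * g' x)"
        by (subst *(4)[rule_format, of x]) (simp add: algebra_simps)
      finally show ?thesis by (simp add: algebra_simps)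
    qed
    moreover have "(\<lambda>x. f' x * g x + f (kill i x) * g' x) \<in> polyfun coords"
      using *(1,2) polyfun_mult.hyps by (intro polyfun_intros polyfun_kill)
    ultimately show ?case
      by (intro bexI[of _ "\<lambda>x. f' x * g x + f (kill i x) * g' x"] allI)
  qed
  with that show ?thesis by blast
qed

text \<open>The scalar 0 is included: functions of positive degree vanish at the origin, and
  functions of degree 0 are constant.\<close>

definition homog :: "nat \<Rightarrow> ('a::comm_ring_1 ^ 'n \<Rightarrow> 'a) \<Rightarrow> bool" where
  "homog d f \<longleftrightarrow> (\<forall>c x. f (c *s x) = c ^ d * f x)"

lemma homogD: "homog d f \<Longrightarrow> f (c *s x) = c ^ d * f x"
  by (simp add: homog_def)

lemma polyfun_homogeneous_components:
  fixes f :: "'a::idom ^ 'n \<Rightarrow> 'a"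
  assumes "f \<in> polyfun coords"
  obtains g M where "\<And>j. g j \<in> polyfun coords" "\<And>j. homog j (g j)"
    "\<And>x. f x = (\<Sum>j\<le>M. g j x)"
proof -
  have "\<exists>g M. (\<forall>j. g j \<in> polyfun coords \<and> homog j (g j)) \<and> (\<forall>j>M. g j = (\<lambda>_. 0)) \<and>
      (\<forall>x. f x = (\<Sum>j\<le>M. g j x))"
    using assms
  proof induction
    case (polyfun_const c)
    show ?case
      by (rule exI[of _ "\<lambda>j _. if j = 0 then c else 0"], rule exI[of _ 0])
        (auto simp: homog_def intro: polyfun.intros)
  next
    case (polyfun_gen h)
    then obtain i where i: "h = (\<lambda>x. x $ i)" by (auto simp: coords_def)
    have "(\<lambda>x. if j = 1 then x $ i else 0) \<in> polyfun coords" for j :: nat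
      by (cases "j = 1") (auto intro: polyfun.intros polyfun_coord)
    then show ?case
      by (intro exI[of _ "\<lambda>j x. if j = 1 then x $ i else 0"] exI[of _ 1])
        (auto simp: homog_def i fun_eq_iff)
  next
    case (polyfun_add f h)
    then obtain g M g' M' where
      g: "\<forall>j. g j \<in> polyfun coords \<and> homog j (g j)" "\<forall>j>M. g j = (\<lambda>_. 0)" "\<forall>x. f x = (\<Sum>j\<le>M. g j x)" and
      g': "\<forall>j. g' j \<in> polyfun coords \<and> homog j (g' j)" "\<forall>j>M'. g' j = (\<lambda>_. 0)"
        "\<forall>x. h x = (\<Sum>j\<le>M'. g' j x)" by blast
    have ext: "(\<Sum>j\<le>M + M'. g j x) = (\<Sum>j\<le>M. g j x)" "(\<Sum>j\<le>M + M'. g' j x) = (\<Sum>j\<le>M'. g' j x)" for x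
      by (rule sum.mono_neutral_right; use g(2) g'(2) in auto)+
    show ?case
    proof (intro exI[of _ "\<lambda>j x. g j x + g' j x"] exI[of _ "M + M'"] conjI allI impI)
      show "(\<lambda>x. g j x + g' j x) \<in> polyfun coords" for j using g(1) g'(1) by (simp add: polyfun.polyfun_add)
      show "homog j (\<lambda>x. g j x + g' j x)" for j
        using g(1) g'(1) by (simp add: homog_def algebra_simps)
      show "(\<lambda>x. g j x + g' j x) = (\<lambda>_. 0)" if "M + M' < j" for j using g(2) g'(2) that by simp
      show "f x + h x = (\<Sum>j\<le>M + M'. g j x + g' j x)" for x
        using g(3) g'(3) by (simp add: sum.distrib ext)
    qed
  next
    case (polyfun_mult f h)
    then obtain g M g' M' where
      g: "\<forall>j. g j \<in> polyfun coords \<and> homog j (g j)" "\<forall>j>M. g j = (\<lambda>_. 0)" "\<forall>x. f x = (\<Sum>j\<le>M. g j x)" and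
      g': "\<forall>j. g' j \<in> polyfun coords \<and> homog j (g' j)" "\<forall>j>M'. g' j = (\<lambda>_. 0)"
        "\<forall>x. h x = (\<Sum>j\<le>M'. g' j x)" by blast
    show ?case
    proof (intro exI[of _ "\<lambda>n x. \<Sum>i\<le>n. g i x * g' (n - i) x"] exI[of _ "M + M'"] conjI allI impI)
      show "(\<lambda>x. \<Sum>i\<le>n. g i x * g' (n - i) x) \<in> polyfun coords" for n
        using g(1) g'(1) by (intro polyfun_sum polyfun.polyfun_mult) auto
      show "homog n (\<lambda>x. \<Sum>i\<le>n. g i x * g' (n - i) x)" for n
        unfolding homog_def
      proof (intro allI)
        fix c x
        have "g i (c *s x) * g' (n - i) (c *s x) = c ^ n * (g i x * g' (n - i) x)" if "i \<le> n" for i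
        proof -
          have "c ^ n = c ^ i * c ^ (n - i)" using that by (simp flip: power_add)
          then show ?thesis using g(1) g'(1) by (simp add: homog_def algebra_simps)
        qed
        then show "(\<Sum>i\<le>n. g i (c *s x) * g' (n - i) (c *s x)) = c ^ n * (\<Sum>i\<le>n. g i x * g' (n - i) x)"
          by (simp add: sum_distrib_left)
      qed
      show "(\<lambda>x. \<Sum>i\<le>n. g i x * g' (n - i) x) = (\<lambda>_. 0)" if "M + M' < n" for n
      proof
        fix x
        have "g i x * g' (n - i) x = 0" if "i \<le> n" for i
          using g(2) g'(2) that \<open>M + M' < n\<close> by (cases "i > M") auto
        then show "(\<Sum>i\<le>n. g i x * g' (n - i) x) = 0" by (intro sum.neutral) simp
      qed
      \<comment> \<open>The Cauchy product of the two sequences of components, taken at argument 1;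
        the vanishing of components beyond the bounds is carried through the induction for
        this.\<close>
      show "f x * h x = (\<Sum>n\<le>M + M'. \<Sum>i\<le>n. g i x * g' (n - i) x)" for x
        using polynomial_product[of M "\<lambda>i. g i x" M' "\<lambda>i. g' i x" 1] g(2,3) g'(2,3) by simp
    qed
  qed
  with that show ?thesis by blast
qed

text \<open>All degrees from some \<open>D\<close> on are allowed, the surplus being a power of
  \<open>x $ i\<close>, so that sums and finite families can be homogenised in one common
  degree.\<close>

lemma polyfun_homogenize:
  fixes f :: "'a::field ^ 'n \<Rightarrow> 'a"
  assumes "f \<in> polyfun coords"
  shows "\<exists>D. \<forall>D'\<ge>D. \<exists>g\<in>polyfun coords. homog D' g \<and>
    (\<forall>x. x $ i \<noteq> 0 \<longrightarrow> g x = (x $ i) ^ D' * f (inverse (x $ i) *s x))"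
  using assms
proof induction
  case (polyfun_const c)
  show ?case
  proof (intro exI[of _ 0] allI impI)
    fix D' :: nat
    show "\<exists>g\<in>polyfun coords. homog D' g \<and> (\<forall>x. x $ i \<noteq> 0 \<longrightarrow> g x = (x $ i) ^ D' * c)"
      by (intro bexI[of _ "\<lambda>x. (x $ i) ^ D' * c"])
        (auto simp: homog_def power_mult_distrib intro!: polyfun_intros polyfun_coord)
  qed
next
  case (polyfun_gen h)
  then obtain k where k: "h = (\<lambda>x. x $ k)" by (auto simp: coords_def)
  show ?case
  proof (intro exI[of _ 1] allI impI)
    fix D' :: nat assume "1 \<le> D'"
    then obtain d where d: "D' = Suc d" by (cases D') auto
    show "\<exists>g\<in>polyfun coords. homog D' g \<and>
        (\<forall>x. x $ i \<noteq> 0 \<longrightarrow> g x = (x $ i) ^ D' * h (inverse (x $ i) *s x))"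
      by (intro bexI[of _ "\<lambda>x. (x $ i) ^ d * x $ k"])
        (auto simp: homog_def power_mult_distrib k d field_simps intro!: polyfun_intros polyfun_coord)
  qed
next
  case (polyfun_add f h)
  then obtain D E where
    D: "\<forall>D'\<ge>D. \<exists>g\<in>polyfun coords. homog D' g \<and>
      (\<forall>x. x $ i \<noteq> 0 \<longrightarrow> g x = (x $ i) ^ D' * f (inverse (x $ i) *s x))" and
    E: "\<forall>D'\<ge>E. \<exists>g\<in>polyfun coords. homog D' g \<and>
      (\<forall>x. x $ i \<noteq> 0 \<longrightarrow> g x = (x $ i) ^ D' * h (inverse (x $ i) *s x))" by blast
  show ?case
  proof (intro exI[of _ "max D E"] allI impI)
    fix D' assume "max D E \<le> D'"
    then have le: "D \<le> D'" "E \<le> D'" by simp_all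
    obtain g where g: "g \<in> polyfun coords" "homog D' g"
        "\<forall>x. x $ i \<noteq> 0 \<longrightarrow> g x = (x $ i) ^ D' * f (inverse (x $ i) *s x)"
      using D le(1) by blast
    obtain k where k: "k \<in> polyfun coords" "homog D' k"
        "\<forall>x. x $ i \<noteq> 0 \<longrightarrow> k x = (x $ i) ^ D' * h (inverse (x $ i) *s x)"
      using E le(2) by blast
    show "\<exists>g\<in>polyfun coords. homog D' g \<and> (\<forall>x. x $ i \<noteq> 0 \<longrightarrow>
        g x = (x $ i) ^ D' * (f (inverse (x $ i) *s x) + h (inverse (x $ i) *s x)))"
      using g k by (intro bexI[of _ "\<lambda>x. g x + k x"])
        (auto simp: homog_def distrib_left intro: polyfun_intros)
  qed
next
  case (polyfun_mult f h)
  then obtain D E where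
    D: "\<forall>D'\<ge>D. \<exists>g\<in>polyfun coords. homog D' g \<and>
      (\<forall>x. x $ i \<noteq> 0 \<longrightarrow> g x = (x $ i) ^ D' * f (inverse (x $ i) *s x))" and
    E: "\<forall>D'\<ge>E. \<exists>g\<in>polyfun coords. homog D' g \<and>
      (\<forall>x. x $ i \<noteq> 0 \<longrightarrow> g x = (x $ i) ^ D' * h (inverse (x $ i) *s x))" by blast
  show ?case
  proof (intro exI[of _ "D + E"] allI impI)
    fix D' assume le: "D + E \<le> D'"
    then have "E \<le> D' - D" by simp
    obtain g where g: "g \<in> polyfun coords" "homog D g"
        "\<forall>x. x $ i \<noteq> 0 \<longrightarrow> g x = (x $ i) ^ D * f (inverse (x $ i) *s x)"
      using D by blast
    obtain k where k: "k \<in> polyfun coords" "homog (D' - D) k"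
        "\<forall>x. x $ i \<noteq> 0 \<longrightarrow> k x = (x $ i) ^ (D' - D) * h (inverse (x $ i) *s x)"
      using E \<open>E \<le> D' - D\<close> by blast
    have pow: "c ^ D' = c ^ D * c ^ (D' - D)" for c :: 'a using le by (simp flip: power_add)
    show "\<exists>g\<in>polyfun coords. homog D' g \<and> (\<forall>x. x $ i \<noteq> 0 \<longrightarrow>
        g x = (x $ i) ^ D' * (f (inverse (x $ i) *s x) * h (inverse (x $ i) *s x)))"
      using g k by (intro bexI[of _ "\<lambda>x. g x * k x"])
        (auto simp: homog_def pow mult_ac intro: polyfun_intros)
  qed
qed

section \<open>The cubic cone\<close>

lemma exhaust_5: "(x::5) = 1 \<or> x = 2 \<or> x = 3 \<or> x = 4 \<or> x = 5"
proof (induct x)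
  case (of_int z)
  then have "0 \<le> z" and "z < 5" by simp_all
  then have "z = 0 \<or> z = 1 \<or> z = 2 \<or> z = 3 \<or> z = 4" by arith
  then show ?case by auto
qed

text \<open>The orderings of the coordinates 2, 3, 4. Up to permuting the coefficients the cubic is
  symmetric in them, so each argument about a plane or a node is given once for a general
  ordering.\<close>

definition triples :: "(5 \<times> 5 \<times> 5) set" where
  "triples = {(2, 3, 4), (2, 4, 3), (3, 2, 4), (3, 4, 2), (4, 2, 3), (4, 3, 2)}"

lemma triples_distinct:
  assumes "(i, j, k) \<in> triples"
  shows "i \<noteq> 1" "j \<noteq> 1" "k \<noteq> 1" "i \<noteq> 5" "j \<noteq> 5" "k \<noteq> 5" "i \<noteq> j" "i \<noteq> k" "j \<noteq> k"
    "1 \<noteq> i" "1 \<noteq> j" "1 \<noteq> k" "5 \<noteq> i" "5 \<noteq> j" "5 \<noteq> k" "j \<noteq> i" "k \<noteq> i" "k \<noteq> j"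
    "1 \<noteq> (5::5)" "5 \<noteq> (1::5)"
  using assms unfolding triples_def by auto

lemma triples_cover: "(i, j, k) \<in> triples \<Longrightarrow> l = 1 \<or> l = i \<or> l = j \<or> l = k \<or> l = 5"
  using exhaust_5[of l] unfolding triples_def by auto

definition pt :: "5 \<Rightarrow> 5 \<Rightarrow> 5 \<Rightarrow> 'a \<Rightarrow> 'a \<Rightarrow> 'a \<Rightarrow> 'a \<Rightarrow> 'a \<Rightarrow> 'a ^ 5" where
  "pt i j k t p q r w =
    (\<chi> l. if l = 1 then t else if l = i then p else if l = j then q else if l = k then r else w)"

lemma pt_nth:
  assumes "(i, j, k) \<in> triples"
  shows "pt i j k t p q r w $ 1 = t" "pt i j k t p q r w $ i = p" "pt i j k t p q r w $ j = q"
    "pt i j k t p q r w $ k = r" "pt i j k t p q r w $ 5 = w"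
  using triples_distinct[OF assms] by (simp_all add: pt_def)

lemma pt_eqI:
  assumes "(i, j, k) \<in> triples" and "x $ 1 = t" "x $ i = p" "x $ j = q" "x $ k = r" "x $ 5 = w"
  shows "x = pt i j k t p q r w"
  unfolding Finite_Cartesian_Product.vec_eq_iff
proof
  fix l
  show "x $ l = pt i j k t p q r w $ l"
    using triples_cover[OF assms(1), of l] assms pt_nth[OF assms(1)] by metis
qed

lemma polyfun_pt:
  assumes "t \<in> polyfun G" "p \<in> polyfun G" "q \<in> polyfun G" "r \<in> polyfun G" "w \<in> polyfun G"
  shows "(\<lambda>x. pt i j k (t x) (p x) (q x) (r x) (w x) $ l) \<in> polyfun G"
proof -
  consider "l = 1" | "l \<noteq> 1" "l = i" | "l \<noteq> 1" "l \<noteq> i" "l = j" | "l \<noteq> 1" "l \<noteq> i" "l \<noteq> j" "l = k"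
    | "l \<noteq> 1" "l \<noteq> i" "l \<noteq> j" "l \<noteq> k" by blast
  then show ?thesis using assms by cases (simp_all add: pt_def)
qed

lemma polyfun_comp_pt:
  assumes "f \<in> polyfun coords"
    and "t \<in> polyfun G" "p \<in> polyfun G" "q \<in> polyfun G" "r \<in> polyfun G" "w \<in> polyfun G"
  shows "(\<lambda>x. f (pt i j k (t x) (p x) (q x) (r x) (w x))) \<in> polyfun G"
  by (rule polyfun_coords_comp[OF assms(1)]) (rule polyfun_pt[OF assms(2-)])

definition cubic_fun :: "'a::comm_ring_1 \<Rightarrow> 'a \<Rightarrow> 'a \<Rightarrow> 'a \<Rightarrow> 'a ^ 5 \<Rightarrow> 'a" where
  "cubic_fun a b1 b2 b3 x = x $ 2 * x $ 3 * x $ 4 + a * (x $ 1) ^ 3 +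
    (x $ 1)\<^sup>2 * (b1 * x $ 2 + b2 * x $ 3 + b3 * x $ 4) +
    x $ 1 * ((x $ 2)\<^sup>2 + (x $ 3)\<^sup>2 + (x $ 4)\<^sup>2 - (x $ 5)\<^sup>2)"

text \<open>The remainder modulo x1 is divided by x2, x3, x4 in turn. After the first division,
  vanishing on the next hyperplane is known only where the earlier coordinates are nonzero, and
  density extends it.\<close>

lemma polyfun_coords_factor:
  fixes f :: "'a::field_char_0 ^ 5 \<Rightarrow> 'a"
  assumes f: "f \<in> polyfun coords"
    and 0: "\<And>x. x $ 1 = 0 \<Longrightarrow> x $ 2 * x $ 3 * x $ 4 = 0 \<Longrightarrow> f x = 0"
  obtains g h where "g \<in> polyfun coords" "h \<in> polyfun coords"
    "\<And>x. f x = x $ 1 * g x + x $ 2 * x $ 3 * x $ 4 * h x"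
proof -
  define f0 where "f0 = (\<lambda>x. f (kill 1 x))"
  have f0: "f0 \<in> polyfun coords" unfolding f0_def by (rule polyfun_kill[OF f])
  obtain g1 where g1: "g1 \<in> polyfun coords" "\<And>x. f x = f0 x + x $ 1 * g1 x"
    using polyfun_split_coord[OF f, of 1] unfolding f0_def by metis
  have z0: "f0 x = 0" if "x $ 2 * x $ 3 * x $ 4 = 0" for x
    unfolding f0_def by (rule 0) (use that in auto)
  obtain h2 where h2: "h2 \<in> polyfun coords" "\<And>x. f0 x = f0 (kill 2 x) + x $ 2 * h2 x"
    by (rule polyfun_split_coord[OF f0]) (rule that)
  have e2: "f0 x = x $ 2 * h2 x" for x using h2(2)[of x] z0[of "kill 2 x"] by simp
  obtain h3 where h3: "h3 \<in> polyfun coords" "\<And>x. h2 x = h2 (kill 3 x) + x $ 3 * h3 x"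
    by (rule polyfun_split_coord[OF h2(1)]) (rule that)
  have "h2 (kill 3 x) = 0" for x
  proof (rule polyfun_dense[OF polyfun_kill[OF h2(1)] polyfun_coord[of 2]])
    show "h2 (kill 3 x) * x $ 2 = 0" for x
      using e2[of "kill 3 x"] z0[of "kill 3 x"] by (simp add: mult.commute)
    show "(\<chi> l. 1) $ 2 \<noteq> (0::'a)" by simp
  qed
  then have e3: "f0 x = x $ 2 * x $ 3 * h3 x" for x using e2[of x] h3(2)[of x] by (simp add: mult.assoc)
  obtain h4 where h4: "h4 \<in> polyfun coords" "\<And>x. h3 x = h3 (kill 4 x) + x $ 4 * h4 x"
    by (rule polyfun_split_coord[OF h3(1)]) (rule that)
  have "h3 (kill 4 x) = 0" for x
  proof (rule polyfun_dense[OF polyfun_kill[OF h3(1)]])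
    show "(\<lambda>x. x $ 2 * x $ 3) \<in> polyfun coords"
      by (intro polyfun_mult polyfun_coord)
    show "h3 (kill 4 x) * (x $ 2 * x $ 3) = 0" for x
      using e3[of "kill 4 x"] z0[of "kill 4 x"] by (simp add: mult.commute)
    show "(\<chi> l. 1) $ 2 * (\<chi> l. 1) $ 3 \<noteq> (0::'a)" by simp
  qed
  then have e4: "f0 x = x $ 2 * x $ 3 * x $ 4 * h4 x" for x
    using e3[of x] h4(2)[of x] by (simp add: mult.assoc)
  show ?thesis
    by (rule that[OF g1(1) h4(1)]) (simp add: g1(2) e4)
qed

locale cubic_cone =
  fixes a b1 b2 b3 :: "'k::{alg_closed_field, field_char_0}"
  assumes ns: "nonsingular a b1 b2 b3"
begin

abbreviation F :: "'k ^ 5 \<Rightarrow> 'k" where "F \<equiv> cubic_fun a b1 b2 b3"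

definition \<beta> :: "5 \<Rightarrow> 'k" where "\<beta> i = (if i = 2 then b1 else if i = 3 then b2 else b3)"

lemma F_triple:
  assumes "(i, j, k) \<in> triples"
  shows "F x = x $ i * x $ j * x $ k + a * (x $ 1) ^ 3 +
    (x $ 1)\<^sup>2 * (\<beta> i * x $ i + \<beta> j * x $ j + \<beta> k * x $ k) +
    x $ 1 * ((x $ i)\<^sup>2 + (x $ j)\<^sup>2 + (x $ k)\<^sup>2 - (x $ 5)\<^sup>2)"
  using assms unfolding triples_def cubic_fun_def \<beta>_def by (auto simp: algebra_simps)

lemma F_pt:
  assumes "(i, j, k) \<in> triples"
  shows "F (pt i j k t p q r w) = p * q * r + a * t ^ 3 + t\<^sup>2 * (\<beta> i * p + \<beta> j * q + \<beta> k * r) +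
    t * (p\<^sup>2 + q\<^sup>2 + r\<^sup>2 - w\<^sup>2)"
  by (simp add: F_triple[OF assms] pt_nth[OF assms])

lemma F_scale: "F (c *s x) = c ^ 3 * F x"
  by (simp add: cubic_fun_def power2_eq_square power3_eq_cube algebra_simps)

lemma F_at_infinity: "x $ 1 = 0 \<Longrightarrow> F x = x $ 2 * x $ 3 * x $ 4"
  by (simp add: cubic_fun_def)

text \<open>At infinity the cone is x1 = x2 x3 x4 = 0, so \<open>f\<close> lies in the ideal of x1
  and x2 x3 x4; modulo \<open>F\<close> the product x2 x3 x4 is itself a multiple of x1.\<close>

lemma divide_by_x1:
  assumes f: "f \<in> polyfun coords" and 0: "\<And>x. F x = 0 \<Longrightarrow> x $ 1 = 0 \<Longrightarrow> f x = 0"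
  obtains g where "g \<in> polyfun coords" "\<And>x. F x = 0 \<Longrightarrow> f x = x $ 1 * g x"
proof -
  have "f x = 0" if "x $ 1 = 0" "x $ 2 * x $ 3 * x $ 4 = 0" for x
    using 0 that by (simp add: F_at_infinity)
  then obtain g h where gh: "g \<in> polyfun coords" "h \<in> polyfun coords"
    "\<And>x. f x = x $ 1 * g x + x $ 2 * x $ 3 * x $ 4 * h x"
    by (rule polyfun_coords_factor[OF f]) (assumption | rule that)+
  define Q where "Q = (\<lambda>x::'k ^ 5. a * (x $ 1)\<^sup>2 + x $ 1 * (b1 * x $ 2 + b2 * x $ 3 + b3 * x $ 4) +
    ((x $ 2)\<^sup>2 + (x $ 3)\<^sup>2 + (x $ 4)\<^sup>2 - (x $ 5)\<^sup>2))"
  have FQ: "F x = x $ 2 * x $ 3 * x $ 4 + x $ 1 * Q x" for x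
    by (simp add: cubic_fun_def Q_def power2_eq_square power3_eq_cube algebra_simps)
  have "Q \<in> polyfun coords" unfolding Q_def by (intro polyfun_intros polyfun_coord)
  then have "(\<lambda>x. g x - Q x * h x) \<in> polyfun coords" using gh by (intro polyfun_intros)
  moreover have "f x = x $ 1 * (g x - Q x * h x)" if "F x = 0" for x
  proof -
    have "x $ 2 * x $ 3 * x $ 4 = - (x $ 1 * Q x)"
      using that unfolding FQ by (simp add: eq_neg_iff_add_eq_0)
    then show ?thesis unfolding gh(3) by (simp add: algebra_simps)
  qed
  ultimately show ?thesis by (rule that)
qed

text \<open>The projection from the node \<open>e\<^sub>i + e\<^sub>5\<close> is inverted by the cubic map below;
  it exhibits a dense part of the plane \<open>x\<^sub>1 = x\<^sub>i = 0\<close> as limits of points with \<open>x\<^sub>1 \<noteq> 0\<close>.\<close>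

lemma F_project:
  assumes "(i, j, k) \<in> triples"
    and q: "q = y * z + \<beta> i * t\<^sup>2 - 2 * t * u"
    and R: "R = 2 * (a * t ^ 3 + t\<^sup>2 * (\<beta> j * y + \<beta> k * z) + t * (y\<^sup>2 + z\<^sup>2)) - u * (y * z + \<beta> i * t\<^sup>2)"
  shows "F (pt i j k (2 * t * q) (- R - u * q) (2 * y * q) (2 * z * q) (- R + u * q)) = 0"
proof -
  \<comment> \<open>\<open>R\<close> is twice the value of \<open>F\<close> at v = (t, -u/2, y, z,
    u/2), and \<open>q\<close> is the tangent cone at the node. As \<open>F\<close> has a double
    zero at the node, \<open>2 q v - R n\<close> is the remaining zero on the line through v and the
    node \<open>n\<close>.\<close>
  define B where "B = y * z + \<beta> i * t\<^sup>2"
  define S where "S = a * t ^ 3 + t\<^sup>2 * (\<beta> j * y + \<beta> k * z) + t * (y\<^sup>2 + z\<^sup>2)"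
  have "F (pt i j k (2 * t * q) (- R - u * q) (2 * y * q) (2 * z * q) (- R + u * q)) =
      4 * q\<^sup>2 * ((- R - u * q) * B + 2 * q * S + 2 * t * u * R)"
    unfolding F_pt[OF assms(1)] B_def S_def
    by (simp add: power2_eq_square power3_eq_cube algebra_simps)
  also have "(- R - u * q) * B + 2 * q * S + 2 * t * u * R = q * (2 * S - u * B) - R * (B - 2 * t * u)"
    by (simp add: algebra_simps)
  also have "2 * S - u * B = R" by (simp add: R S_def B_def)
  also have "B - 2 * t * u = q" by (simp add: q B_def)
  finally show ?thesis by simp
qed

lemma plane_in_closure:
  assumes ijk: "(i, j, k) \<in> triples" and f: "f \<in> polyfun coords"
    and 0: "\<And>x. F x = 0 \<Longrightarrow> x $ 1 \<noteq> 0 \<Longrightarrow> f x = 0"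
    and x: "x $ 1 = 0" "x $ i = 0"
  shows "f x = 0"
proof -
  have gen: "f (pt i j k 0 0 y z u) = 0" if "y * z \<noteq> 0" for y z u
  proof -
    define q where "q = (\<lambda>t. y * z + \<beta> i * t\<^sup>2 - 2 * t * u)"
    define R where "R = (\<lambda>t. 2 * (a * t ^ 3 + t\<^sup>2 * (\<beta> j * y + \<beta> k * z) + t * (y\<^sup>2 + z\<^sup>2)) - u * (y * z + \<beta> i * t\<^sup>2))"
    \<comment> \<open>At \<open>t = 0\<close> the curve is at \<open>2 y z\<close> times the
      prescribed point of the plane, where \<open>q\<close> equals \<open>y z\<close>; the factor
      \<open>m\<close> normalises this.\<close>
    define m where "m = inverse (2 * (y * z))"
    define \<phi> where "\<phi> t = m *s pt i j k (2 * t * q t) (- R t - u * q t) (2 * y * q t) (2 * z * q t) (- R t + u * q t)" for t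
    have id: "(\<lambda>t. t) \<in> polyfun {\<lambda>t::'k. t}" by (rule polyfun_gen) simp
    have qp: "q \<in> polyfun {\<lambda>t. t}" unfolding q_def by (intro polyfun_intros id)
    have Rp: "R \<in> polyfun {\<lambda>t. t}" unfolding R_def by (intro polyfun_intros id)
    have "(\<lambda>t. f (\<phi> t)) \<in> polyfun {\<lambda>t. t}"
    proof (rule polyfun_coords_comp[OF f])
      show "(\<lambda>t. \<phi> t $ l) \<in> polyfun {\<lambda>t. t}" for l
        unfolding \<phi>_def vector_smult_component
        by (intro polyfun_intros polyfun_pt id qp Rp)
    qed
    then obtain p where p: "\<And>t. f (\<phi> t) = poly p t" by (rule polyfun_univariate) (rule that)
    obtain q' where q': "\<And>t. q t = poly q' t" by (rule polyfun_univariate[OF qp]) (rule that)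
    have F\<phi>: "F (\<phi> t) = 0" for t
      unfolding \<phi>_def F_scale using F_project[OF ijk, of "q t" y z t u "R t"] by (simp add: q_def R_def)
    have "poly (p * ([:0, 1:] * q')) t = 0" for t
    proof (cases "t * q t = 0")
      case True
      then show ?thesis by (auto simp: q')
    next
      case False
      then have "\<phi> t $ 1 \<noteq> 0" using that by (simp add: \<phi>_def pt_nth[OF ijk] m_def)
      then have "f (\<phi> t) = 0" by (rule 0[OF F\<phi>])
      then show ?thesis by (simp add: p)
    qed
    then have "\<forall>t. poly (p * ([:0, 1:] * q')) t = 0" by (rule allI)
    then have "p * ([:0, 1:] * q') = 0" by (simp only: poly_all_0_iff_0)
    moreover have "poly q' 0 \<noteq> 0" using that by (simp add: q_def flip: q')
    then have "q' \<noteq> 0" by auto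
    ultimately have "p = 0" by simp
    moreover have "\<phi> 0 = pt i j k 0 0 y z u"
    proof (rule pt_eqI[OF ijk])
      have "m * (2 * (y * z)) = 1" unfolding m_def by (rule left_inverse) (use that in simp)
      then have "m * (2 * c * (y * z)) = c" for c
        by (metis mult.assoc mult.left_commute mult.right_neutral)
      then show "\<phi> 0 $ j = y" "\<phi> 0 $ k = z" "\<phi> 0 $ 5 = u" "\<phi> 0 $ 1 = 0" "\<phi> 0 $ i = 0"
        by (simp_all add: \<phi>_def pt_nth[OF ijk] q_def R_def algebra_simps)
    qed
    ultimately show ?thesis using p[of 0] by simp
  qed
  have pf: "(\<lambda>x. f (pt i j k 0 0 (x $ j) (x $ k) (x $ 5))) \<in> polyfun coords"
    by (intro polyfun_comp_pt[OF f] polyfun_const polyfun_coord)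
  have "f (pt i j k 0 0 (x $ j) (x $ k) (x $ 5)) = 0"
  proof (rule polyfun_dense[OF pf])
    show "(\<lambda>x. x $ j * x $ k) \<in> polyfun coords" by (intro polyfun_mult polyfun_coord)
    show "f (pt i j k 0 0 (x $ j) (x $ k) (x $ 5)) * (x $ j * x $ k) = 0" for x
      using gen[of "x $ j" "x $ k" "x $ 5"] by auto
    show "(\<chi> l. 1) $ j * (\<chi> l. 1) $ k \<noteq> (0::'k)" by simp
  qed
  moreover have "x = pt i j k 0 0 (x $ j) (x $ k) (x $ 5)" using x by (intro pt_eqI[OF ijk]) auto
  ultimately show ?thesis by simp
qed

text \<open>The zero set of x1 on the cone is the union of the three planes, each in the closure of
  the affine part. This is what permits cancelling x1.\<close>

lemma x1_nonzero_dense: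
  assumes f: "f \<in> polyfun coords"
    and 0: "\<And>x. F x = 0 \<Longrightarrow> x $ 1 \<noteq> 0 \<Longrightarrow> f x = 0" and "F x = 0"
  shows "f x = 0"
proof (cases "x $ 1 = 0")
  case True
  then have "x $ 2 = 0 \<or> x $ 3 = 0 \<or> x $ 4 = 0" using F_at_infinity assms(3) by simp
  moreover have "(2, 3, 4) \<in> triples" "(3, 2, 4) \<in> triples" "(4, 2, 3) \<in> triples"
    by (simp_all add: triples_def)
  ultimately show ?thesis using plane_in_closure[OF _ f 0] True by metis
qed (use 0 assms(3) in blast)

lemma cancel_x1:
  assumes f: "f \<in> polyfun coords" and 0: "\<And>x. F x = 0 \<Longrightarrow> x $ 1 * f x = 0" and "F x = 0"
  shows "f x = 0"
  by (rule x1_nonzero_dense[OF f _ assms(3)]) (use 0 in force)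

end

section \<open>Sections that vanish on a plane through a node\<close>

definition coords2 :: "('a::comm_ring_1 \<times> 'a \<Rightarrow> 'a) set" where
  "coords2 = {fst, snd}"

lemma polyfun_coords2: "(\<lambda>x. fst x) \<in> polyfun coords2" "(\<lambda>x. snd x) \<in> polyfun coords2"
  by (rule polyfun_gen, simp add: coords2_def)+

lemma polyfun_coords2_ev2:
  assumes "f \<in> polyfun coords2"
  obtains p where "\<And>x. f x = ev2 p (fst x) (snd x)"
proof -
  from assms have "\<exists>p. \<forall>x. f x = ev2 p (fst x) (snd x)"
  proof induction
    case (polyfun_const c)
    show ?case by (rule exI[of _ "[:[:c:]:]"]) simp
  next
    case (polyfun_gen g)
    then consider "g = fst" | "g = snd" by (auto simp: coords2_def)
    then show ?case
    proof cases
      case 1 then show ?thesis by (intro exI[of _ "[:[:0, 1:]:]"]) simp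
    next
      case 2 then show ?thesis by (intro exI[of _ "[:0, 1:]"]) simp
    qed
  next
    case (polyfun_add f g)
    then obtain p q where "\<forall>x. f x = ev2 p (fst x) (snd x)" "\<forall>x. g x = ev2 q (fst x) (snd x)" by blast
    then show ?case by (intro exI[of _ "p + q"]) simp
  next
    case (polyfun_mult f g)
    then obtain p q where "\<forall>x. f x = ev2 p (fst x) (snd x)" "\<forall>x. g x = ev2 q (fst x) (snd x)" by blast
    then show ?case by (intro exI[of _ "p * q"]) simp
  qed
  with that show ?thesis by blast
qed

lemma ev2_eqI:
  fixes p q :: "'a::field_char_0 poly poly"
  assumes "\<And>x y. ev2 p x y = ev2 q x y"
  shows "p = q"
proof -
  have "p - q = 0" by (rule ev2_eq_0) (simp add: assms)
  then show ?thesis by simp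
qed

lemma prime_factor_at_origin:
  fixes p :: "'a::field_char_0 poly poly"
  assumes "p \<noteq> 0" "ev2 p 0 0 = 0"
  obtains \<pi> where "prime_elem \<pi>" "\<pi> dvd p" "ev2 \<pi> 0 0 = 0"
proof -
  have "\<exists>\<pi>. prime_elem \<pi> \<and> \<pi> dvd p \<and> ev2 \<pi> 0 0 = 0"
    using assms
  proof (induction p rule: ufd_induct)
    case (unit x)
    obtain y where "1 = x * y" using unit(1) by (rule dvdE)
    then have "ev2 (x * y) 0 0 = 1" by (metis ev2_simps(2))
    then show ?case using unit(2) by simp
  next
    case (prime p x)
    from prime.prems consider "ev2 p 0 0 = 0" | "ev2 x 0 0 = 0" by auto
    then show ?case
    proof cases
      case 1
      then show ?thesis using prime.hyps(1) by (intro exI[of _ p] conjI dvd_triv_left)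
    next
      case 2
      from prime.IH[OF this] obtain \<pi> where \<pi>: "prime_elem \<pi>" "\<pi> dvd x" "ev2 \<pi> 0 0 = 0"
        by (elim exE conjE)
      show ?thesis by (intro exI[of _ \<pi>] conjI \<pi>(1,3) dvd_mult[OF \<pi>(2)])
    qed
  qed
  then show ?thesis using that by (elim exE conjE)
qed

text \<open>A divisor of the second variable is a unit or associate to it, and a unit does not
  vanish at the origin.\<close>

lemma vanishing_divisor_of_variable:
  fixes \<pi> :: "'a::field_char_0 poly poly"
  assumes "\<pi> dvd [:0, 1:]" "ev2 \<pi> 0 0 = 0"
  shows "ev2 \<pi> x 0 = 0"
proof -
  obtain w where w: "[:0, 1:] = \<pi> * w" using assms(1) by (rule dvdE)
  have nz: "\<pi> \<noteq> 0" "w \<noteq> 0" using w by auto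
  have "degree \<pi> + degree w = 1" using degree_mult_eq[OF nz] unfolding w[symmetric] by simp
  then consider "degree \<pi> = 0" "degree w \<le> 1" | "degree w = 0" "degree \<pi> \<le> 1" by linarith
  then show ?thesis
  proof cases
    case 1
    obtain c where c: "\<pi> = [:c:]" using 1(1) by (rule degree_eq_zeroE)
    have "c * coeff w 1 = 1" using arg_cong[OF w, of "\<lambda>p. coeff p 1"] by (simp add: c)
    then have "poly c 0 * poly (coeff w 1) 0 = 1" by (metis poly_1 poly_mult)
    then show ?thesis using assms(2) by (simp add: c)
  next
    case 2
    obtain d where d: "w = [:d:]" using 2(1) by (rule degree_eq_zeroE)
    have "d \<noteq> 0" using nz d by simp
    moreover have "coeff \<pi> 0 * d = 0" using arg_cong[OF w, of "\<lambda>p. coeff p 0"] by (simp add: d mult.commute)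
    ultimately have "coeff \<pi> 0 = 0" by simp
    moreover have "\<pi> = [:coeff \<pi> 0, coeff \<pi> 1:]" by (rule degree_le_1_eq[OF 2(2)])
    ultimately have "\<pi> = [:0, coeff \<pi> 1:]" by simp
    then show ?thesis by (metis add_0 ev2_simps(8) mult_zero_left poly_0)
  qed
qed

text \<open>Take a prime factor of \<open>l\<close> through the origin. It divides the left side,
  but neither \<open>D\<close> nor \<open>p m\<close>, which are nonzero at the origin; so it
  divides the variable, and \<open>l\<close> vanishes wherever that variable does.\<close>

lemma vanishing_spreads_along_variable:
  fixes l D :: "'a::field_char_0 poly poly" and p q :: "'i \<Rightarrow> 'a poly poly"
  assumes eq: "\<And>i. ([:0, 1:] * D) ^ N * p i = l * q i"
    and nz: "ev2 (p m) 0 0 \<noteq> 0" "ev2 D 0 0 \<noteq> 0" and l: "ev2 l 0 0 = 0"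
  shows "ev2 l x 0 = 0"
proof (cases "l = 0")
  case False
  obtain \<pi> where \<pi>: "prime_elem \<pi>" "\<pi> dvd l" "ev2 \<pi> 0 0 = 0"
    by (rule prime_factor_at_origin[OF False l]) (rule that)
  have no: "\<not> \<pi> dvd r" if r: "ev2 r 0 0 \<noteq> 0" for r
  proof
    assume "\<pi> dvd r"
    then obtain s where "r = \<pi> * s" by (rule dvdE)
    then show False using r \<pi>(3) by simp
  qed
  have "\<pi> dvd l * q m" by (rule dvd_mult2[OF \<pi>(2)])
  then have "\<pi> dvd ([:0, 1:] * D) ^ N * p m" unfolding eq .
  from prime_elem_dvd_multD[OF \<pi>(1) this] have "\<pi> dvd ([:0, 1:] * D) ^ N"
    using no[OF nz(1)] by (simp only: simp_thms)
  from prime_elem_dvd_power[OF \<pi>(1) this] have "\<pi> dvd [:0, 1:] * D" .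
  from prime_elem_dvd_multD[OF \<pi>(1) this] have "\<pi> dvd [:0, 1:]"
    using no[OF nz(2)] by (simp only: simp_thms)
  from vanishing_divisor_of_variable[OF this \<pi>(3)] have "ev2 \<pi> x 0 = 0" .
  moreover obtain s where "l = \<pi> * s" using \<pi>(2) by (rule dvdE)
  ultimately show ?thesis by simp
qed simp

context cubic_cone
begin

text \<open>The hyperplane \<open>x\<^sub>j = c x\<^sub>1\<close> cuts out the plane \<open>x\<^sub>1 = x\<^sub>j = 0\<close> and a residual
  quadric surface, parametrised here by projection from the node \<open>e\<^sub>k - e\<^sub>5\<close>.\<close>

lemma F_quadric:
  assumes ijk: "(i, j, k) \<in> triples"
    and D: "D = 2 + c * e + \<beta> k * t"
    and M: "M = 2 * (e\<^sup>2 + (a + \<beta> j * c + c\<^sup>2) * t\<^sup>2 + \<beta> i * t * e) + c * e + \<beta> k * t"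
  shows "F (pt i j k (2 * t * D) (2 * e * D) (2 * c * t * D) (D - M) (D + M)) = 0"
proof -
  define m where "m = c * e + \<beta> k * t"
  define S where "S = e\<^sup>2 + (a + \<beta> j * c + c\<^sup>2) * t\<^sup>2 + \<beta> i * t * e"
  have "F (pt i j k (2 * t * D) (2 * e * D) (2 * c * t * D) (D - M) (D + M)) =
      4 * t * D\<^sup>2 * (m * (D - M) + D * (2 * S) - 2 * M)"
    unfolding F_pt[OF ijk] m_def S_def
    by (simp add: power2_eq_square power3_eq_cube algebra_simps)
  also have "2 * S = M - m" by (simp add: S_def m_def M)
  also have "m * (D - M) + D * (M - m) - 2 * M = M * (D - m - 2)" by (simp add: algebra_simps)
  also have "D - m - 2 = 0" by (simp add: D m_def)
  finally show ?thesis by simp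
qed

text \<open>The node \<open>e_k + e_5\<close> lies on both planes x1 = x_i = 0 and x1 = x_j = 0. On
  each residual quadric, parametrised by \<open>(e, t)\<close> with the node at the origin, x1 is
  \<open>t\<close> times a function that is nonzero there. Since \<open>P\<close> is nonzero and
  \<open>l\<close> zero at the node, \<open>l\<close> is divisible by \<open>t\<close> and so
  vanishes on the conic \<open>t = 0\<close> in the second plane. The conics for all
  \<open>c\<close> sweep out a dense part of that plane.\<close>

lemma vanishing_across_node:
  assumes ijk: "(i, j, k) \<in> triples"
    and P: "\<And>m. P m \<in> polyfun coords" "\<And>m. homog d (P m)" and Q: "\<And>m. Q m \<in> polyfun coords"
    and l: "l \<in> polyfun coords"
    and eq: "\<And>x m. F x = 0 \<Longrightarrow> (x $ 1) ^ N * P m x = l x * Q m x"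
    and node: "P m0 (pt i j k 0 0 0 1 1) \<noteq> 0"
    and van: "\<And>x. x $ 1 = 0 \<Longrightarrow> x $ i = 0 \<Longrightarrow> l x = 0"
    and x: "x $ 1 = 0" "x $ j = 0"
  shows "l x = 0"
proof -
  have conic: "l (pt i j k 0 (\<mu> * (2 * e * (2 + c * e))) 0 (\<mu> * (2 - 2 * e\<^sup>2)) (\<mu> * (2 + 2 * c * e + 2 * e\<^sup>2))) = 0"
    if \<mu>: "\<mu> \<noteq> 0" for \<mu> c e
  proof -
    define D where "D = (\<lambda>(e, t). 2 + c * e + \<beta> k * t)"
    define M where "M = (\<lambda>(e, t). 2 * (e\<^sup>2 + (a + \<beta> j * c + c\<^sup>2) * t\<^sup>2 + \<beta> i * t * e) + c * e + \<beta> k * t)"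
    \<comment> \<open>The scalar \<open>\<mu>\<close> is part of the parametrisation because
      \<open>l\<close> need not be homogeneous: its zeros have to be found on vectors, not on
      lines.\<close>
    define \<psi> where "\<psi> x = pt i j k (\<mu> * (2 * snd x * D x)) (\<mu> * (2 * fst x * D x)) (\<mu> * (2 * c * snd x * D x))
        (\<mu> * (D x - M x)) (\<mu> * (D x + M x))" for x
    have Dp: "D \<in> polyfun coords2" unfolding D_def case_prod_beta
      by (intro polyfun_intros polyfun_coords2)
    have Mp: "M \<in> polyfun coords2" unfolding M_def case_prod_beta
      by (intro polyfun_intros polyfun_coords2)
    have \<psi>: "(\<lambda>x. f (\<psi> x)) \<in> polyfun coords2" if "f \<in> polyfun coords" for f
      unfolding \<psi>_def by (intro polyfun_comp_pt[OF that] polyfun_intros polyfun_coords2 Dp Mp)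
    have \<psi>_scale: "\<psi> (e, t) = \<mu> *s pt i j k (2 * t * D (e, t)) (2 * e * D (e, t)) (2 * c * t * D (e, t))
        (D (e, t) - M (e, t)) (D (e, t) + M (e, t))" for e t
      unfolding \<psi>_def fst_conv snd_conv by (rule sym, rule pt_eqI[OF ijk]) (simp_all add: pt_nth[OF ijk])
    have F\<psi>: "F (\<psi> x) = 0" for x
    proof (cases x)
      case (Pair e t)
      have "F (pt i j k (2 * t * D (e, t)) (2 * e * D (e, t)) (2 * c * t * D (e, t))
        (D (e, t) - M (e, t)) (D (e, t) + M (e, t))) = 0"
        by (rule F_quadric[OF ijk]) (simp_all add: D_def M_def)
      then show ?thesis unfolding Pair \<psi>_scale F_scale by simp
    qed
    have "\<exists>r. \<forall>x. P m (\<psi> x) = ev2 r (fst x) (snd x)" for m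
      using polyfun_coords2_ev2[OF \<psi>[OF P(1)]] by blast
    then obtain p where p: "\<And>m x. P m (\<psi> x) = ev2 (p m) (fst x) (snd x)" by metis
    have "\<exists>r. \<forall>x. Q m (\<psi> x) = ev2 r (fst x) (snd x)" for m
      using polyfun_coords2_ev2[OF \<psi>[OF Q]] by blast
    then obtain q where q: "\<And>m x. Q m (\<psi> x) = ev2 (q m) (fst x) (snd x)" by metis
    obtain L where L: "\<And>x. l (\<psi> x) = ev2 L (fst x) (snd x)"
      using polyfun_coords2_ev2[OF \<psi>[OF l]] by metis
    obtain D' where D': "\<And>x. 2 * \<mu> * D x = ev2 D' (fst x) (snd x)"
      using polyfun_coords2_ev2[OF polyfun_mult[OF polyfun_const Dp]] by metis
    have "([:0, 1:] * D') ^ N * p m = L * q m" for m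
    proof (rule ev2_eqI)
      fix e t
      have "\<psi> (e, t) $ 1 = t * (2 * \<mu> * D (e, t))" by (simp add: \<psi>_def pt_nth[OF ijk])
      then show "ev2 (([:0, 1:] * D') ^ N * p m) e t = ev2 (L * q m) e t"
        using eq[OF F\<psi>[of "(e, t)"], of m] p[of m "(e, t)"] q[of m "(e, t)"] L[of "(e, t)"] D'[of "(e, t)"]
        by simp
    qed
    moreover have node': "\<psi> (0, 0) = (2 * \<mu>) *s pt i j k 0 0 0 1 1"
      by (rule sym, unfold \<psi>_def, rule pt_eqI[OF ijk]) (simp_all add: pt_nth[OF ijk] D_def M_def)
    then have "P m0 (\<psi> (0, 0)) \<noteq> 0" using node \<mu> by (simp add: homogD[OF P(2)])
    then have "ev2 (p m0) 0 0 \<noteq> 0" using p[of m0 "(0, 0)"] by simp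
    moreover have "ev2 D' 0 0 \<noteq> 0" unfolding D'[of "(0, 0)", unfolded fst_conv snd_conv, symmetric] using \<mu> by (simp add: D_def)
    moreover have "l (\<psi> (0, 0)) = 0" by (rule van) (simp_all add: node' pt_nth[OF ijk])
    then have "ev2 L 0 0 = 0" using L[of "(0, 0)"] by simp
    ultimately have "ev2 L e 0 = 0" by (rule vanishing_spreads_along_variable)
    then have "l (\<psi> (e, 0)) = 0" using L[of "(e, 0)"] by simp
    moreover have "\<psi> (e, 0) = pt i j k 0 (\<mu> * (2 * e * (2 + c * e))) 0 (\<mu> * (2 - 2 * e\<^sup>2)) (\<mu> * (2 + 2 * c * e + 2 * e\<^sup>2))"
      unfolding \<psi>_def by (rule pt_eqI[OF ijk]) (simp_all add: pt_nth[OF ijk] D_def M_def algebra_simps)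
    ultimately show ?thesis by simp
  qed
  have gen: "l (pt i j k 0 p 0 r w) = 0"
    if nz: "(w + r) * p * r * ((w + r)\<^sup>2 - p\<^sup>2) \<noteq> 0" for p r w
  proof -
    define W where "W = w + r"
    have nz': "W \<noteq> 0" "p \<noteq> 0" "r \<noteq> 0" "W\<^sup>2 - p\<^sup>2 \<noteq> 0" using nz by (auto simp: W_def)
    \<comment> \<open>The last two coordinates of the conic add up to
      \<open>2 * \<mu> * (2 + c * e)\<close>, so the first one divided by this sum \<open>W\<close>
      is \<open>e\<close>. Next \<open>r\<close> determines \<open>\<mu>\<close>, and
      \<open>W\<close> determines \<open>c\<close>.\<close>
    define e where "e = p / W"
    have e2: "1 - e\<^sup>2 \<noteq> 0" "e \<noteq> 0" using nz' by (auto simp: e_def power_divide)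
    define \<mu> where "\<mu> = r / (2 * (1 - e\<^sup>2))"
    have \<mu>: "\<mu> \<noteq> 0" using nz' e2 by (simp add: \<mu>_def)
    define c where "c = (W / (2 * \<mu>) - 2) / e"
    have 1: "2 + c * e = W / (2 * \<mu>)" using e2 by (simp add: c_def)
    have "\<mu> * (2 * e * (2 + c * e)) = e * W" unfolding 1 using \<mu> by simp
    then have 2: "\<mu> * (2 * e * (2 + c * e)) = p" using nz' by (simp add: e_def)
    have 3: "\<mu> * (2 - 2 * e\<^sup>2) = r" using e2 by (simp add: \<mu>_def divide_simps)
    have "\<mu> * (2 + 2 * c * e + 2 * e\<^sup>2) = 2 * \<mu> * (2 + c * e) - \<mu> * (2 - 2 * e\<^sup>2)"
      by (simp add: algebra_simps)
    then have 4: "\<mu> * (2 + 2 * c * e + 2 * e\<^sup>2) = w" unfolding 3 unfolding 1 using \<mu> by (simp add: W_def)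
    show ?thesis using conic[OF \<mu>, of e c] unfolding 2 3 4 .
  qed
  have pf: "(\<lambda>x. l (pt i j k 0 (x $ i) 0 (x $ k) (x $ 5))) \<in> polyfun coords"
    by (intro polyfun_comp_pt[OF l] polyfun_const polyfun_coord)
  have "l (pt i j k 0 (x $ i) 0 (x $ k) (x $ 5)) = 0"
  proof (rule polyfun_dense[OF pf])
    show "(\<lambda>x. (x $ 5 + x $ k) * x $ i * x $ k * ((x $ 5 + x $ k)\<^sup>2 - (x $ i)\<^sup>2)) \<in> polyfun coords"
      by (intro polyfun_intros polyfun_coord)
    show "l (pt i j k 0 (x $ i) 0 (x $ k) (x $ 5)) *
        ((x $ 5 + x $ k) * x $ i * x $ k * ((x $ 5 + x $ k)\<^sup>2 - (x $ i)\<^sup>2)) = 0" for x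
      using gen[of "x $ 5" "x $ k" "x $ i"]
      by (cases "(x $ 5 + x $ k) * x $ i * x $ k * ((x $ 5 + x $ k)\<^sup>2 - (x $ i)\<^sup>2) = 0") simp_all
    show "((\<chi> l. 1) $ 5 + (\<chi> l. 1) $ k) * (\<chi> l. 1) $ i * (\<chi> l. 1) $ k *
        (((\<chi> l. 1) $ 5 + (\<chi> l. 1) $ k)\<^sup>2 - ((\<chi> l. 1) $ i)\<^sup>2) \<noteq> (0::'k)" by simp
  qed
  moreover have "x = pt i j k 0 (x $ i) 0 (x $ k) (x $ 5)" using x by (intro pt_eqI[OF ijk]) auto
  ultimately show ?thesis by simp
qed

end

section \<open>Local representations are induced by a global one\<close>

lemma homog_mult: "homog d f \<Longrightarrow> homog e g \<Longrightarrow> homog (d + e) (\<lambda>x. f x * g x)"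
  by (simp add: homog_def power_add mult_ac)

lemma homog_coord: "homog 1 (\<lambda>x. x $ i)"
  by (simp add: homog_def)

lemma homogenize_vector:
  fixes f :: "'i::finite \<Rightarrow> 'a::field ^ 'n \<Rightarrow> 'a"
  assumes "\<And>m. f m \<in> polyfun coords"
  obtains D g where "\<And>m. g m \<in> polyfun coords" "\<And>m. homog D (g m)"
    "\<And>m x. x $ i \<noteq> 0 \<Longrightarrow> g m x = (x $ i) ^ D * f m (inverse (x $ i) *s x)"
proof -
  have "\<forall>m. \<exists>D. \<forall>D'\<ge>D. \<exists>g\<in>polyfun coords. homog D' g \<and>
      (\<forall>x. x $ i \<noteq> 0 \<longrightarrow> g x = (x $ i) ^ D' * f m (inverse (x $ i) *s x))"
    using polyfun_homogenize[OF assms] by blast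
  then obtain E where E: "\<And>m D'. E m \<le> D' \<Longrightarrow> \<exists>g\<in>polyfun coords. homog D' g \<and>
      (\<forall>x. x $ i \<noteq> 0 \<longrightarrow> g x = (x $ i) ^ D' * f m (inverse (x $ i) *s x))" by metis
  define D where "D = (\<Sum>m\<in>UNIV. E m)"
  have "E m \<le> D" for m unfolding D_def by (rule member_le_sum) auto
  then have "\<forall>m. \<exists>g. g \<in> polyfun coords \<and> homog D g \<and>
      (\<forall>x. x $ i \<noteq> 0 \<longrightarrow> g x = (x $ i) ^ D * f m (inverse (x $ i) *s x))" using E by blast
  then obtain g where "\<And>m. g m \<in> polyfun coords \<and> homog D (g m) \<and>
      (\<forall>x. x $ i \<noteq> 0 \<longrightarrow> g m x = (x $ i) ^ D * f m (inverse (x $ i) *s x))" by metis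
  then show ?thesis by (intro that[of g D]) auto
qed

text \<open>Only the component of degree \<open>d\<close> of the quotient survives: compare
  coefficients of the scalar \<open>c\<close> in the relation at \<open>c *s x\<close>.\<close>

lemma homogeneous_quotient:
  fixes f g :: "'a::field_char_0 ^ 'n \<Rightarrow> 'a"
  assumes g: "g \<in> polyfun coords" and f: "homog (Suc d) f"
    and C: "\<And>c x. x \<in> C \<Longrightarrow> c *s x \<in> C" and eq: "\<And>x. x \<in> C \<Longrightarrow> f x = x $ i * g x"
  obtains h where "h \<in> polyfun coords" "homog d h" "\<And>x. x \<in> C \<Longrightarrow> f x = x $ i * h x"
proof -
  obtain h M where h: "\<And>j. h j \<in> polyfun coords" "\<And>j. homog j (h j)" "\<And>x. g x = (\<Sum>j\<le>M. h j x)"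
    using polyfun_homogeneous_components[OF g] by metis
  \<comment> \<open>Components beyond \<open>M\<close> do not occur in the sum for \<open>g\<close>,
    so there the one of degree \<open>d\<close> is taken to be 0.\<close>
  define h' where "h' = (if d \<le> M then h d else (\<lambda>_. 0))"
  have "f x = x $ i * h' x" if x: "x \<in> C" for x
  proof -
    define p where "p = monom (f x) (Suc d) - pCons 0 (\<Sum>j\<le>M. monom (x $ i * h j x) j)"
    have "poly p c = 0" for c
    proof -
      have "c ^ Suc d * f x = f (c *s x)" by (simp only: homogD[OF f])
      also have "\<dots> = (c * x $ i) * (\<Sum>j\<le>M. h j (c *s x))" using eq[OF C[OF x, of c]] h(3) by simp
      also have "\<dots> = c * (\<Sum>j\<le>M. c ^ j * (x $ i * h j x))"
        unfolding homogD[OF h(2)] mult.assoc sum_distrib_left by (simp add: mult_ac)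
      finally show ?thesis by (simp add: p_def poly_monom poly_sum mult_ac)
    qed
    then have "\<forall>c. poly p c = 0" by (rule allI)
    then have "p = 0" by (simp only: poly_all_0_iff_0)
    then have "coeff p (Suc d) = 0" by simp
    then show ?thesis by (cases "d \<le> M") (simp_all add: p_def coeff_sum h'_def)
  qed
  moreover have "h' \<in> polyfun coords" "homog d h'"
    using h unfolding h'_def by (auto simp: homog_def intro: polyfun_const)
  ultimately show ?thesis using that by blast
qed

context cubic_cone
begin

section \<open>The affine chart\<close>

lemma F_0 [simp]: "F 0 = 0"
  by (simp add: cubic_fun_def)

lemma F_scale_0: "F x = 0 \<Longrightarrow> F (c *s x) = 0"
  by (simp add: F_scale)

text \<open>The inverse of \<open>r, s = 2 x2 + x3 x4 + b1 +- 2 x5\<close>, the two factors of the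
  difference of squares obtained by completing the square in x2.\<close>

definition chart :: "'k \<times> 'k \<times> 'k \<times> 'k \<Rightarrow> 'k ^ 5" where
  "chart x = pt 2 3 4 1
     (inverse 4 * (fst (snd (snd x)) + snd (snd (snd x))) - inverse 2 * (fst x * fst (snd x) + b1))
     (fst x) (fst (snd x)) (inverse 4 * (fst (snd (snd x)) - snd (snd (snd x))))"

lemma triple_234: "(2, 3, 4) \<in> triples"
  by (simp add: triples_def)

lemma F_chart: "4 * F (chart (y, z, r, s)) = r * s - ev2 (branch a b1 b2 b3) y z"
proof -
  define p where "p = inverse 4 * (r + s) - inverse 2 * (y * z + b1)"
  define w where "w = inverse 4 * (r - s)"
  have "2 * p = (2 * inverse 4) * (r + s) - (2 * inverse 2) * (y * z + b1)"
    by (simp only: p_def right_diff_distrib mult.assoc)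
  moreover have "2 * inverse 4 = inverse (2::'k)" "2 * inverse 2 = (1::'k)" by simp_all
  ultimately have 1: "2 * p + (y * z + b1) = inverse 2 * (r + s)" by simp
  have "4 * F (chart (y, z, r, s)) = (2 * p + (y * z + b1))\<^sup>2 - 4 * w\<^sup>2 - ev2 (branch a b1 b2 b3) y z"
    unfolding chart_def fst_conv snd_conv p_def[symmetric] w_def[symmetric] F_pt[OF triple_234] ev2_branch
    by (simp add: \<beta>_def power2_eq_square algebra_simps)
  also have "(2 * p + (y * z + b1))\<^sup>2 - 4 * w\<^sup>2 = r * s"
    unfolding 1 by (simp add: w_def power2_eq_square field_simps)
  finally show ?thesis .
qed

definition chart_inv :: "'k ^ 5 \<Rightarrow> 'k \<times> 'k \<times> 'k \<times> 'k" where
  "chart_inv x = (x $ 3, x $ 4, 2 * x $ 2 + x $ 3 * x $ 4 + b1 + 2 * x $ 5,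
     2 * x $ 2 + x $ 3 * x $ 4 + b1 - 2 * x $ 5)"

lemma chart_chart_inv: "x $ 1 = 1 \<Longrightarrow> chart (chart_inv x) = x"
  unfolding chart_def
  by (rule sym, rule pt_eqI[OF triple_234]) (simp_all add: chart_inv_def field_simps)

lemma chart_1: "chart x $ 1 = 1"
  by (simp add: chart_def pt_nth[OF triple_234])

lemma polyfun_chart: "f \<in> polyfun coords \<Longrightarrow> (\<lambda>x. f (chart x)) \<in> polyfun coords4"
  unfolding chart_def
  by (rule polyfun_comp_pt, assumption) (intro polyfun_intros polyfun_coords4')+

lemma polyfun_chart_inv: "f \<in> polyfun coords4 \<Longrightarrow> (\<lambda>x. f (chart_inv x)) \<in> polyfun coords"
  unfolding chart_inv_def
  by (rule polyfun_coords4_comp, assumption) (intro polyfun_intros polyfun_coord)+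

text \<open>\<open>P\<close> is a multiple of \<open>Q\<close> on the cone once x1 is inverted;
  \<open>N\<close> counts the powers of x1 that remain to be cancelled.\<close>

definition linked :: "nat \<Rightarrow> (5 \<Rightarrow> 'k ^ 5 \<Rightarrow> 'k) \<Rightarrow> (5 \<Rightarrow> 'k ^ 5 \<Rightarrow> 'k) \<Rightarrow> bool" where
  "linked N P Q \<longleftrightarrow> (\<exists>l\<in>polyfun coords. \<forall>x. F x = 0 \<longrightarrow> (\<forall>m. (x $ 1) ^ N * P m x = l x * Q m x))"

lemma plane_irreducible:
  assumes "l \<in> polyfun coords" "q \<in> polyfun coords"
    and "\<And>x. x $ 1 = 0 \<Longrightarrow> x $ i = 0 \<Longrightarrow> l x * q x = 0"
    and "y $ 1 = 0" "y $ i = 0" "q y \<noteq> 0" and x: "x $ 1 = 0" "x $ i = (0::'k)"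
  shows "l x = 0"
proof -
  have "l (kill 1 (kill i x)) = 0"
  proof (rule polyfun_dense[where f = "\<lambda>x. l (kill 1 (kill i x))" and g = "\<lambda>x. q (kill 1 (kill i x))" and y = y])
    show "(\<lambda>x. l (kill 1 (kill i x))) \<in> polyfun coords" "(\<lambda>x. q (kill 1 (kill i x))) \<in> polyfun coords"
      using polyfun_kill[OF polyfun_kill[OF assms(1)]] polyfun_kill[OF polyfun_kill[OF assms(2)]]
      by (simp_all)
    show "l (kill 1 (kill i x)) * q (kill 1 (kill i x)) = 0" for x
      by (rule assms(3)) simp_all
    show "q (kill 1 (kill i y)) \<noteq> 0" using assms(4-6) by (simp add: kill_id)
  qed
  then show ?thesis using x by (simp add: kill_id)
qed

text \<open>When \<open>h * l\<close> vanishes at infinity it is divisible by x1, so one power of x1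
  can be cancelled if \<open>P\<close> is multiplied by \<open>h\<close>. The factor
  \<open>h\<close> will be a coordinate that is nonzero at a given node, or 1.\<close>

lemma linked_reduce:
  assumes P: "\<And>m. P m \<in> polyfun coords" and Q: "\<And>m. Q m \<in> polyfun coords"
    and l: "l \<in> polyfun coords"
    and eq: "\<And>x m. F x = 0 \<Longrightarrow> (x $ 1) ^ Suc N * P m x = l x * Q m x"
    and h: "h \<in> polyfun coords"
    and 0: "\<And>x. F x = 0 \<Longrightarrow> x $ 1 = 0 \<Longrightarrow> h x * l x = 0"
  shows "linked N (\<lambda>m x. h x * P m x) Q"
proof -
  obtain g where g: "g \<in> polyfun coords" "\<And>x. F x = 0 \<Longrightarrow> h x * l x = x $ 1 * g x"
    by (rule divide_by_x1[OF polyfun_mult[OF h l] 0]) (assumption | rule that)+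
  have "(x $ 1) ^ N * (h x * P m x) = g x * Q m x" if "F x = 0" for x m
  proof -
    have "(\<lambda>x. (x $ 1) ^ N * (h x * P m x) - g x * Q m x) \<in> polyfun coords"
      by (intro polyfun_intros polyfun_coord h P g Q)
    moreover have "x $ 1 * ((x $ 1) ^ N * (h x * P m x) - g x * Q m x) = 0" if "F x = 0" for x
    proof -
      have "x $ 1 * ((x $ 1) ^ N * (h x * P m x)) = h x * ((x $ 1) ^ Suc N * P m x)" by simp
      also have "\<dots> = h x * l x * Q m x" unfolding eq[OF that] by simp
      also have "\<dots> = x $ 1 * (g x * Q m x)" unfolding g(2)[OF that] by simp
      finally show ?thesis by (simp add: right_diff_distrib)
    qed
    ultimately have "(x $ 1) ^ N * (h x * P m x) - g x * Q m x = 0"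
      using that by (rule cancel_x1)
    then show ?thesis by simp
  qed
  then show ?thesis unfolding linked_def using g(1) by blast
qed

lemma linked_wedge:
  assumes P: "\<And>m. P m \<in> polyfun coords" and Q: "\<And>m. Q m \<in> polyfun coords"
    and PQ: "linked N P Q" and x: "F x = 0"
  shows "P i x * Q j x = P j x * Q i x"
proof -
  obtain l where l: "\<And>x m. F x = 0 \<Longrightarrow> (x $ 1) ^ N * P m x = l x * Q m x"
    using PQ unfolding linked_def by blast
  have "(\<lambda>x. P i x * Q j x - P j x * Q i x) \<in> polyfun coords" by (intro polyfun_intros P Q)
  then have "P i x * Q j x - P j x * Q i x = 0"
  proof (rule x1_nonzero_dense[OF _ _ x])
    fix x assume x: "F x = 0" "x $ 1 \<noteq> 0"
    have "(x $ 1) ^ N * (P i x * Q j x - P j x * Q i x) =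
      ((x $ 1) ^ N * P i x) * Q j x - ((x $ 1) ^ N * P j x) * Q i x" by (simp add: algebra_simps)
    also have "\<dots> = 0" unfolding l[OF x(1)] by simp
    finally show "P i x * Q j x - P j x * Q i x = 0" using x(2) by simp
  qed
  then show ?thesis by simp
qed

text \<open>The family is restricted to x1 = 1, where factoriality gives a common vector; this
  vector is homogenised again. Its behaviour at infinity is left open.\<close>

lemma affine_representation:
  fixes \<P> :: "(nat \<times> (5 \<Rightarrow> 'k ^ 5 \<Rightarrow> 'k)) set"
  assumes poly: "\<And>d P m. (d, P) \<in> \<P> \<Longrightarrow> P m \<in> polyfun coords"
    and hom: "\<And>d P m. (d, P) \<in> \<P> \<Longrightarrow> homog d (P m)"
    and wedge: "\<And>d P e Q x i j. (d, P) \<in> \<P> \<Longrightarrow> (e, Q) \<in> \<P> \<Longrightarrow> F x = 0 \<Longrightarrow>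
        P i x * Q j x = P j x * Q i x"
    and nz: "\<And>x. F x = 0 \<Longrightarrow> x \<noteq> 0 \<Longrightarrow> \<exists>d P m. (d, P) \<in> \<P> \<and> P m x \<noteq> 0"
  obtains D Q where "\<And>m. Q m \<in> polyfun coords" "\<And>m. homog D (Q m)"
    "\<And>x. F x = 0 \<Longrightarrow> x $ 1 \<noteq> 0 \<Longrightarrow> \<exists>m. Q m x \<noteq> 0"
    "\<And>d P. (d, P) \<in> \<P> \<Longrightarrow> \<exists>N. linked N P Q"
proof -
  interpret hyperbolic_threefold "branch a b1 b2 b3" by (rule branch_hyperbolic_threefold[OF ns])
  have FV: "F (chart x) = 0 \<longleftrightarrow> x \<in> V" for x
    using F_chart by (cases x) (metis V_iff eq_iff_diff_eq_0 mult_eq_0_iff zero_neq_numeral)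
  define \<P>' where "\<P>' = {\<lambda>m x. P m (chart x) |d P. (d, P) \<in> \<P>}"
  have "\<exists>p. (\<forall>m. p m \<in> polyfun coords4) \<and> (\<forall>x\<in>V. \<exists>m. p m x \<noteq> 0) \<and>
      (\<forall>P\<in>\<P>'. \<exists>l\<in>polyfun coords4. \<forall>x\<in>V. \<forall>m. P m x = l x * p m x)"
  proof (rule proportional_family[of \<P>'])
    show "P m \<in> polyfun coords4" if "P \<in> \<P>'" for P m
      using that poly polyfun_chart unfolding \<P>'_def by auto
    show "P i x * Q j x = P j x * Q i x" if "P \<in> \<P>'" "Q \<in> \<P>'" "x \<in> V" for P Q i j x
    proof -
      obtain d P' where P': "P = (\<lambda>m x. P' m (chart x))" "(d, P') \<in> \<P>"
        using \<open>P \<in> \<P>'\<close> unfolding \<P>'_def by blast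
      obtain e Q' where Q': "Q = (\<lambda>m x. Q' m (chart x))" "(e, Q') \<in> \<P>"
        using \<open>Q \<in> \<P>'\<close> unfolding \<P>'_def by blast
      have "F (chart x) = 0" using FV \<open>x \<in> V\<close> by blast
      from wedge[OF P'(2) Q'(2) this] show ?thesis unfolding P' Q' .
    qed
    show "\<exists>P\<in>\<P>'. \<exists>m. P m x \<noteq> 0" if "x \<in> V" for x
    proof -
      have "chart x \<noteq> 0" using chart_1[of x] by auto
      moreover have "F (chart x) = 0" using FV that by blast
      ultimately have "\<exists>d P m. (d, P) \<in> \<P> \<and> P m (chart x) \<noteq> 0" by (intro nz)
      then obtain d P m where "(d, P) \<in> \<P>" "P m (chart x) \<noteq> 0" by (elim exE conjE)
      moreover have "(\<lambda>m x. P m (chart x)) \<in> \<P>'"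
        using \<open>(d, P) \<in> \<P>\<close> unfolding \<P>'_def by blast
      ultimately show ?thesis by (intro bexI[of _ "\<lambda>m x. P m (chart x)"]) auto
    qed
  qed blast
  then obtain p where p: "\<And>m. p m \<in> polyfun coords4" "\<And>x. x \<in> V \<Longrightarrow> \<exists>m. p m x \<noteq> 0"
    "\<And>P. P \<in> \<P>' \<Longrightarrow> \<exists>l\<in>polyfun coords4. \<forall>x\<in>V. \<forall>m. P m x = l x * p m x" by blast
  define p1 where "p1 m x = p m (chart_inv x)" for m x
  have p1: "p1 m \<in> polyfun coords" for m
    unfolding p1_def by (rule polyfun_chart_inv[OF p(1)])
  obtain D Q where Q: "\<And>m. Q m \<in> polyfun coords" "\<And>m. homog D (Q m)"
    "\<And>m x. x $ 1 \<noteq> 0 \<Longrightarrow> Q m x = (x $ 1) ^ D * p1 m (inverse (x $ 1) *s x)"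
    by (rule homogenize_vector[OF p1, of 1]) (rule that)
  have norm: "F (inverse (x $ 1) *s x) = 0" "chart_inv (inverse (x $ 1) *s x) \<in> V"
      "chart (chart_inv (inverse (x $ 1) *s x)) = inverse (x $ 1) *s x"
      "x = x $ 1 *s (inverse (x $ 1) *s x)"
    if "F x = 0" "x $ 1 \<noteq> 0" for x
  proof -
    show 1: "F (inverse (x $ 1) *s x) = 0" by (rule F_scale_0[OF that(1)])
    show 2: "chart (chart_inv (inverse (x $ 1) *s x)) = inverse (x $ 1) *s x"
      by (rule chart_chart_inv) (use that in simp)
    show "chart_inv (inverse (x $ 1) *s x) \<in> V" using 1 by (simp add: 2 flip: FV)
    show "x = x $ 1 *s (inverse (x $ 1) *s x)" using that(2) by (simp add: vector_smult_assoc)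
  qed
  show ?thesis
  proof (rule that[OF Q(1,2)])
    fix x assume x: "F x = 0" "x $ 1 \<noteq> 0"
    obtain m where "p1 m (inverse (x $ 1) *s x) \<noteq> 0" using p(2)[OF norm(2)[OF x]] unfolding p1_def by blast
    then have "Q m x \<noteq> 0" using x(2) by (simp add: Q(3))
    then show "\<exists>m. Q m x \<noteq> 0" by blast
  next
    fix d P assume P: "(d, P) \<in> \<P>"
    then have "(\<lambda>m x. P m (chart x)) \<in> \<P>'" unfolding \<P>'_def by blast
    from p(3)[OF this] obtain l where l: "l \<in> polyfun coords4"
      "\<And>x m. x \<in> V \<Longrightarrow> P m (chart x) = l x * p m x" by blast
    have l1: "(\<lambda>x. l (chart_inv x)) \<in> polyfun coords" by (rule polyfun_chart_inv[OF l(1)])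
    obtain E L where L: "L \<in> polyfun coords"
      "\<And>x. x $ 1 \<noteq> 0 \<Longrightarrow> L x = (x $ 1) ^ E * l (chart_inv (inverse (x $ 1) *s x))"
      using polyfun_homogenize[OF l1, of 1] by blast
    \<comment> \<open>The homogenisations are known only where x1 is nonzero; one more factor x1 on
      each side makes the relation trivial at infinity.\<close>
    have "(x $ 1) ^ Suc (D + E) * P m x = ((x $ 1) ^ Suc d * L x) * Q m x" if x: "F x = 0" for x m
    proof (cases "x $ 1 = 0")
      case False
      define x' where "x' = inverse (x $ 1) *s x"
      have "P m x = (x $ 1) ^ d * P m x'"
        unfolding x'_def by (subst norm(4)[OF x False]) (rule homogD[OF hom[OF P]])
      also have "P m x' = l (chart_inv x') * p1 m x'"
        using l(2)[OF norm(2)[OF x False], of m] unfolding norm(3)[OF x False] p1_def x'_def .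
      finally show ?thesis using False by (simp add: L(2) Q(3) x'_def power_add mult_ac)
    qed simp
    moreover have "(\<lambda>x. (x $ 1) ^ Suc d * L x) \<in> polyfun coords"
      by (intro polyfun_intros polyfun_coord L)
    ultimately show "\<exists>N. linked N P Q" unfolding linked_def
      by (intro exI[of _ "Suc (D + E)"] bexI[of _ "\<lambda>x. (x $ 1) ^ Suc d * L x"]) auto
  qed
qed

lemma exists_affine_point: "\<exists>x. F x = 0 \<and> x $ 1 \<noteq> 0"
proof -
  obtain w where "1 * w\<^sup>2 + 0 * w + (- a) = (0::'k)" using quadratic_root[of 1 0 "- a"] by auto
  then have "F (pt 2 3 4 1 0 0 0 w) = 0" by (simp add: F_pt[OF triple_234])
  then show ?thesis using pt_nth(1)[OF triple_234] by (metis zero_neq_one)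
qed

text \<open>A vector vanishing at all points at infinity could be divided by x1 within the
  homogeneous functions, so one of least degree does not.\<close>

lemma minimal_representation:
  fixes \<P> :: "(nat \<times> (5 \<Rightarrow> 'k ^ 5 \<Rightarrow> 'k)) set"
  assumes poly: "\<And>d P m. (d, P) \<in> \<P> \<Longrightarrow> P m \<in> polyfun coords"
    and hom: "\<And>d P m. (d, P) \<in> \<P> \<Longrightarrow> homog d (P m)"
    and wedge: "\<And>d P e Q x i j. (d, P) \<in> \<P> \<Longrightarrow> (e, Q) \<in> \<P> \<Longrightarrow> F x = 0 \<Longrightarrow>
        P i x * Q j x = P j x * Q i x"
    and nz: "\<And>x. F x = 0 \<Longrightarrow> x \<noteq> 0 \<Longrightarrow> \<exists>d P m. (d, P) \<in> \<P> \<and> P m x \<noteq> 0"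
  obtains D Q where "\<And>m. Q m \<in> polyfun coords" "\<And>m. homog D (Q m)"
    "\<And>x. F x = 0 \<Longrightarrow> x $ 1 \<noteq> 0 \<Longrightarrow> \<exists>m. Q m x \<noteq> 0"
    "\<And>d P. (d, P) \<in> \<P> \<Longrightarrow> \<exists>N. linked N P Q"
    "\<exists>x m. F x = 0 \<and> x $ 1 = 0 \<and> Q m x \<noteq> 0"
proof -
  define good where "good D Q \<longleftrightarrow> (\<forall>m. Q m \<in> polyfun coords \<and> homog D (Q m)) \<and>
      (\<forall>x. F x = 0 \<longrightarrow> x $ 1 \<noteq> 0 \<longrightarrow> (\<exists>m. Q m x \<noteq> 0)) \<and>
      (\<forall>d P. (d, P) \<in> \<P> \<longrightarrow> (\<exists>N. linked N P Q))" for D and Q :: "5 \<Rightarrow> 'k ^ 5 \<Rightarrow> 'k"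
  have "\<exists>D Q. good D Q"
    unfolding good_def by (rule affine_representation[of \<P>]) ((fact poly hom wedge nz)+, blast)
  then have ex: "\<exists>D. \<exists>Q. good D Q" .
  define D where "D = (LEAST D. \<exists>Q. good D Q)"
  obtain Q where Q: "good D Q" using LeastI_ex[OF ex] unfolding D_def by blast
  have Qp: "Q m \<in> polyfun coords" "homog D (Q m)" for m using Q by (simp_all add: good_def)
  have "\<exists>x m. F x = 0 \<and> x $ 1 = 0 \<and> Q m x \<noteq> 0"
  proof (rule ccontr)
    assume "\<not> ?thesis"
    then have van: "F x = 0 \<Longrightarrow> x $ 1 = 0 \<Longrightarrow> Q m x = 0" for x m by blast
    obtain y where y: "F y = 0" "y $ 1 \<noteq> 0" using exists_affine_point by blast
    then obtain m0 where m0: "Q m0 y \<noteq> 0" using Q unfolding good_def by blast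
    \<comment> \<open>In degree 0 the entries are constant, and they would already be zero at the
      origin, which has x1 = 0.\<close>
    have "D \<noteq> 0"
    proof
      assume "D = 0"
      then have "Q m0 (0 *s y) = Q m0 y" using homogD[OF Qp(2), of m0 0 y] by simp
      moreover have "Q m0 (0 *s y) = 0" by (rule van) (simp_all add: F_scale_0 y)
      ultimately show False using m0 by simp
    qed
    then obtain d where d: "D = Suc d" using not0_implies_Suc by blast
    have "\<exists>h. h \<in> polyfun coords \<and> homog d h \<and> (\<forall>x. F x = 0 \<longrightarrow> Q m x = x $ 1 * h x)" for m
    proof -
      obtain g where g: "g \<in> polyfun coords" "\<And>x. F x = 0 \<Longrightarrow> Q m x = x $ 1 * g x"
        by (rule divide_by_x1[OF Qp(1) van]) (assumption | rule that)+
      have "homog (Suc d) (Q m)" using Qp(2) unfolding d .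
      then show ?thesis
        by (rule homogeneous_quotient[OF g(1), of _ _ "{x. F x = 0}" 1]) (use g(2) F_scale_0 in auto)
    qed
    then obtain h where h: "\<And>m. h m \<in> polyfun coords" "\<And>m. homog d (h m)"
      "\<And>m x. F x = 0 \<Longrightarrow> Q m x = x $ 1 * h m x" by metis
    have "good d h"
      unfolding good_def
    proof (intro conjI allI impI h)
      show "\<exists>m. h m x \<noteq> 0" if "F x = 0" "x $ 1 \<noteq> 0" for x
        using Q that h(3) unfolding good_def by (metis mult_zero_right)
      fix e P assume "(e, P) \<in> \<P>"
      then obtain N l where "l \<in> polyfun coords"
        "\<And>x m. F x = 0 \<Longrightarrow> (x $ 1) ^ N * P m x = l x * Q m x"
        using Q unfolding good_def linked_def by metis
      then have "(\<lambda>x. l x * x $ 1) \<in> polyfun coords"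
        "\<And>x m. F x = 0 \<Longrightarrow> (x $ 1) ^ N * P m x = (l x * x $ 1) * h m x"
        by (simp_all add: h(3) mult.assoc polyfun_mult polyfun_coord)
      then show "\<exists>N. linked N P h" unfolding linked_def
        by (intro exI[of _ N] bexI[of _ "\<lambda>x. l x * x $ 1"]) auto
    qed
    then have "D \<le> d" unfolding D_def by (intro Least_le) blast
    then show False using d by simp
  qed
  with Q show ?thesis unfolding good_def by (intro that[of Q D]) blast+
qed

lemma vanishing_at_infinity:
  assumes "\<And>i y. i \<in> {2, 3, 4} \<Longrightarrow> y $ 1 = 0 \<Longrightarrow> y $ i = 0 \<Longrightarrow> l y = (0::'k)"
    and "F x = 0" "x $ 1 = 0"
  shows "l x = 0"
proof -
  have "x $ 2 = 0 \<or> x $ 3 = 0 \<or> x $ 4 = 0" using F_at_infinity assms(2,3) by simp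
  then show ?thesis using assms(1)[of 2 x] assms(1)[of 3 x] assms(1)[of 4 x] assms(3) by auto
qed

text \<open>Induction on the power of x1. For power 0, \<open>Q\<close> is nonzero at the node,
  which lies on the second plane. Otherwise \<open>l\<close> vanishes on the first plane, where
  \<open>Q\<close> is not identically zero, and across the node also on the second, so one power can
  be cancelled.\<close>

lemma nonvanishing_spreads:
  fixes \<P> :: "(nat \<times> (5 \<Rightarrow> 'k ^ 5 \<Rightarrow> 'k)) set"
  assumes ijk: "(i, j, k) \<in> triples"
    and Q: "\<And>m. Q m \<in> polyfun coords"
    and P: "\<And>m. P m \<in> polyfun coords" "\<And>m. homog d (P m)" "P m0 (pt i j k 0 0 0 1 1) \<noteq> 0"
    and PQ: "linked N P Q"
    and y: "y $ 1 = 0" "y $ i = 0" "Q m1 y \<noteq> 0"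
  shows "\<exists>x m. x $ 1 = 0 \<and> x $ j = 0 \<and> Q m x \<noteq> 0"
  using P PQ
proof (induction N arbitrary: P d m0)
  case 0
  let ?n = "pt i j k 0 0 0 1 1 :: 'k ^ 5"
  obtain l where l: "\<And>x m. F x = 0 \<Longrightarrow> (x $ 1) ^ 0 * P m x = l x * Q m x"
    using 0(4) unfolding linked_def by blast
  have "F ?n = 0" by (simp add: F_pt[OF ijk])
  from l[OF this, of m0] have "Q m0 ?n \<noteq> 0" using 0(3) by auto
  then show ?case using pt_nth[OF ijk] by metis
next
  case (Suc N)
  obtain l where l: "l \<in> polyfun coords"
    "\<And>x m. F x = 0 \<Longrightarrow> (x $ 1) ^ Suc N * P m x = l x * Q m x"
    using Suc.prems(4) unfolding linked_def by metis
  have "l x = 0" if "x $ 1 = 0" "x $ i = 0" for x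
  proof (rule plane_irreducible[OF l(1) Q _ y that])
    fix x assume x: "x $ 1 = 0" "x $ i = (0::'k)"
    then have "F x = 0" by (simp add: F_triple[OF ijk])
    from l(2)[OF this, of m1] show "l x * Q m1 x = 0" using x(1) by simp
  qed
  note van_i = this
  have van_j: "l x = 0" if "x $ 1 = 0" "x $ j = 0" for x
    by (rule vanishing_across_node[OF ijk, where P = P and d = d and Q = Q and N = "Suc N" and l = l])
      (fact Suc.prems Q l van_i that)+
  \<comment> \<open>\<open>l\<close> vanishes on the planes of \<open>i\<close> and
    \<open>j\<close>, and \<open>x $ k\<close> on the third. As \<open>x $ k\<close> is 1 at the
    node, the enlarged \<open>P\<close> is still nonzero there.\<close>
  have "linked N (\<lambda>m x. x $ k * P m x) Q"
  proof (rule linked_reduce[OF Suc.prems(1) Q l polyfun_coord])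
    fix x assume x: "F x = 0" "x $ 1 = 0"
    then have "x $ i * x $ j * x $ k = 0" by (simp add: F_triple[OF ijk])
    then show "x $ k * l x = 0" using van_i van_j x by auto
  qed
  moreover have "(\<lambda>x. x $ k * P m x) \<in> polyfun coords" "homog (1 + d) (\<lambda>x. x $ k * P m x)" for m
    by (intro polyfun_mult polyfun_coord Suc.prems(1)) (intro homog_mult homog_coord Suc.prems(2))
  moreover have "pt i j k 0 0 0 1 1 $ k * P m0 (pt i j k 0 0 0 1 1) \<noteq> 0"
    using Suc.prems(3) by (simp add: pt_nth[OF ijk])
  ultimately show ?case by (intro Suc.IH[of "\<lambda>m x. x $ k * P m x" "1 + d" m0])
qed

text \<open>Near a node two of the three planes pass, neither of which is a Cartier divisor there, but
  their sum is.\<close>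

theorem global_representation:
  fixes \<P> :: "(nat \<times> (5 \<Rightarrow> 'k ^ 5 \<Rightarrow> 'k)) set"
  assumes poly: "\<And>d P m. (d, P) \<in> \<P> \<Longrightarrow> P m \<in> polyfun coords"
    and hom: "\<And>d P m. (d, P) \<in> \<P> \<Longrightarrow> homog d (P m)"
    and wedge: "\<And>d P e Q x i j. (d, P) \<in> \<P> \<Longrightarrow> (e, Q) \<in> \<P> \<Longrightarrow> F x = 0 \<Longrightarrow>
        P i x * Q j x = P j x * Q i x"
    and nz: "\<And>x. F x = 0 \<Longrightarrow> x \<noteq> 0 \<Longrightarrow> \<exists>d P m. (d, P) \<in> \<P> \<and> P m x \<noteq> 0"
  obtains D Q where "\<And>m. Q m \<in> polyfun coords" "\<And>m. homog D (Q m)"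
    "\<And>x. F x = 0 \<Longrightarrow> x \<noteq> 0 \<Longrightarrow> \<exists>m. Q m x \<noteq> 0"
    "\<And>d P x i j. (d, P) \<in> \<P> \<Longrightarrow> F x = 0 \<Longrightarrow> P i x * Q j x = P j x * Q i x"
proof -
  obtain D Q where Q: "\<And>m. Q m \<in> polyfun coords" "\<And>m. homog D (Q m)"
    "\<And>x. F x = 0 \<Longrightarrow> x $ 1 \<noteq> 0 \<Longrightarrow> \<exists>m. Q m x \<noteq> 0"
    "\<And>d P. (d, P) \<in> \<P> \<Longrightarrow> \<exists>N. linked N P Q"
    "\<exists>x m. F x = 0 \<and> x $ 1 = 0 \<and> Q m x \<noteq> 0"
    by (rule minimal_representation[of \<P>];
      (erule poly | erule hom | (rule wedge; assumption) | (rule nz; assumption) | (rule that; assumption)))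
  define T where "T i \<longleftrightarrow> (\<exists>x m. x $ 1 = 0 \<and> x $ i = 0 \<and> Q m x \<noteq> 0)" for i
  have spread: "T j" if ijk: "(i, j, k) \<in> triples" and "T i" for i j k
  proof -
    let ?n = "pt i j k 0 0 0 1 1 :: 'k ^ 5"
    have "F ?n = 0" by (simp add: F_pt[OF ijk])
    moreover have "?n \<noteq> 0" using pt_nth(4)[OF ijk, of 0 0 0 1 1] by (metis zero_index zero_neq_one)
    ultimately obtain d P m where P: "(d, P) \<in> \<P>" "P m ?n \<noteq> 0" using nz by blast
    obtain N where N: "linked N P Q" using Q(4)[OF P(1)] by blast
    obtain y m1 where y: "y $ 1 = 0" "y $ i = 0" "Q m1 y \<noteq> 0" using \<open>T i\<close> unfolding T_def by blast
    show ?thesis unfolding T_def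
      by (rule nonvanishing_spreads[OF ijk Q(1) poly[OF P(1)] hom[OF P(1)] P(2) N y])
  qed
  obtain y m where y: "F y = 0" "y $ 1 = 0" "Q m y \<noteq> 0" using Q(5) by blast
  then have "y $ 2 = 0 \<or> y $ 3 = 0 \<or> y $ 4 = 0" by (simp add: F_at_infinity)
  then have "T 2 \<or> T 3 \<or> T 4" using y(2,3) unfolding T_def by blast
  moreover have "T 2 \<longrightarrow> T 3" "T 3 \<longrightarrow> T 4" "T 4 \<longrightarrow> T 2"
    using spread[of 2 3 4] spread[of 3 4 2] spread[of 4 2 3] by (simp_all add: triples_def)
  ultimately have "T 2 \<and> T 3 \<and> T 4" by blast
  then have T: "T i" if "i \<in> {2, 3, 4}" for i using that by blast
  \<comment> \<open>Once \<open>Q\<close> is not identically zero on any of the three planes,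
    \<open>l\<close> vanishes on all of them as long as a power of x1 is left. So every power
    cancels, and \<open>P = l Q\<close> shows that \<open>Q\<close> is nonzero wherever some
    \<open>P\<close> is.\<close>
  have base: "\<exists>m. Q m x \<noteq> 0"
    if P: "\<And>m. P m \<in> polyfun coords" "P m0 x \<noteq> 0" and "linked N P Q" and x: "F x = 0" "x $ 1 = 0" for P m0 N x
    using that(3)
  proof (induction N)
    case 0
    then obtain l where "\<And>x m. F x = 0 \<Longrightarrow> (x $ 1) ^ 0 * P m x = l x * Q m x"
      unfolding linked_def by blast
    from this[OF x(1), of m0] show ?case using P(2) by auto
  next
    case (Suc N)
    then obtain l where l: "l \<in> polyfun coords"
      "\<And>x m. F x = 0 \<Longrightarrow> (x $ 1) ^ Suc N * P m x = l x * Q m x"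
      unfolding linked_def by metis
    have plane: "l x = 0" if i: "i \<in> {2, 3, 4}" and x: "x $ 1 = 0" "x $ i = 0" for i x
    proof -
      obtain y m1 where y: "y $ 1 = 0" "y $ i = 0" "Q m1 y \<noteq> 0" using T[OF i] unfolding T_def by blast
      show ?thesis
      proof (rule plane_irreducible[OF l(1) Q(1) _ y x])
        fix x assume x: "x $ 1 = 0" "x $ i = (0::'k)"
        then have "F x = 0" using i by (auto simp: F_at_infinity)
        from l(2)[OF this, of m1] show "l x * Q m1 x = 0" using x(1) by simp
      qed
    qed
    have "linked N (\<lambda>m x. 1 * P m x) Q"
    proof (rule linked_reduce[OF P(1) Q(1) l polyfun_const])
      show "1 * l x = 0" if "F x = 0" "x $ 1 = 0" for x
        using vanishing_at_infinity[OF plane that] by simp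
    qed
    then show ?case using Suc.IH by simp
  qed
  show ?thesis
  proof (rule that[OF Q(1,2)])
    fix x assume x: "F x = 0" "x \<noteq> 0"
    obtain d P m where P: "(d, P) \<in> \<P>" "P m x \<noteq> 0" using nz[OF x] by blast
    obtain N where N: "linked N P Q" using Q(4)[OF P(1)] by blast
    show "\<exists>m. Q m x \<noteq> 0"
    proof (cases "x $ 1 = 0")
      case True
      show ?thesis by (rule base[OF poly[OF P(1)] P(2) N x(1) True])
    qed (rule Q(3)[OF x(1)])
  next
    fix d P x i j assume P: "(d, P) \<in> \<P>" and x: "F x = 0"
    obtain N where N: "linked N P Q" using Q(4)[OF P] by blast
    show "P i x * Q j x = P j x * Q i x" by (rule linked_wedge[OF poly[OF P] Q(1) N x])
  qed
qed

end

section \<open>Evaluation of polynomials\<close>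

definition mval :: "('n::finite \<Rightarrow>\<^sub>0 nat) \<Rightarrow> 'a::comm_semiring_1 ^ 'n \<Rightarrow> 'a" where
  "mval m x = (\<Prod>i\<in>UNIV. (x $ i) ^ Poly_Mapping.lookup m i)"

lemma mval_add: "mval (m + n) x = mval m x * mval n x"
  by (simp add: mval_def lookup_add power_add prod.distrib)

lemma mval_0: "mval 0 x = 1"
  by (simp add: mval_def)

lemma mval_single: "mval (Poly_Mapping.single i 1) x = x $ i"
proof -
  have "mval (Poly_Mapping.single i 1) x = (\<Prod>j\<in>UNIV. if j = i then x $ j else 1)"
    unfolding mval_def by (rule prod.cong) (auto simp: lookup_single when_def)
  then show ?thesis by simp
qed

lemma mp_eval_superset:
  assumes "finite S" "Poly_Mapping.keys p \<subseteq> S"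
  shows "mp_eval p x = (\<Sum>m\<in>S. Poly_Mapping.lookup p m * mval m x)"
  unfolding mp_eval_def mval_def[symmetric] using assms
  by (intro sum.mono_neutral_left) (auto simp: in_keys_iff)

lemma mp_eval_alt: "mp_eval p x = (\<Sum>m\<in>Poly_Mapping.keys p. Poly_Mapping.lookup p m * mval m x)"
  by (simp add: mp_eval_def mval_def)

lemma mp_eval_0: "mp_eval 0 x = 0"
  by (simp add: mp_eval_def)

lemma mp_eval_add: "mp_eval (p + q) x = mp_eval p x + mp_eval q x"
proof -
  let ?S = "Poly_Mapping.keys p \<union> Poly_Mapping.keys q"
  have "Poly_Mapping.keys (p + q) \<subseteq> ?S" by (rule Poly_Mapping.keys_add)
  then show ?thesis
    by (simp add: mp_eval_superset[of ?S] lookup_add algebra_simps sum.distrib)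
qed

lemma mp_eval_diff:
  fixes p q :: "('n::finite, 'a::comm_ring_1) mpoly"
  shows "mp_eval (p - q) x = mp_eval p x - mp_eval q x"
  using mp_eval_add[of "p - q" q x] by simp

lemma mp_eval_sum: "mp_eval (\<Sum>i\<in>A. p i) x = (\<Sum>i\<in>A. mp_eval (p i) x)"
  by (induction A rule: infinite_finite_induct) (simp_all add: mp_eval_0 mp_eval_add)

lemma mp_eval_single: "mp_eval (Poly_Mapping.single m c) x = c * mval m x"
  by (simp add: mp_eval_superset[of "{m}"])

lemma mpoly_expand: "p = (\<Sum>m\<in>Poly_Mapping.keys p. Poly_Mapping.single m (Poly_Mapping.lookup p m))"
proof (rule poly_mapping_eqI)
  fix n
  have "(\<Sum>m\<in>Poly_Mapping.keys p. if m = n then Poly_Mapping.lookup p m else 0) = Poly_Mapping.lookup p n"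
    by (simp add: in_keys_iff)
  then show "Poly_Mapping.lookup p n =
      Poly_Mapping.lookup (\<Sum>m\<in>Poly_Mapping.keys p. Poly_Mapping.single m (Poly_Mapping.lookup p m)) n"
    by (simp add: lookup_sum lookup_single when_def)
qed

lemma mp_eval_mult:
  fixes p q :: "('n::finite, 'a::comm_semiring_1) mpoly"
  shows "mp_eval (p * q) x = mp_eval p x * mp_eval q x"
proof -
  have "mp_eval (p * q) x = mp_eval (\<Sum>m\<in>Poly_Mapping.keys p. \<Sum>n\<in>Poly_Mapping.keys q.
      Poly_Mapping.single (m + n) (Poly_Mapping.lookup p m * Poly_Mapping.lookup q n)) x"
    by (subst mpoly_expand[of p], subst mpoly_expand[of q]) (simp add: sum_product mult_single)
  also have "\<dots> = (\<Sum>m\<in>Poly_Mapping.keys p. \<Sum>n\<in>Poly_Mapping.keys q.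
      (Poly_Mapping.lookup p m * Poly_Mapping.lookup q n) * (mval m x * mval n x))"
    by (simp only: mp_eval_sum mp_eval_single mval_add)
  also have "\<dots> = mp_eval p x * mp_eval q x"
    by (simp add: sum_product mp_eval_alt mult_ac)
  finally show ?thesis .
qed

lemma mp_eval_var: "mp_eval (var i) x = x $ i"
  by (simp add: var_def mp_eval_single mval_single del: One_nat_def)

lemma mp_eval_cnst: "mp_eval (cnst c) x = c"
  by (simp add: cnst_def mp_eval_single mval_0)

lemma mp_eval_power:
  fixes p :: "('n::finite, 'a::comm_semiring_1) mpoly"
  shows "mp_eval (p ^ n) x = mp_eval p x ^ n"
proof (induction n)
  case 0
  have "(1 :: ('n, 'a) mpoly) = cnst 1" by (simp add: cnst_def)
  then show ?case using mp_eval_cnst[of "1 :: 'a" x] by simp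
qed (simp add: mp_eval_mult)

lemma mp_eval_cubic: "mp_eval (cubic a b1 b2 b3) x = cubic_fun a b1 b2 b3 x"
  by (simp add: cubic_def cubic_fun_def mp_eval_add mp_eval_diff mp_eval_mult mp_eval_power
      mp_eval_var mp_eval_cnst)

lemma homog_mp_eval:
  fixes p :: "('n::finite, 'a::comm_ring_1) mpoly"
  assumes "homogeneous d p"
  shows "homog d (mp_eval p)"
  unfolding homog_def
proof (intro allI)
  fix c and x :: "'a ^ 'n"
  have "mval m (c *s x) = c ^ d * mval m x" if "m \<in> Poly_Mapping.keys p" for m
    using assms that by (simp add: mval_def homogeneous_def power_mult_distrib prod.distrib flip: power_sum)
  then show "mp_eval p (c *s x) = c ^ d * mp_eval p x"
    by (simp add: mp_eval_superset[OF finite_keys order_refl] sum_distrib_left mult_ac)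
qed

text \<open>The formal partial derivative is the derivative of the restriction to a coordinate line,
  so it can be computed from any univariate expression for that restriction.\<close>

lemma mp_eval_deriv:
  fixes p :: "('n::finite, 'a::field_char_0) mpoly"
  assumes r: "\<And>c. mp_eval p (x + c *s axis i 1) = poly r c"
  shows "mp_eval (mp_deriv i p) x = poly (pderiv r) 0"
proof -
  define q where "q m = smult (\<Prod>j\<in>UNIV - {i}. (x $ j) ^ Poly_Mapping.lookup m j)
    ([:x $ i, 1:] ^ Poly_Mapping.lookup m i)" for m :: "'n \<Rightarrow>\<^sub>0 nat"
  have split: "prod f UNIV = f i * prod f (UNIV - {i})" for f :: "'n \<Rightarrow> 'a"
    by (rule prod.remove) auto
  have q: "mval m (x + c *s axis i 1) = poly (q m) c" for m c
  proof -
    have "(\<Prod>j\<in>UNIV - {i}. ((x + c *s axis i 1) $ j) ^ Poly_Mapping.lookup m j) =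
        (\<Prod>j\<in>UNIV - {i}. (x $ j) ^ Poly_Mapping.lookup m j)"
      by (rule prod.cong) (auto simp: axis_def)
    then show ?thesis by (simp add: mval_def q_def split poly_power axis_def mult.commute)
  qed
  have "poly r c = poly (\<Sum>m\<in>Poly_Mapping.keys p. smult (Poly_Mapping.lookup p m) (q m)) c" for c
    unfolding r[symmetric] by (simp add: mp_eval_superset[OF finite_keys order_refl] q poly_sum)
  then have "r = (\<Sum>m\<in>Poly_Mapping.keys p. smult (Poly_Mapping.lookup p m) (q m))"
    by (simp add: poly_eq_poly_eq_iff[symmetric] fun_eq_iff)
  then have "poly (pderiv r) 0 = (\<Sum>m\<in>Poly_Mapping.keys p. Poly_Mapping.lookup p m * poly (pderiv (q m)) 0)"
    by (simp add: pderiv_sum pderiv_smult poly_sum)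
  also have "\<dots> = (\<Sum>m\<in>Poly_Mapping.keys p. (of_nat (Poly_Mapping.lookup m i) * Poly_Mapping.lookup p m) *
      mval (m - Poly_Mapping.single i 1) x)"
  proof (rule sum.cong[OF refl])
    fix m
    have "(\<Prod>j\<in>UNIV - {i}. (x $ j) ^ Poly_Mapping.lookup (m - Poly_Mapping.single i 1) j) =
        (\<Prod>j\<in>UNIV - {i}. (x $ j) ^ Poly_Mapping.lookup m j)"
      by (rule prod.cong) (auto simp: lookup_minus lookup_single when_def)
    then have mval: "mval (m - Poly_Mapping.single i 1) x = (x $ i) ^ (Poly_Mapping.lookup m i - 1) *
        (\<Prod>j\<in>UNIV - {i}. (x $ j) ^ Poly_Mapping.lookup m j)"
      by (simp add: mval_def split lookup_minus)
    have "poly (pderiv ([:x $ i, 1:] ^ n)) 0 = of_nat n * (x $ i) ^ (n - 1)" for n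
      by (cases n) (simp_all add: pderiv_power_Suc pderiv_pCons poly_power del: power_Suc)
    then have "poly (pderiv (q m)) 0 = of_nat (Poly_Mapping.lookup m i) * mval (m - Poly_Mapping.single i 1) x"
      unfolding mval by (simp add: q_def pderiv_smult mult_ac)
    then show "Poly_Mapping.lookup p m * poly (pderiv (q m)) 0 =
      (of_nat (Poly_Mapping.lookup m i) * Poly_Mapping.lookup p m) * mval (m - Poly_Mapping.single i 1) x"
      by (simp add: mult_ac)
  qed
  also have "\<dots> = mp_eval (mp_deriv i p) x"
    by (simp add: mp_deriv_def mp_eval_sum mp_eval_single)
  finally show ?thesis by simp
qed

section \<open>Lines and singular points\<close>

lemma span_single: "vec.span {x} = range (\<lambda>c. c *s (x :: 'a::field ^ 'n))"
  by (rule vec.span_singleton)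

lemma span_scale_eq:
  fixes x :: "'a::field ^ 'n"
  assumes "c \<noteq> 0"
  shows "vec.span {c *s x} = vec.span {x}"
proof -
  have "d *s x = (d * inverse c) *s (c *s x)" for d
    using assms by (simp add: vector_smult_assoc mult.assoc)
  then have "d *s x \<in> range (\<lambda>d. d *s (c *s x))" for d by (rule range_eqI)
  moreover have "d *s (c *s x) \<in> range (\<lambda>d. d *s x)" for d
    unfolding vector_smult_assoc by (rule rangeI)
  ultimately show ?thesis unfolding span_single by (intro subset_antisym image_subsetI)
qed

lemma proj_space_iff:
  fixes L :: "('a::field ^ 'n::finite) set"
  shows "L \<in> proj_space \<longleftrightarrow> (\<exists>x. x \<noteq> 0 \<and> L = vec.span {x})"
proof
  assume L: "L \<in> proj_space"
  obtain B where B: "B \<subseteq> L" "vec.independent B" "L \<subseteq> vec.span B" "card B = vec.dim L"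
    using vec.basis_exists by blast
  then have "card B = 1" using L by (simp add: proj_space_def)
  then obtain x where x: "B = {x}" by (auto simp: card_1_singleton_iff)
  have "x \<noteq> 0" using B(2) x vec.dependent_zero by blast
  moreover have "L = vec.span {x}"
    using B(1,3) L x vec.span_minimal[of B L] by (auto simp: proj_space_def)
  ultimately show "\<exists>x. x \<noteq> 0 \<and> L = vec.span {x}" by blast
next
  assume "\<exists>x. x \<noteq> 0 \<and> L = vec.span {x}"
  then obtain x where x: "x \<noteq> 0" "L = vec.span {x}" by blast
  have "vec.independent {x}" using x(1) by (simp add: vec.independent_insert vec.independent_empty vec.span_empty)
  then have "vec.dim {x} = 1" by (simp add: vec.dim_eq_card_independent)
  then show "L \<in> proj_space" by (simp add: proj_space_def x(2) vec.dim_span vec.subspace_span)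
qed

lemma hypersurface_cubic_iff:
  "L \<in> hypersurface (cubic a b1 b2 b3) \<longleftrightarrow> (\<exists>x. x \<noteq> 0 \<and> cubic_fun a b1 b2 b3 x = 0 \<and> L = vec.span {x})"
proof -
  have F: "cubic_fun a b1 b2 b3 (c *s x) = c ^ 3 * cubic_fun a b1 b2 b3 x" for c x
    by (simp add: cubic_fun_def power2_eq_square power3_eq_cube algebra_simps)
  have "x \<in> vec.span {x}" for x :: "'a ^ 5" by (rule vec.span_base) simp
  then show ?thesis
    unfolding hypersurface_def proj_space_iff mp_eval_cubic
    by (auto simp: span_single F)
qed

definition cubic_grad :: "'a::comm_ring_1 \<Rightarrow> 'a \<Rightarrow> 'a \<Rightarrow> 'a \<Rightarrow> 'a ^ 5 \<Rightarrow> 5 \<Rightarrow> 'a" where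
  "cubic_grad a b1 b2 b3 x i =
    (if i = 1 then 3 * a * (x $ 1)\<^sup>2 + 2 * x $ 1 * (b1 * x $ 2 + b2 * x $ 3 + b3 * x $ 4) +
       ((x $ 2)\<^sup>2 + (x $ 3)\<^sup>2 + (x $ 4)\<^sup>2 - (x $ 5)\<^sup>2)
     else if i = 2 then x $ 3 * x $ 4 + b1 * (x $ 1)\<^sup>2 + 2 * x $ 1 * x $ 2
     else if i = 3 then x $ 2 * x $ 4 + b2 * (x $ 1)\<^sup>2 + 2 * x $ 1 * x $ 3
     else if i = 4 then x $ 2 * x $ 3 + b3 * (x $ 1)\<^sup>2 + 2 * x $ 1 * x $ 4
     else - 2 * x $ 1 * x $ 5)"

lemma mp_eval_deriv_cubic:
  fixes a :: "'a::field_char_0"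
  shows "mp_eval (mp_deriv i (cubic a b1 b2 b3)) x = cubic_grad a b1 b2 b3 x i"
proof -
  define e where "e j = (if j = i then 1 else 0 :: 'a)" for j
  define l where "l j = [:x $ j, e j:]" for j
  define r where "r = l 2 * l 3 * l 4 + [:a:] * l 1 ^ 3 +
    (l 1)\<^sup>2 * ([:b1:] * l 2 + [:b2:] * l 3 + [:b3:] * l 4) + l 1 * ((l 2)\<^sup>2 + (l 3)\<^sup>2 + (l 4)\<^sup>2 - (l 5)\<^sup>2)"
  have "(x + c *s axis i 1) $ j = poly (l j) c" for c j
    by (simp add: l_def e_def axis_def)
  then have "mp_eval (cubic a b1 b2 b3) (x + c *s axis i 1) = poly r c" for c
    unfolding mp_eval_cubic cubic_fun_def r_def by (simp add: poly_power)
  then have "mp_eval (mp_deriv i (cubic a b1 b2 b3)) x = poly (pderiv r) 0"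
    by (rule mp_eval_deriv)
  also have "\<dots> = x $ 3 * x $ 4 * e 2 + x $ 2 * x $ 4 * e 3 + x $ 2 * x $ 3 * e 4 + 3 * a * (x $ 1)\<^sup>2 * e 1
      + 2 * x $ 1 * e 1 * (b1 * x $ 2 + b2 * x $ 3 + b3 * x $ 4) + (x $ 1)\<^sup>2 * (b1 * e 2 + b2 * e 3 + b3 * e 4)
      + e 1 * ((x $ 2)\<^sup>2 + (x $ 3)\<^sup>2 + (x $ 4)\<^sup>2 - (x $ 5)\<^sup>2)
      + x $ 1 * (2 * x $ 2 * e 2 + 2 * x $ 3 * e 3 + 2 * x $ 4 * e 4 - 2 * x $ 5 * e 5)"
    by (simp add: r_def l_def pderiv_mult pderiv_add pderiv_diff pderiv_pCons power2_eq_square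
        power3_eq_cube algebra_simps)
  also have "\<dots> = cubic_grad a b1 b2 b3 x i"
    using exhaust_5[of i] by (auto simp: cubic_grad_def e_def algebra_simps)
  finally show ?thesis .
qed

lemma sing_locus_cubicI:
  fixes a :: "'a::field_char_0"
  assumes "x \<noteq> 0" "cubic_fun a b1 b2 b3 x = 0" "\<And>i. cubic_grad a b1 b2 b3 x i = 0"
  shows "vec.span {x} \<in> sing_locus (cubic a b1 b2 b3)"
proof -
  have "cubic_grad a b1 b2 b3 (c *s x) i = c\<^sup>2 * cubic_grad a b1 b2 b3 x i" for c i
    by (simp add: cubic_grad_def power2_eq_square algebra_simps)
  then have "\<forall>y\<in>vec.span {x} - {0}. \<forall>i. mp_eval (mp_deriv i (cubic a b1 b2 b3)) y = 0"
    unfolding mp_eval_deriv_cubic span_single using assms(3) by auto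
  then show ?thesis unfolding sing_locus_def using assms by (auto simp: hypersurface_cubic_iff)
qed

lemma span_eq_imp_scaled:
  fixes x y :: "'a::field ^ 'n"
  assumes "vec.span {x} = vec.span {y}"
  obtains c where "x = c *s y"
proof -
  have "x \<in> vec.span {x}" by (rule vec.span_base) simp
  then show ?thesis using that unfolding assms unfolding span_single by blast
qed

section \<open>The six nodes at infinity\<close>

definition node :: "5 \<times> 'a \<Rightarrow> 'a::comm_ring_1 ^ 5" where
  "node = (\<lambda>(k, s). \<chi> l. if l = k then s else if l = 5 then 1 else 0)"

lemma node_singular:
  fixes a :: "'a::field_char_0"
  assumes "k \<in> {2, 3, 4}" "s \<in> {1, -1}"
  shows "vec.span {node (k, s)} \<in> sing_locus (cubic a b1 b2 b3)"
proof (rule sing_locus_cubicI)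
  have k: "k = 2 \<or> k = 3 \<or> k = 4" and s: "s\<^sup>2 = 1" using assms by auto
  have "node (k, s) $ 5 = 1" using k by (auto simp: node_def)
  then show "node (k, s) \<noteq> 0" by auto
  show "cubic_fun a b1 b2 b3 (node (k, s)) = 0"
    using k by (elim disjE) (simp_all add: node_def cubic_fun_def)
  show "cubic_grad a b1 b2 b3 (node (k, s)) i = 0" for i
    using k s by (elim disjE) (simp_all add: node_def cubic_grad_def)
qed

lemma affine_singular:
  fixes a :: "'a::field_char_0"
  assumes "x * y * z + x\<^sup>2 + y\<^sup>2 + z\<^sup>2 + b1 * x + b2 * y + b3 * z + a = 0"
    and "y * z + 2 * x + b1 = 0" "x * z + 2 * y + b2 = 0" "x * y + 2 * z + b3 = 0"
  shows "vec.span {pt 2 3 4 1 x y z 0} \<in> sing_locus (cubic a b1 b2 b3)"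
proof (rule sing_locus_cubicI)
  have T: "(2, 3, 4) \<in> triples" by (simp add: triples_def)
  note nth = pt_nth[OF T]
  show "pt 2 3 4 1 x y z 0 \<noteq> (0 :: 'a ^ 5)" using nth(1)[of 1 x y z "0 :: 'a"] by auto
  show "cubic_fun a b1 b2 b3 (pt 2 3 4 1 x y z 0) = 0"
    using assms(1) by (simp add: cubic_fun_def nth algebra_simps)
  \<comment> \<open>Euler's relation at x1 = 1: the derivative in x1 is three times the cubic minus
    the other derivatives weighted by their coordinates.\<close>
  have "3 * a + 2 * (b1 * x + b2 * y + b3 * z) + (x\<^sup>2 + y\<^sup>2 + z\<^sup>2) =
      3 * (x * y * z + x\<^sup>2 + y\<^sup>2 + z\<^sup>2 + b1 * x + b2 * y + b3 * z + a)
      - x * (y * z + 2 * x + b1) - y * (x * z + 2 * y + b2) - z * (x * y + 2 * z + b3)"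
    by (simp add: power2_eq_square algebra_simps)
  then have e: "3 * a + 2 * (b1 * x + b2 * y + b3 * z) + (x\<^sup>2 + y\<^sup>2 + z\<^sup>2) = 0"
    unfolding assms by simp
  show "cubic_grad a b1 b2 b3 (pt 2 3 4 1 x y z 0) i = 0" for i
    using exhaust_5[of i] e assms(2-4)
    by (elim disjE) (simp_all add: cubic_grad_def nth algebra_simps)
qed

text \<open>The six points \<open>s e_k + e_5\<close> with \<open>s\<close> a sign are singular for
  all coefficients and have x1 = 0, so a singular point with x1 nonzero would be a seventh.\<close>

lemma six_singular_points_imp_nonsingular:
  fixes a :: "'a::field_char_0"
  assumes card6: "card (sing_locus (cubic a b1 b2 b3)) = 6"
  shows "nonsingular a b1 b2 b3"
  unfolding nonsingular_def
proof (intro notI, elim exE conjE)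
  fix x y z
  assume *: "x * y * z + x\<^sup>2 + y\<^sup>2 + z\<^sup>2 + b1 * x + b2 * y + b3 * z + a = 0"
    "y * z + 2 * x + b1 = 0" "x * z + 2 * y + b2 = 0" "x * y + 2 * z + b3 = 0"
  define X where "X = (pt 2 3 4 1 x y z 0 :: 'a ^ 5)"
  define I where "I = {2, 3, 4 :: 5} \<times> {1, -1 :: 'a}"
  have X1: "X $ 1 = 1" unfolding X_def by (rule pt_nth) (simp add: triples_def)
  have n1: "node p $ 1 = 0" if "p \<in> I" for p :: "5 \<times> 'a" using that by (auto simp: I_def node_def)
  have n5: "node p $ 5 = 1" if "p \<in> I" for p :: "5 \<times> 'a" using that by (auto simp: I_def node_def)
  have "inj_on (\<lambda>p. vec.span {node p}) I"
  proof (rule inj_onI)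
    fix p q assume p: "p \<in> I" and q: "q \<in> I" and eq: "vec.span {node p} = vec.span {node q}"
    obtain c where c: "node p = c *s node q" using eq by (rule span_eq_imp_scaled)
    have "c = 1" using arg_cong[OF c, of "\<lambda>v. v $ 5"] n5[OF p] n5[OF q] by simp
    then have "node p = node q" using c by simp
    then have "node p $ fst p = node q $ fst p" "node p $ fst q = node q $ fst q" by simp_all
    then show "p = q" using p q unfolding I_def node_def
      by (cases p; cases q) (auto split: if_splits)
  qed
  then have card: "card ((\<lambda>p. vec.span {node p}) ` I) = 6"
    by (simp add: card_image) (simp add: I_def card_cartesian_product)
  have notin: "vec.span {X} \<notin> (\<lambda>p. vec.span {node p}) ` I"
  proof
    assume "vec.span {X} \<in> (\<lambda>p. vec.span {node p}) ` I"
    then obtain p where p: "p \<in> I" "vec.span {X} = vec.span {node p}" by blast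
    obtain c where "X = c *s node p" using p(2) by (rule span_eq_imp_scaled)
    from arg_cong[OF this, of "\<lambda>v. v $ 1"] show False using X1 n1[OF p(1)] by simp
  qed
  have fin: "finite I" by (simp add: I_def)
  have "insert (vec.span {X}) ((\<lambda>p. vec.span {node p}) ` I) \<subseteq> sing_locus (cubic a b1 b2 b3)"
  proof (intro insert_subsetI image_subsetI)
    show "vec.span {X} \<in> sing_locus (cubic a b1 b2 b3)"
      using affine_singular[OF *] by (simp only: X_def)
    show "vec.span {node p} \<in> sing_locus (cubic a b1 b2 b3)" if "p \<in> I" for p
      using that node_singular[of "fst p" "snd p"] by (auto simp only: I_def mem_Times_iff prod.collapse)
  qed
  moreover have "finite (sing_locus (cubic a b1 b2 b3))" using card6 by (intro card_ge_0_finite) simp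
  ultimately have "card (insert (vec.span {X}) ((\<lambda>p. vec.span {node p}) ` I)) \<le> 6"
    unfolding card6[symmetric] by (intro card_mono)
  then show False using notin card fin by simp
qed

section \<open>Automorphisms are linear\<close>

text \<open>A first-order expansion along rays whose linear term is one linear form for all rays;
  for a homogeneous function of degree 1 only this term remains.\<close>

lemma polyfun_linear_part:
  fixes f :: "'a::comm_ring_1 ^ 'n::finite \<Rightarrow> 'a"
  assumes "f \<in> polyfun coords"
  shows "\<exists>k l. \<forall>x. \<exists>r. \<forall>c. f (c *s x) = k + c * (\<Sum>i\<in>UNIV. l i * x $ i) + c\<^sup>2 * poly r c"
  using assms
proof induction
  case (polyfun_const c)
  show ?case by (intro exI[of _ c] exI[of _ "\<lambda>_. 0"] allI exI[of _ 0]) simp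
next
  case (polyfun_gen g)
  then obtain j where j: "g = (\<lambda>x. x $ j)" by (auto simp: coords_def)
  have "(\<Sum>i\<in>UNIV. (if i = j then 1 else 0) * x $ i) = x $ j" for x :: "'a ^ 'n"
    by (simp add: if_distrib[of "\<lambda>c. c * _"] cong: if_cong)
  then show ?case
    by (intro exI[of _ 0] exI[of _ "\<lambda>i. if i = j then 1 else 0"] allI exI[of _ 0]) (simp add: j)
next
  case (polyfun_add f g)
  then obtain k l k' l' where
    f: "\<forall>x. \<exists>r. \<forall>c. f (c *s x) = k + c * (\<Sum>i\<in>UNIV. l i * x $ i) + c\<^sup>2 * poly r c" and
    g: "\<forall>x. \<exists>r. \<forall>c. g (c *s x) = k' + c * (\<Sum>i\<in>UNIV. l' i * x $ i) + c\<^sup>2 * poly r c" by blast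
  show ?case
  proof (intro exI[of _ "k + k'"] exI[of _ "\<lambda>i. l i + l' i"] allI)
    fix x
    obtain r where r: "\<forall>c. f (c *s x) = k + c * (\<Sum>i\<in>UNIV. l i * x $ i) + c\<^sup>2 * poly r c" using f by blast
    obtain s where s: "\<forall>c. g (c *s x) = k' + c * (\<Sum>i\<in>UNIV. l' i * x $ i) + c\<^sup>2 * poly s c" using g by blast
    show "\<exists>r. \<forall>c. f (c *s x) + g (c *s x) = k + k' + c * (\<Sum>i\<in>UNIV. (l i + l' i) * x $ i) + c\<^sup>2 * poly r c"
      by (rule exI[of _ "r + s"]) (simp add: r s algebra_simps sum.distrib)
  qed
next
  case (polyfun_mult f g)
  then obtain k l k' l' where
    f: "\<forall>x. \<exists>r. \<forall>c. f (c *s x) = k + c * (\<Sum>i\<in>UNIV. l i * x $ i) + c\<^sup>2 * poly r c" and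
    g: "\<forall>x. \<exists>r. \<forall>c. g (c *s x) = k' + c * (\<Sum>i\<in>UNIV. l' i * x $ i) + c\<^sup>2 * poly r c" by blast
  show ?case
  proof (intro exI[of _ "k * k'"] exI[of _ "\<lambda>i. k * l' i + k' * l i"] allI)
    fix x
    define L where "L = (\<Sum>i\<in>UNIV. l i * x $ i)"
    define L' where "L' = (\<Sum>i\<in>UNIV. l' i * x $ i)"
    obtain r where r: "\<forall>c. f (c *s x) = k + c * L + c\<^sup>2 * poly r c" using f unfolding L_def by blast
    obtain s where s: "\<forall>c. g (c *s x) = k' + c * L' + c\<^sup>2 * poly s c" using g unfolding L'_def by blast
    have lin: "(\<Sum>i\<in>UNIV. (k * l' i + k' * l i) * x $ i) = k * L' + k' * L"
      by (simp add: L_def L'_def sum.distrib sum_distrib_left algebra_simps)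
    show "\<exists>r. \<forall>c. f (c *s x) * g (c *s x) = k * k' + c * (\<Sum>i\<in>UNIV. (k * l' i + k' * l i) * x $ i) + c\<^sup>2 * poly r c"
      unfolding lin
      by (rule exI[of _ "[:k:] * s + [:k':] * r + [:L * L':] + [:0, L:] * s + [:0, L':] * r + [:0, 0, 1:] * r * s"])
        (simp add: r s power2_eq_square algebra_simps)
  qed
qed

lemma homog_1_linear:
  fixes f :: "'a::field_char_0 ^ 'n::finite \<Rightarrow> 'a"
  assumes "f \<in> polyfun coords" "homog 1 f"
  obtains l where "\<And>x. f x = (\<Sum>i\<in>UNIV. l i * x $ i)"
proof -
  obtain k l where kl: "\<And>x. \<exists>r. \<forall>c. f (c *s x) = k + c * (\<Sum>i\<in>UNIV. l i * x $ i) + c\<^sup>2 * poly r c"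
    using polyfun_linear_part[OF assms(1)] by blast
  have "f x = (\<Sum>i\<in>UNIV. l i * x $ i)" for x
  proof -
    obtain r where r: "\<And>c. f (c *s x) = k + c * (\<Sum>i\<in>UNIV. l i * x $ i) + c\<^sup>2 * poly r c"
      using kl by blast
    define p where "p = [:k, (\<Sum>i\<in>UNIV. l i * x $ i) - f x:] + [:0, 0, 1:] * r"
    have "poly p c = 0" for c
      using r[of c] homogD[OF assms(2), of c x] by (simp add: p_def power2_eq_square algebra_simps)
    then have "\<forall>c. poly p c = 0" by (rule allI)
    then have "p = 0" by (simp only: poly_all_0_iff_0)
    then have "coeff p 1 = 0" by simp
    then show ?thesis by (simp add: p_def)
  qed
  then show ?thesis by (rule that)
qed

lemma poly_without_root_constant:
  fixes p :: "'a::alg_closed_field poly"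
  assumes "\<And>x. poly p x \<noteq> 0"
  obtains c where "\<And>x. poly p x = c" "c \<noteq> 0"
proof -
  have "degree p = 0" using alg_closed_imp_poly_has_root assms by blast
  then obtain c where "p = [:c:]" by (rule degree_eq_zeroE)
  then show ?thesis using that[of c] assms[of 0] by simp
qed

context cubic_cone
begin

abbreviation X where "X \<equiv> hypersurface (cubic a b1 b2 b3)"

lemma in_X_iff: "L \<in> X \<longleftrightarrow> (\<exists>x. x \<noteq> 0 \<and> F x = 0 \<and> L = vec.span {x})"
  by (rule hypersurface_cubic_iff)

lemma span_in_X: "x \<noteq> 0 \<Longrightarrow> F x = 0 \<Longrightarrow> vec.span {x} \<in> X"
  by (auto simp: in_X_iff)

lemma span_in_X_imp:
  assumes "vec.span {x} \<in> X" "x \<noteq> 0"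
  shows "F x = 0"
proof -
  obtain y where y: "F y = 0" "vec.span {x} = vec.span {y}" using assms(1) by (auto simp: in_X_iff)
  obtain c where "x = c *s y" using y(2) by (rule span_eq_imp_scaled)
  then show ?thesis using F_scale_0[OF y(1)] by simp
qed

lemma span_mem: "x \<in> vec.span {x :: 'k ^ 5}"
  by (rule vec.span_base) simp

text \<open>The family consists of all homogeneous vectors that represent \<open>f\<close> where
  they are nonzero. Two of them are proportional at every point: either both span the same line or
  one of them is zero.\<close>

lemma regular_map_global:
  assumes reg: "regular_map (cubic a b1 b2 b3) f"
  obtains D Q where "\<And>m. Q m \<in> polyfun coords" "\<And>m. homog D (Q m)"
    "\<And>x. F x = 0 \<Longrightarrow> x \<noteq> 0 \<Longrightarrow> (\<chi> m. Q m x) \<noteq> 0"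
    "\<And>x. F x = 0 \<Longrightarrow> x \<noteq> 0 \<Longrightarrow> f (vec.span {x}) = vec.span {\<chi> m. Q m x}"
proof -
  define rep where "rep d P \<longleftrightarrow> (\<forall>m. P m \<in> polyfun coords) \<and> (\<forall>m. homog d (P m)) \<and>
      (\<forall>y. F y = 0 \<longrightarrow> y \<noteq> 0 \<longrightarrow> (\<chi> m. P m y) \<noteq> 0 \<longrightarrow> f (vec.span {y}) = vec.span {\<chi> m. P m y})"
    for d and P :: "5 \<Rightarrow> 'k ^ 5 \<Rightarrow> 'k"
  define \<P> where "\<P> = {(d, P). rep d P}"
  have wedge: "P i x * Q j x = P j x * Q i x" if "rep d P" "rep e Q" "F x = 0" "x \<noteq> 0" for d P e Q x i j
  proof (cases "(\<chi> m. P m x) = 0 \<or> (\<chi> m. Q m x) = 0")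
    case True
    then have "(\<forall>m. P m x = 0) \<or> (\<forall>m. Q m x = 0)" by (simp add: Finite_Cartesian_Product.vec_eq_iff)
    then show ?thesis by auto
  next
    case False
    then have "vec.span {\<chi> m. P m x} = vec.span {\<chi> m. Q m x}"
      using that unfolding rep_def by metis
    then obtain c where c: "(\<chi> m. P m x) = c *s (\<chi> m. Q m x)" by (rule span_eq_imp_scaled)
    have "P m x = c * Q m x" for m using arg_cong[OF c, of "\<lambda>v. v $ m"] by simp
    then show ?thesis by simp
  qed
  have nz: "\<exists>d P. rep d P \<and> (\<chi> m. P m x) \<noteq> 0" if x: "F x = 0" "x \<noteq> 0" for x
  proof -
    obtain d P where P: "\<forall>i. homogeneous d (P i)"
      "\<forall>y\<in>vec.span {x} - {0}. (\<chi> i. mp_eval (P i) y) \<noteq> 0"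
      "\<forall>M\<in>X. \<forall>y\<in>M - {0}. (\<chi> i. mp_eval (P i) y) \<noteq> 0 \<longrightarrow> f M = vec.span {\<chi> i. mp_eval (P i) y}"
      using reg span_in_X[OF x(2,1)] unfolding regular_map_def by metis
    have "rep d (\<lambda>i. mp_eval (P i))"
      unfolding rep_def
    proof (intro conjI allI impI)
      show "mp_eval (P m) \<in> polyfun coords" for m by (rule polyfun_mp_eval)
      show "homog d (mp_eval (P m))" for m using P(1) by (intro homog_mp_eval) (rule spec)
      fix y assume y: "F y = 0" "y \<noteq> 0" "(\<chi> m. mp_eval (P m) y) \<noteq> 0"
      have "y \<in> vec.span {y} - {0}" using y(2) span_mem by simp
      then show "f (vec.span {y}) = vec.span {\<chi> m. mp_eval (P m) y}"
        using P(3) span_in_X[OF y(2,1)] y(3) by simp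
    qed
    moreover have "(\<chi> i. mp_eval (P i) x) \<noteq> 0" using P(2) x(2) span_mem[of x] by simp
    ultimately show ?thesis by (intro exI conjI)
  qed
  obtain z where "F z = 0" "z $ 1 \<noteq> 0" using exists_affine_point by blast
  then have z: "F z = 0" "z \<noteq> 0" by auto
  obtain D Q where Q: "\<And>m. Q m \<in> polyfun coords" "\<And>m. homog D (Q m)"
    "\<And>x. F x = 0 \<Longrightarrow> x \<noteq> 0 \<Longrightarrow> \<exists>m. Q m x \<noteq> 0"
    "\<And>d P x i j. (d, P) \<in> \<P> \<Longrightarrow> F x = 0 \<Longrightarrow> P i x * Q j x = P j x * Q i x"
  proof (rule global_representation[of \<P>])
    show "P m \<in> polyfun coords" "homog d (P m)" if "(d, P) \<in> \<P>" for d P m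
      using that by (simp_all add: \<P>_def rep_def)
    show "P i x * Q j x = P j x * Q i x" if "(d, P) \<in> \<P>" "(e, Q) \<in> \<P>" "F x = 0" for d P e Q x i j
    proof (cases "x = 0")
      case False
      then show ?thesis using wedge that by (simp add: \<P>_def)
    next
      case True
      \<comment> \<open>The origin is not a point of the hypersurface; homogeneity carries the
        relation over from the point \<open>z\<close>.\<close>
      have "P m 0 = 0 ^ d * P m z" "Q m 0 = 0 ^ e * Q m z" for m
        using that(1,2) homogD[of d "P m" 0 z] homogD[of e "Q m" 0 z] by (simp_all add: \<P>_def rep_def)
      then show ?thesis using wedge[of d P e Q z i j] that z unfolding True by (simp add: \<P>_def)
    qed
    show "\<exists>d P m. (d, P) \<in> \<P> \<and> P m x \<noteq> 0" if x: "F x = 0" "x \<noteq> 0" for x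
    proof -
      obtain d P where "rep d P" "(\<chi> m. P m x) \<noteq> 0" using nz[OF x] by blast
      then show ?thesis unfolding \<P>_def by (auto simp: Finite_Cartesian_Product.vec_eq_iff)
    qed
  qed blast
  show ?thesis
  proof (rule that[OF Q(1,2)])
    fix x assume x: "F x = 0" "x \<noteq> 0"
    obtain m where m: "Q m x \<noteq> 0" using Q(3)[OF x] by blast
    then show nzQ: "(\<chi> m. Q m x) \<noteq> 0" by (auto simp: Finite_Cartesian_Product.vec_eq_iff)
    obtain d P where P: "rep d P" "(\<chi> m. P m x) \<noteq> 0" using nz[OF x] by blast
    have P': "P i x = (P m x / Q m x) * Q i x" for i
    proof -
      have "P i x * Q m x = P m x * Q i x"
        using Q(4)[of d P x i m] P(1) x(1) by (simp only: \<P>_def mem_Collect_eq case_prod_conv)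
      then have "P i x = P m x * Q i x / Q m x" using m by (simp only: eq_divide_eq) simp
      then show ?thesis by simp
    qed
    have c: "(\<chi> i. P i x) = (P m x / Q m x) *s (\<chi> i. Q i x)"
      unfolding Finite_Cartesian_Product.vec_eq_iff vector_smult_component vec_lambda_beta
      by (rule allI) (rule P')
    have "P m x / Q m x \<noteq> 0"
    proof
      assume "P m x / Q m x = 0"
      then have "(\<chi> i. P i x) = 0" unfolding c by (simp only: vector_smult_lzero)
      with P(2) show False by contradiction
    qed
    then have "vec.span {\<chi> i. P i x} = vec.span {\<chi> i. Q i x}" unfolding c by (rule span_scale_eq)
    moreover have "f (vec.span {x}) = vec.span {\<chi> m. P m x}" using P x unfolding rep_def by blast
    ultimately show "f (vec.span {x}) = vec.span {\<chi> m. Q m x}" by simp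
  qed
qed

text \<open>On the line x1 = x2 = x5 = 0 of the threefold the composite multiplies each vector by a
  nonzero scalar. In either affine coordinate this scalar is a polynomial without zeros, hence
  constant, which leaves homogeneity of degree 1 only.\<close>

lemma inverse_degrees:
  assumes Q: "\<And>m. Q m \<in> polyfun coords" "\<And>m. homog D (Q m)"
    and R: "\<And>m. R m \<in> polyfun coords" "\<And>m. homog E (R m)"
    and inv: "\<And>x. F x = 0 \<Longrightarrow> x \<noteq> 0 \<Longrightarrow> \<exists>c. c \<noteq> 0 \<and> (\<chi> m. R m (\<chi> n. Q n x)) = c *s x"
  shows "D * E = 1"
proof -
  define G where "G m y z = R m (\<chi> n. Q n (pt 2 3 4 0 0 y z 0))" for m y z
  note nth = pt_nth[OF triple_234]
  have id: "(\<lambda>t. t) \<in> polyfun {\<lambda>t::'k. t}" by (rule polyfun_gen) simp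
  have Gp: "(\<lambda>t. G m (f t) (g t)) \<in> polyfun {\<lambda>t. t}" if "f \<in> polyfun {\<lambda>t. t}" "g \<in> polyfun {\<lambda>t. t}" for m f g
    unfolding G_def
  proof (rule polyfun_coords_comp[OF R(1)])
    fix i
    show "(\<lambda>t. (\<chi> n. Q n (pt 2 3 4 0 0 (f t) (g t) 0)) $ i) \<in> polyfun {\<lambda>t. t}"
      by simp (intro polyfun_comp_pt[OF Q(1)] polyfun_const that)
  qed
  have ray: "\<exists>c. c \<noteq> 0 \<and> G 3 y z = c * y \<and> G 4 y z = c * z" if "y \<noteq> 0 \<or> z \<noteq> 0" for y z
  proof -
    have "pt 2 3 4 0 0 y z 0 \<noteq> (0 :: 'k ^ 5)"
      using that nth(3)[of 0 0 y z "0 :: 'k"] nth(4)[of 0 0 y z "0 :: 'k"] by auto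
    moreover have "F (pt 2 3 4 0 0 y z 0) = 0" by (simp add: F_pt[OF triple_234])
    ultimately obtain c where c: "c \<noteq> 0"
      "(\<chi> m. R m (\<chi> n. Q n (pt 2 3 4 0 0 y z 0))) = c *s pt 2 3 4 0 0 y z 0" using inv by blast
    have "G m y z = c * pt 2 3 4 0 0 y z 0 $ m" for m
      using arg_cong[OF c(2), of "\<lambda>v. v $ m"] by (simp add: G_def)
    then show ?thesis using c(1) by (intro exI[of _ c]) (simp add: nth)
  qed
  have hom: "G m (c * y) (c * z) = c ^ (D * E) * G m y z" for m c y z
  proof -
    have "pt 2 3 4 0 0 (c * y) (c * z) 0 = c *s pt 2 3 4 0 0 y z 0"
      by (rule sym, rule pt_eqI[OF triple_234]) (simp_all add: nth)
    moreover have "(\<chi> n. Q n (c *s x)) = c ^ D *s (\<chi> n. Q n x)" for x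
      by (simp add: Finite_Cartesian_Product.vec_eq_iff homogD[OF Q(2)])
    ultimately show ?thesis by (simp add: G_def homogD[OF R(2)] power_mult)
  qed
  obtain p where p: "\<And>t. G 4 t 1 = poly p t"
    by (rule polyfun_univariate[OF Gp[OF id polyfun_const]]) (rule that)
  have "poly p t \<noteq> 0" for t using ray[of t 1] by (auto simp flip: p)
  then obtain u where u: "\<And>t. poly p t = u" "u \<noteq> 0" by (rule poly_without_root_constant) (rule that)
  obtain q where q: "\<And>t. G 3 1 t = poly q t"
    by (rule polyfun_univariate[OF Gp[OF polyfun_const id]]) (rule that)
  have "poly q t \<noteq> 0" for t using ray[of 1 t] by (auto simp flip: q)
  then obtain v where v: "\<And>t. poly q t = v" "v \<noteq> 0" by (rule poly_without_root_constant) (rule that)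
  have G4: "G 4 1 t = t * v" for t using ray[of 1 t] v(1)[of t] by (auto simp flip: q)
  \<comment> \<open>The constants \<open>u\<close> and \<open>v\<close> of the two affine
    coordinates are compared by scaling the vector \<open>(1, 1/y)\<close> by \<open>y\<close>. The
    value \<open>y = 1\<close> gives \<open>u = v\<close>, and \<open>y = 2\<close> determines the
    exponent in characteristic 0.\<close>
  have key: "u = y ^ (D * E) * (inverse y * v)" if "y \<noteq> 0" for y
    using hom[of 4 y 1 "inverse y"] that unfolding G4 using u(1)[of y] by (simp flip: p)
  have "u = v" using key[of 1] by simp
  then have "v * 2 = v * 2 ^ (D * E)" using key[of 2] by (simp add: field_simps)
  then have "2 ^ (D * E) = (2 :: 'k)" using v(2) by simp
  then have "of_nat (2 ^ (D * E)) = (of_nat 2 :: 'k)" by simp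
  then have "2 ^ (D * E) = (2 ^ 1 :: nat)" by (simp only: of_nat_eq_iff power_one_right)
  then show ?thesis by (simp only: power_inject_exp)
qed

text \<open>The degrees of the global families of \<open>f\<close> and its inverse multiply to 1, so
  both are 1, and homogeneous polynomial functions of degree 1 are linear forms.\<close>

theorem automorphism_linear:
  assumes f: "f \<in> carrier (Aut_hyp (cubic a b1 b2 b3))"
  obtains A :: "'k ^ 5 ^ 5" where "surj (\<lambda>x. A *v x)"
    "\<And>x. F x = 0 \<Longrightarrow> F (A *v x) = 0" "\<And>x. F x = 0 \<Longrightarrow> x \<noteq> 0 \<Longrightarrow> f (vec.span {x}) = vec.span {A *v x}"
proof -
  define g where "g = inv_into X f"
  have bij: "bij_betw f X X" and reg: "regular_map (cubic a b1 b2 b3) f" "regular_map (cubic a b1 b2 b3) g"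
    using f by (simp_all add: Aut_hyp_def Bij_def g_def)
  have fX: "f L \<in> X" if "L \<in> X" for L using bij that by (rule bij_betw_apply)
  have gX: "g L \<in> X" if "L \<in> X" for L using bij_betw_inv_into[OF bij] that unfolding g_def by (rule bij_betw_apply)
  have gf: "g (f L) = L" if "L \<in> X" for L using bij that unfolding g_def by (rule bij_betw_inv_into_left)
  have fg: "f (g L) = L" if "L \<in> X" for L using bij that unfolding g_def by (rule bij_betw_inv_into_right)
  obtain D Q where Q: "\<And>m. Q m \<in> polyfun coords" "\<And>m. homog D (Q m)"
    "\<And>x. F x = 0 \<Longrightarrow> x \<noteq> 0 \<Longrightarrow> (\<chi> m. Q m x) \<noteq> 0"
    "\<And>x. F x = 0 \<Longrightarrow> x \<noteq> 0 \<Longrightarrow> f (vec.span {x}) = vec.span {\<chi> m. Q m x}"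
    by (rule regular_map_global[OF reg(1)]) (rule that)
  obtain E R where R: "\<And>m. R m \<in> polyfun coords" "\<And>m. homog E (R m)"
    "\<And>x. F x = 0 \<Longrightarrow> x \<noteq> 0 \<Longrightarrow> (\<chi> m. R m x) \<noteq> 0"
    "\<And>x. F x = 0 \<Longrightarrow> x \<noteq> 0 \<Longrightarrow> g (vec.span {x}) = vec.span {\<chi> m. R m x}"
    by (rule regular_map_global[OF reg(2)]) (rule that)
  have FQ: "F (\<chi> m. Q m x) = 0" if "F x = 0" "x \<noteq> 0" for x
    using fX[OF span_in_X[OF that(2,1)]] Q(3,4)[OF that] by (simp add: span_in_X_imp)
  have "D * E = 1"
  proof (rule inverse_degrees[OF Q(1,2) R(1,2)])
    fix x assume x: "F x = 0" "x \<noteq> 0"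
    let ?y = "\<chi> m. Q m x"
    have "vec.span {x} = vec.span {\<chi> m. R m ?y}"
      using gf[OF span_in_X[OF x(2,1)]] R(4)[OF FQ[OF x] Q(3)[OF x]] unfolding Q(4)[OF x] by simp
    then obtain c where c: "(\<chi> m. R m ?y) = c *s x" using span_eq_imp_scaled[OF sym] by blast
    then have "c \<noteq> 0" using R(3)[OF FQ[OF x] Q(3)[OF x]] by auto
    with c show "\<exists>c. c \<noteq> 0 \<and> (\<chi> m. R m ?y) = c *s x" by blast
  qed
  then have D: "D = 1" by simp
  have "\<exists>l. \<forall>x. Q m x = (\<Sum>i\<in>UNIV. l i * x $ i)" for m
    using homog_1_linear[OF Q(1) Q(2)[unfolded D]] by metis
  then obtain l where l: "\<And>m x. Q m x = (\<Sum>i\<in>UNIV. l m i * x $ i)" by metis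
  define A where "A = (\<chi> m i. l m i)"
  have A: "(\<chi> m. Q m x) = A *v x" for x
    by (simp add: A_def l matrix_vector_mult_def)
  note span = vec.subspace_span
  \<comment> \<open>As \<open>f\<close> is onto, the image of the matrix contains the whole cone.
    The cone contains \<open>e_2\<close> to \<open>e_5\<close> and a point with x1 = 1, so it
    spans.\<close>
  have hit: "y \<in> range (\<lambda>x. A *v x)" if y: "F y = 0" for y
  proof (cases "y = 0")
    case True
    then have "y = A *v 0" by simp
    then show ?thesis by blast
  next
    case False
    then obtain x where x: "x \<noteq> 0" "F x = 0" "g (vec.span {y}) = vec.span {x}"
      using gX[OF span_in_X[OF False y]] by (auto simp: in_X_iff)
    then have "vec.span {y} = vec.span {A *v x}"
      using fg[OF span_in_X[OF False y]] Q(4)[of x] by (simp add: A)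
    then obtain c where "y = c *s (A *v x)" by (rule span_eq_imp_scaled)
    then have "y = A *v (c *s x)" by (simp add: vector_scalar_commute)
    then show ?thesis by blast
  qed
  have sub: "vec.subspace (range (\<lambda>x. A *v x))"
    by (rule vec.subspaceI) (auto simp: matrix_vector_right_distrib[symmetric] vector_scalar_commute[symmetric]
        intro: range_eqI[of _ _ 0])
  have "surj (\<lambda>x. A *v x)"
  proof -
    have ax: "axis i 1 \<in> range (\<lambda>x. A *v x)" if "i \<noteq> 1" for i
      by (rule hit) (use that in \<open>auto simp: F_at_infinity axis_def\<close>)
    obtain w where w: "F (pt 2 3 4 1 0 0 0 w) = 0"
    proof -
      obtain w where "1 * w\<^sup>2 + 0 * w + (- a) = (0::'k)" using quadratic_root[of 1 0 "- a"] by auto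
      then have "F (pt 2 3 4 1 0 0 0 w) = 0" by (simp add: F_pt[OF triple_234])
      then show ?thesis by (rule that)
    qed
    have "axis 1 1 = pt 2 3 4 1 0 0 0 w - w *s axis 5 1"
      unfolding Finite_Cartesian_Product.vec_eq_iff
    proof
      fix i
      show "axis 1 1 $ i = (pt 2 3 4 1 0 0 0 w - w *s axis 5 1) $ i"
        using exhaust_5[of i] by (auto simp: pt_def axis_def)
    qed
    then have ax1: "axis 1 1 \<in> range (\<lambda>x. A *v x)"
      using vec.subspace_diff[OF sub hit[OF w] vec.subspace_scale[OF sub ax[of 5]]] by simp
    have "x \<in> range (\<lambda>x. A *v x)" for x :: "'k ^ 5"
    proof -
      have "x = (\<Sum>i\<in>UNIV. x $ i *s axis i 1)" by (simp add: basis_expansion)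
      moreover have "(\<Sum>i\<in>UNIV. x $ i *s axis i 1) \<in> range (\<lambda>x. A *v x)"
        using ax ax1 by (intro vec.subspace_sum[OF sub] vec.subspace_scale[OF sub]) metis
      ultimately show ?thesis by simp
    qed
    then show ?thesis by blast
  qed
  moreover have "F (A *v x) = 0" if "F x = 0" for x
    using FQ[OF that] by (cases "x = 0") (simp_all add: A)
  moreover have "f (vec.span {x}) = vec.span {A *v x}" if "F x = 0" "x \<noteq> 0" for x
    using Q(4)[OF that] by (simp add: A)
  ultimately show ?thesis by (rule that)
qed

end

section \<open>Linear automorphisms are signed permutations\<close>

lemma sum_5: "sum f (UNIV :: 5 set) = f 1 + f 2 + f 3 + f 4 + f 5"
proof -
  have "(UNIV :: 5 set) = {1, 2, 3, 4, 5}" using exhaust_5 by blast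
  then have "sum f (UNIV :: 5 set) = sum f {1, 2, 3, 4, 5}" by simp
  also have "\<dots> = f 1 + f 2 + f 3 + f 4 + f 5" by (simp add: add.assoc)
  finally show ?thesis .
qed

text \<open>The points with x1 = 1 form the double cover \<open>w^2 = g(p, q, r)\<close>. The part
  of the substituted equation odd in \<open>w\<close> must vanish by itself, and in the even part
  \<open>w^2\<close> can be replaced by \<open>g\<close>, which leaves a polynomial identity in
  \<open>p, q, r\<close>.\<close>

lemma cubic_substitution:
  fixes a :: "'a::{alg_closed_field, field_char_0}"
  assumes zero: "\<And>p q r w. w\<^sup>2 = p * q * r + a + b1 * p + b2 * q + b3 * r + p\<^sup>2 + q\<^sup>2 + r\<^sup>2 \<Longrightarrow>
      (\<alpha>2 * p + \<gamma>2) * (\<alpha>3 * q + \<gamma>3) * (\<alpha>4 * r + \<gamma>4) + a * m ^ 3 +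
      m\<^sup>2 * (\<beta>2 * (\<alpha>2 * p + \<gamma>2) + \<beta>3 * (\<alpha>3 * q + \<gamma>3) + \<beta>4 * (\<alpha>4 * r + \<gamma>4)) +
      m * ((\<alpha>2 * p + \<gamma>2)\<^sup>2 + (\<alpha>3 * q + \<gamma>3)\<^sup>2 + (\<alpha>4 * r + \<gamma>4)\<^sup>2 -
        (\<rho> * w + (d1 + d2 * p + d3 * q + d4 * r))\<^sup>2) = 0"
    and m: "m \<noteq> 0" and \<rho>: "\<rho> \<noteq> 0"
  shows "d1 = 0 \<and> d2 = 0 \<and> d3 = 0 \<and> d4 = 0 \<and> \<gamma>2 = 0 \<and> \<gamma>3 = 0 \<and> \<gamma>4 = 0 \<and>
    \<alpha>2\<^sup>2 = \<rho>\<^sup>2 \<and> \<alpha>3\<^sup>2 = \<rho>\<^sup>2 \<and> \<alpha>4\<^sup>2 = \<rho>\<^sup>2 \<and> \<alpha>2 * \<alpha>3 * \<alpha>4 = m * \<rho>\<^sup>2 \<and>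
    m * \<beta>2 * \<alpha>2 = \<rho>\<^sup>2 * b1 \<and> m * \<beta>3 * \<alpha>3 = \<rho>\<^sup>2 * b2 \<and> m * \<beta>4 * \<alpha>4 = \<rho>\<^sup>2 * b3"
proof -
  define g where "g = [:[:[:a, b1, 1:], [:b2:], 1:], [:[:b3:], [:0, 1:]:], [:1:]:]"
  define L where "L = [:[:[:d1, d2:], [:d3:]:], [:[:d4:]:]:]"
  have g: "ev3 g (p, q, r) = p * q * r + a + b1 * p + b2 * q + b3 * r + p\<^sup>2 + q\<^sup>2 + r\<^sup>2" for p q r
    by (simp add: g_def power2_eq_square algebra_simps)
  have L: "ev3 L (p, q, r) = d1 + d2 * p + d3 * q + d4 * r" for p q r
    by (simp add: L_def algebra_simps)
  have root: "\<exists>w. w\<^sup>2 = ev3 g x" for x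
  proof -
    obtain w where "1 * w\<^sup>2 + 0 * w + (- ev3 g x) = 0" using quadratic_root[of 1 0 "- ev3 g x"] by auto
    then show ?thesis by (intro exI[of _ w]) simp
  qed
  \<comment> \<open>Both \<open>w\<close> and \<open>- w\<close> are admissible; the difference of
    the two equations is a nonzero constant times \<open>w * L\<close>.\<close>
  have "ev3 (g * L) x = 0" for x
  proof (cases x)
    case (fields p q r)
    obtain w where w: "w\<^sup>2 = ev3 g (p, q, r)" using root by blast
    define K where "K = (\<alpha>2 * p + \<gamma>2) * (\<alpha>3 * q + \<gamma>3) * (\<alpha>4 * r + \<gamma>4) + a * m ^ 3 +
      m\<^sup>2 * (\<beta>2 * (\<alpha>2 * p + \<gamma>2) + \<beta>3 * (\<alpha>3 * q + \<gamma>3) + \<beta>4 * (\<alpha>4 * r + \<gamma>4))"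
    define N where "N = (\<alpha>2 * p + \<gamma>2)\<^sup>2 + (\<alpha>3 * q + \<gamma>3)\<^sup>2 + (\<alpha>4 * r + \<gamma>4)\<^sup>2"
    define l where "l = d1 + d2 * p + d3 * q + d4 * r"
    have w': "(- w)\<^sup>2 = p * q * r + a + b1 * p + b2 * q + b3 * r + p\<^sup>2 + q\<^sup>2 + r\<^sup>2"
      using w unfolding g by simp
    have 1: "K + m * (N - (\<rho> * w + l)\<^sup>2) = 0"
      unfolding K_def N_def l_def by (rule zero[OF w[unfolded g]])
    have 2: "K + m * (N - (\<rho> * (- w) + l)\<^sup>2) = 0"
      unfolding K_def N_def l_def by (rule zero[OF w'])
    have "4 * (m * \<rho> * (w * l)) = (K + m * (N - (\<rho> * (- w) + l)\<^sup>2)) - (K + m * (N - (\<rho> * w + l)\<^sup>2))"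
      by (simp add: power2_eq_square algebra_simps)
    then have "4 * (m * \<rho> * (w * l)) = 0" unfolding 1 2 by simp
    then have "w * l = 0" using m \<rho> by simp
    then have "w\<^sup>2 * l = 0" by auto
    then show ?thesis by (simp add: fields w L l_def)
  qed
  then have "g * L = 0" by (rule ev3_eq_0)
  moreover have "g \<noteq> 0" by (simp add: g_def)
  ultimately have "L = 0" by simp
  then have d: "d1 = 0" "d2 = 0" "d3 = 0" "d4 = 0" by (simp_all add: L_def)
  \<comment> \<open>The coefficients of the even part with \<open>w^2\<close> replaced by
    \<open>g\<close>. All of them vanish, which yields the relations one by one.\<close>
  define C where "C = [:
    [:[:\<gamma>2 * \<gamma>3 * \<gamma>4 + a * m ^ 3 + m\<^sup>2 * (\<beta>2 * \<gamma>2 + \<beta>3 * \<gamma>3 + \<beta>4 * \<gamma>4) + m * (\<gamma>2\<^sup>2 + \<gamma>3\<^sup>2 + \<gamma>4\<^sup>2) - m * \<rho>\<^sup>2 * a,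
        \<alpha>2 * \<gamma>3 * \<gamma>4 + m\<^sup>2 * \<beta>2 * \<alpha>2 + 2 * m * \<alpha>2 * \<gamma>2 - m * \<rho>\<^sup>2 * b1, m * \<alpha>2\<^sup>2 - m * \<rho>\<^sup>2:],
      [:\<gamma>2 * \<alpha>3 * \<gamma>4 + m\<^sup>2 * \<beta>3 * \<alpha>3 + 2 * m * \<alpha>3 * \<gamma>3 - m * \<rho>\<^sup>2 * b2, \<alpha>2 * \<alpha>3 * \<gamma>4:],
      [:m * \<alpha>3\<^sup>2 - m * \<rho>\<^sup>2:]:],
    [:[:\<gamma>2 * \<gamma>3 * \<alpha>4 + m\<^sup>2 * \<beta>4 * \<alpha>4 + 2 * m * \<alpha>4 * \<gamma>4 - m * \<rho>\<^sup>2 * b3, \<alpha>2 * \<gamma>3 * \<alpha>4:],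
      [:\<gamma>2 * \<alpha>3 * \<alpha>4, \<alpha>2 * \<alpha>3 * \<alpha>4 - m * \<rho>\<^sup>2:]:],
    [:[:m * \<alpha>4\<^sup>2 - m * \<rho>\<^sup>2:]:]:]"
  have "ev3 C x = 0" for x
  proof (cases x)
    case (fields p q r)
    obtain w where w: "w\<^sup>2 = ev3 g (p, q, r)" using root by blast
    define K where "K = (\<alpha>2 * p + \<gamma>2) * (\<alpha>3 * q + \<gamma>3) * (\<alpha>4 * r + \<gamma>4) + a * m ^ 3 +
      m\<^sup>2 * (\<beta>2 * (\<alpha>2 * p + \<gamma>2) + \<beta>3 * (\<alpha>3 * q + \<gamma>3) + \<beta>4 * (\<alpha>4 * r + \<gamma>4))"
    define N where "N = (\<alpha>2 * p + \<gamma>2)\<^sup>2 + (\<alpha>3 * q + \<gamma>3)\<^sup>2 + (\<alpha>4 * r + \<gamma>4)\<^sup>2"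
    have "K + m * (N - (\<rho> * w + (d1 + d2 * p + d3 * q + d4 * r))\<^sup>2) = 0"
      unfolding K_def N_def by (rule zero[OF w[unfolded g]])
    then have 1: "K + m * (N - \<rho>\<^sup>2 * w\<^sup>2) = 0" by (simp add: d power_mult_distrib)
    have "ev3 C (p, q, r) = K + m * (N - \<rho>\<^sup>2 * ev3 g (p, q, r))"
      unfolding g C_def K_def N_def by (simp add: power2_eq_square algebra_simps)
    also have "\<dots> = 0" using 1 unfolding w .
    finally show ?thesis by (simp add: fields)
  qed
  then have "C = 0" by (rule ev3_eq_0)
  then have *: "m * \<alpha>2\<^sup>2 - m * \<rho>\<^sup>2 = 0" "m * \<alpha>3\<^sup>2 - m * \<rho>\<^sup>2 = 0" "m * \<alpha>4\<^sup>2 - m * \<rho>\<^sup>2 = 0"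
    "\<alpha>2 * \<alpha>3 * \<gamma>4 = 0" "\<alpha>2 * \<gamma>3 * \<alpha>4 = 0" "\<gamma>2 * \<alpha>3 * \<alpha>4 = 0" "\<alpha>2 * \<alpha>3 * \<alpha>4 - m * \<rho>\<^sup>2 = 0"
    "\<alpha>2 * \<gamma>3 * \<gamma>4 + m\<^sup>2 * \<beta>2 * \<alpha>2 + 2 * m * \<alpha>2 * \<gamma>2 - m * \<rho>\<^sup>2 * b1 = 0"
    "\<gamma>2 * \<alpha>3 * \<gamma>4 + m\<^sup>2 * \<beta>3 * \<alpha>3 + 2 * m * \<alpha>3 * \<gamma>3 - m * \<rho>\<^sup>2 * b2 = 0"
    "\<gamma>2 * \<gamma>3 * \<alpha>4 + m\<^sup>2 * \<beta>4 * \<alpha>4 + 2 * m * \<alpha>4 * \<gamma>4 - m * \<rho>\<^sup>2 * b3 = 0"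
    unfolding C_def by (simp_all only: pCons_eq_0_iff)
  have prod: "\<alpha>2 * \<alpha>3 * \<alpha>4 = m * \<rho>\<^sup>2" using *(7) by simp
  then have nz: "\<alpha>2 \<noteq> 0" "\<alpha>3 \<noteq> 0" "\<alpha>4 \<noteq> 0" using m \<rho> by auto
  then have \<gamma>: "\<gamma>2 = 0" "\<gamma>3 = 0" "\<gamma>4 = 0" using *(4-6) by simp_all
  have sq: "\<alpha>2\<^sup>2 = \<rho>\<^sup>2" "\<alpha>3\<^sup>2 = \<rho>\<^sup>2" "\<alpha>4\<^sup>2 = \<rho>\<^sup>2"
    using *(1-3) m by (simp_all flip: right_diff_distrib)
  have "m * (m * \<beta>2 * \<alpha>2 - \<rho>\<^sup>2 * b1) = 0" "m * (m * \<beta>3 * \<alpha>3 - \<rho>\<^sup>2 * b2) = 0"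
    "m * (m * \<beta>4 * \<alpha>4 - \<rho>\<^sup>2 * b3) = 0"
    using *(8-10) by (simp_all add: \<gamma> power2_eq_square algebra_simps)
  then have "m * \<beta>2 * \<alpha>2 = \<rho>\<^sup>2 * b1" "m * \<beta>3 * \<alpha>3 = \<rho>\<^sup>2 * b2" "m * \<beta>4 * \<alpha>4 = \<rho>\<^sup>2 * b3"
    using m by simp_all
  then show ?thesis using d \<gamma> sq prod by blast
qed

section \<open>The three planes and the shape of a linear automorphism\<close>

definition plane :: "5 \<Rightarrow> ('a::field ^ 5) set" where
  "plane i = {x. x $ 1 = 0 \<and> x $ i = 0}"

lemma subspace_plane: "vec.subspace (plane i)"
  by (rule vec.subspaceI) (simp_all add: plane_def)

lemma dim_plane:
  assumes ijk: "(i, j, k) \<in> triples"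
  shows "vec.dim (plane i :: ('a::field ^ 5) set) = 3"
proof (rule vec.dim_unique)
  let ?B = "{axis j 1, axis k 1, axis 5 1} :: ('a ^ 5) set"
  note d = triples_distinct[OF ijk]
  show "?B \<subseteq> plane i" using d by (auto simp: plane_def axis_def)
  show "vec.independent ?B"
    by (rule vec.independent_mono[OF independent_cart_basis]) (auto simp: cart_basis_def)
  show "card ?B = 3" using d by (simp add: axis_eq_axis)
  show "plane i \<subseteq> vec.span ?B"
  proof
    fix x :: "'a ^ 5" assume x: "x \<in> plane i"
    have "x = x $ j *s axis j 1 + x $ k *s axis k 1 + x $ 5 *s axis 5 1"
      unfolding Finite_Cartesian_Product.vec_eq_iff
    proof
      fix l
      show "x $ l = (x $ j *s axis j 1 + x $ k *s axis k 1 + x $ 5 *s axis 5 1) $ l"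
        using triples_cover[OF ijk, of l] x d by (auto simp: plane_def axis_def)
    qed
    also have "\<dots> \<in> vec.span ?B"
      by (intro vec.span_add vec.span_scale vec.span_base) simp_all
    finally show "x \<in> vec.span ?B" .
  qed
qed

lemma plane_inj:
  assumes "plane i = (plane j :: ('a::field ^ 5) set)" "i \<noteq> 1" "j \<noteq> 1"
  shows "i = j"
proof (rule ccontr)
  assume "i \<noteq> j"
  then have "axis i 1 \<in> (plane j :: ('a ^ 5) set)" using assms(2) by (simp add: plane_def axis_def)
  then show False unfolding assms(1)[symmetric] by (simp add: plane_def)
qed

context cubic_cone
begin

lemma planes_in_cubic:
  assumes "card (planes_in (cubic a b1 b2 b3)) = 3"
  shows "planes_in (cubic a b1 b2 b3) = plane ` {2, 3, 4}"
proof -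
  have "plane i \<in> planes_in (cubic a b1 b2 b3)" if "i \<in> {2, 3, 4}" for i
  proof -
    have "\<exists>j k. (i, j, k) \<in> triples" using that by (auto simp: triples_def)
    then have "vec.dim (plane i :: ('k ^ 5) set) = 3" using dim_plane by blast
    moreover have "F x = 0" if "x \<in> plane i" for x
      using that \<open>i \<in> {2, 3, 4}\<close> by (auto simp: plane_def F_at_infinity)
    ultimately show ?thesis unfolding planes_in_def mp_eval_cubic by (simp add: subspace_plane)
  qed
  then have "plane ` {2, 3, 4} \<subseteq> planes_in (cubic a b1 b2 b3)" by blast
  moreover have "card (plane ` {2, 3, 4} :: ('k ^ 5) set set) = 3"
  proof -
    have "inj_on (plane :: 5 \<Rightarrow> ('k ^ 5) set) {2, 3, 4}"
      by (rule inj_onI, rule plane_inj) auto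
    then show ?thesis by (subst card_image) auto
  qed
  moreover have "finite (planes_in (cubic a b1 b2 b3))" using assms by (intro card_ge_0_finite) simp
  ultimately show ?thesis using assms by (intro card_subset_eq[symmetric]) auto
qed

text \<open>Permuting the planes leaves only the first entry in row 1, one further entry in each row
  belonging to a plane, and row 5 free; preservation of the equation settles the rest.\<close>

theorem automorphism_signed_permutation:
  assumes planes: "card (planes_in (cubic a b1 b2 b3)) = 3"
    and f: "f \<in> carrier (Aut_hyp (cubic a b1 b2 b3))"
  obtains i j k e2 e3 e4 e where "(i, j, k) \<in> triples"
    "e2 \<in> {1, -1}" "e3 \<in> {1, -1}" "e4 \<in> {1, -1}" "e \<in> {1, -1}" "e2 * e3 * e4 = 1"
    "\<beta> i = e2 * b1" "\<beta> j = e3 * b2" "\<beta> k = e4 * b3"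
    "\<And>x. F x = 0 \<Longrightarrow> x \<noteq> 0 \<Longrightarrow>
      f (vec.span {x}) = vec.span {pt i j k (x $ 1) (e2 * x $ 2) (e3 * x $ 3) (e4 * x $ 4) (e * x $ 5)}"
proof -
  obtain A :: "'k ^ 5 ^ 5" where A: "surj (\<lambda>x. A *v x)"
    "\<And>x. F x = 0 \<Longrightarrow> F (A *v x) = 0" "\<And>x. F x = 0 \<Longrightarrow> x \<noteq> 0 \<Longrightarrow> f (vec.span {x}) = vec.span {A *v x}"
    by (rule automorphism_linear[OF f]) (rule that)
  have lin: "Vector_Spaces.linear (*s) (*s) (\<lambda>x. A *v x)" by (rule matrix_vector_mul_linear_gen)
  have inj: "inj (\<lambda>x. A *v x)" by (rule vec.linear_surj_imp_inj[OF lin A(1)])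
  have img: "\<exists>j\<in>{2, 3, 4}. (\<lambda>x. A *v x) ` plane i = plane j" if i: "i \<in> {2, 3, 4}" for i
  proof -
    have "plane i \<in> planes_in (cubic a b1 b2 b3)" using planes_in_cubic[OF planes] i by blast
    then have "vec.dim (plane i :: ('k ^ 5) set) = 3" "\<forall>x\<in>plane i. F x = 0"
      by (simp_all add: planes_in_def mp_eval_cubic)
    moreover have "vec.dim ((\<lambda>x. A *v x) ` plane i) = vec.dim (plane i :: ('k ^ 5) set)"
      by (rule vec.dim_image_eq[OF lin]) (use inj in \<open>auto intro: inj_on_subset\<close>)
    moreover have "vec.subspace ((\<lambda>x. A *v x) ` plane i)"
      by (rule vec.linear_subspace_image[OF lin subspace_plane])
    ultimately have "(\<lambda>x. A *v x) ` plane i \<in> planes_in (cubic a b1 b2 b3)"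
      unfolding planes_in_def mp_eval_cubic using A(2) by auto
    then show ?thesis unfolding planes_in_cubic[OF planes] by blast
  qed
  then obtain \<pi> where \<pi>: "\<And>i. i \<in> {2, 3, 4} \<Longrightarrow> \<pi> i \<in> {2, 3, 4 :: 5}"
    "\<And>i. i \<in> {2, 3, 4} \<Longrightarrow> (\<lambda>x. A *v x) ` plane i = plane (\<pi> i)" by metis
  have \<pi>inj: "i = j" if "i \<in> {2, 3, 4}" "j \<in> {2, 3, 4}" "\<pi> i = \<pi> j" for i j
  proof -
    have "plane i = (plane j :: ('k ^ 5) set)"
      using \<pi>(2)[OF that(1)] \<pi>(2)[OF that(2)] that(3) by (metis inj inj_image_eq_iff)
    then show ?thesis by (rule plane_inj) (use that in auto)
  qed
  define i j k where "i = \<pi> 2" and "j = \<pi> 3" and "k = \<pi> 4"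
  have "i \<noteq> j" "i \<noteq> k" "j \<noteq> k" using \<pi>inj[of 2 3] \<pi>inj[of 2 4] \<pi>inj[of 3 4] by (auto simp: i_def j_def k_def)
  then have ijk: "(i, j, k) \<in> triples"
    using \<pi>(1)[of 2] \<pi>(1)[of 3] \<pi>(1)[of 4] unfolding i_def[symmetric] j_def[symmetric] k_def[symmetric]
    by (auto simp: triples_def)
  have col: "(A *v axis l 1) $ n = A $ n $ l" for l n
    by (simp add: matrix_vector_mul_component axis_def matrix_vector_mult_def if_distrib cong: if_cong)
  \<comment> \<open>For \<open>l\<close> other than 1 and \<open>n\<close> the vector
    \<open>e_l\<close> lies in the plane of \<open>n\<close>, so its image lies in the plane of
    \<open>\<pi> n\<close>.\<close>
  have zero: "A $ 1 $ l = 0" "A $ \<pi> n $ l = 0" if "n \<in> {2, 3, 4}" "l \<noteq> 1" "l \<noteq> n" for n l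
  proof -
    have "axis l 1 \<in> (plane n :: ('k ^ 5) set)" using that by (simp add: plane_def axis_def)
    then have "A *v axis l 1 \<in> plane (\<pi> n)" using \<pi>(2)[OF that(1)] by blast
    then show "A $ 1 $ l = 0" "A $ \<pi> n $ l = 0" by (simp_all add: plane_def col)
  qed
  have A1: "A $ 1 $ 2 = 0" "A $ 1 $ 3 = 0" "A $ 1 $ 4 = 0" "A $ 1 $ 5 = 0"
    using zero(1)[of 3 2] zero(1)[of 2 3] zero(1)[of 2 4] zero(1)[of 2 5] by simp_all
  have Ai: "A $ i $ 3 = 0" "A $ i $ 4 = 0" "A $ i $ 5 = 0" unfolding i_def by (rule zero(2); simp)+
  have Aj: "A $ j $ 2 = 0" "A $ j $ 4 = 0" "A $ j $ 5 = 0" unfolding j_def by (rule zero(2); simp)+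
  have Ak: "A $ k $ 2 = 0" "A $ k $ 3 = 0" "A $ k $ 5 = 0" unfolding k_def by (rule zero(2); simp)+
  define m \<rho> where "m = A $ 1 $ 1" and "\<rho> = A $ 5 $ 5"
  define \<alpha>2 \<alpha>3 \<alpha>4 where "\<alpha>2 = A $ i $ 2" and "\<alpha>3 = A $ j $ 3" and "\<alpha>4 = A $ k $ 4"
  define \<gamma>2 \<gamma>3 \<gamma>4 where "\<gamma>2 = A $ i $ 1" and "\<gamma>3 = A $ j $ 1" and "\<gamma>4 = A $ k $ 1"
  define d1 d2 d3 d4 where "d1 = A $ 5 $ 1" and "d2 = A $ 5 $ 2" and "d3 = A $ 5 $ 3" and "d4 = A $ 5 $ 4"
  have Ax: "A *v x = pt i j k (m * x $ 1) (\<alpha>2 * x $ 2 + \<gamma>2 * x $ 1) (\<alpha>3 * x $ 3 + \<gamma>3 * x $ 1) (\<alpha>4 * x $ 4 + \<gamma>4 * x $ 1)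
      (\<rho> * x $ 5 + (d1 * x $ 1 + d2 * x $ 2 + d3 * x $ 3 + d4 * x $ 4))" for x
    by (rule pt_eqI[OF ijk])
      (simp_all add: matrix_vector_mult_def sum_5 A1 Ai Aj Ak m_def \<rho>_def \<alpha>2_def \<alpha>3_def \<alpha>4_def
        \<gamma>2_def \<gamma>3_def \<gamma>4_def d1_def d2_def d3_def d4_def)
  have m: "m \<noteq> 0"
  proof
    assume "m = 0"
    obtain x where "axis 1 1 = A *v x" using A(1) by (metis surjD)
    from arg_cong[OF this, of "\<lambda>v. v $ 1"] show False
      by (simp add: Ax pt_nth[OF ijk] \<open>m = 0\<close>)
  qed
  have \<rho>: "\<rho> \<noteq> 0"
  proof
    assume "\<rho> = 0"
    have "A *v axis 5 1 = A *v 0" unfolding Ax using \<open>\<rho> = 0\<close> by (simp add: axis_def)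
    then have "axis 5 1 = (0 :: 'k ^ 5)" by (rule injD[OF inj])
    from arg_cong[OF this, of "\<lambda>v. v $ 5"] show False by simp
  qed
  have rel: "d1 = 0 \<and> d2 = 0 \<and> d3 = 0 \<and> d4 = 0 \<and> \<gamma>2 = 0 \<and> \<gamma>3 = 0 \<and> \<gamma>4 = 0 \<and>
    \<alpha>2\<^sup>2 = \<rho>\<^sup>2 \<and> \<alpha>3\<^sup>2 = \<rho>\<^sup>2 \<and> \<alpha>4\<^sup>2 = \<rho>\<^sup>2 \<and> \<alpha>2 * \<alpha>3 * \<alpha>4 = m * \<rho>\<^sup>2 \<and>
    m * \<beta> i * \<alpha>2 = \<rho>\<^sup>2 * b1 \<and> m * \<beta> j * \<alpha>3 = \<rho>\<^sup>2 * b2 \<and> m * \<beta> k * \<alpha>4 = \<rho>\<^sup>2 * b3"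
  proof (rule cubic_substitution[OF _ m \<rho>])
    fix p q r w :: 'k
    assume "w\<^sup>2 = p * q * r + a + b1 * p + b2 * q + b3 * r + p\<^sup>2 + q\<^sup>2 + r\<^sup>2"
    then have "F (pt 2 3 4 1 p q r w) = 0" by (simp add: F_pt[OF triple_234] \<beta>_def)
    from A(2)[OF this] show "(\<alpha>2 * p + \<gamma>2) * (\<alpha>3 * q + \<gamma>3) * (\<alpha>4 * r + \<gamma>4) + a * m ^ 3 +
      m\<^sup>2 * (\<beta> i * (\<alpha>2 * p + \<gamma>2) + \<beta> j * (\<alpha>3 * q + \<gamma>3) + \<beta> k * (\<alpha>4 * r + \<gamma>4)) +
      m * ((\<alpha>2 * p + \<gamma>2)\<^sup>2 + (\<alpha>3 * q + \<gamma>3)\<^sup>2 + (\<alpha>4 * r + \<gamma>4)\<^sup>2 -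
        (\<rho> * w + (d1 + d2 * p + d3 * q + d4 * r))\<^sup>2) = 0"
      unfolding Ax F_pt[OF ijk] by (simp add: pt_nth[OF triple_234])
  qed
  have "(\<rho>\<^sup>2) ^ 3 = \<alpha>2\<^sup>2 * \<alpha>3\<^sup>2 * \<alpha>4\<^sup>2" using rel by (simp only: power3_eq_cube)
  also have "\<dots> = (\<alpha>2 * \<alpha>3 * \<alpha>4)\<^sup>2" by (simp only: power_mult_distrib)
  also have "\<dots> = m\<^sup>2 * (\<rho>\<^sup>2)\<^sup>2" using rel by (simp only: power_mult_distrib)
  finally have "(\<rho>\<^sup>2)\<^sup>2 * (\<rho>\<^sup>2 - m\<^sup>2) = 0" by (simp add: power2_eq_square power3_eq_cube algebra_simps)
  \<comment> \<open>The three \<open>\<alpha>\<close> have square \<open>\<rho>^2\<close> and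
    product \<open>m \<rho>^2\<close>; squaring the product gives this. So all quotients by
    \<open>m\<close> are signs, and those of the three \<open>\<alpha>\<close> have product
    1.\<close>
  then have \<rho>m: "\<rho>\<^sup>2 = m\<^sup>2" using \<rho> by simp
  have sgn: "c / m \<in> {1, -1}" if "c\<^sup>2 = \<rho>\<^sup>2" for c
  proof -
    have "(c / m)\<^sup>2 = 1" using that \<rho>m m by (simp add: power_divide)
    then show ?thesis by (simp add: power2_eq_1_iff)
  qed
  have quot: "\<beta> l = c / m * b" if "m * \<beta> l * c = \<rho>\<^sup>2 * b" "c\<^sup>2 = \<rho>\<^sup>2" for l c b
  proof -
    have "\<beta> l * c * m = b * m * m" using that(1) \<rho>m by (simp add: power2_eq_square mult_ac)
    then have "\<beta> l * c = b * m" using m by simp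
    then have 1: "(\<beta> l * c) * c = (b * m) * c" by (rule arg_cong)
    have 2: "c * c = m * m" using that(2) \<rho>m by (simp add: power2_eq_square)
    have "(\<beta> l * m) * m = (c * b) * m" using 1 unfolding mult.assoc 2 by (simp only: mult_ac)
    then have "\<beta> l * m = c * b" using m by (simp only: mult_right_cancel simp_thms)
    then show ?thesis using m by (simp add: field_simps)
  qed
  show ?thesis
  proof (rule that[OF ijk, of "\<alpha>2 / m" "\<alpha>3 / m" "\<alpha>4 / m" "\<rho> / m"])
    show "\<alpha>2 / m \<in> {1, -1}" "\<alpha>3 / m \<in> {1, -1}" "\<alpha>4 / m \<in> {1, -1}" "\<rho> / m \<in> {1, -1}"
      using rel sgn by blast+
    show "\<alpha>2 / m * (\<alpha>3 / m) * (\<alpha>4 / m) = 1"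
      using rel \<rho>m m by (simp add: power2_eq_square)
    show "\<beta> i = \<alpha>2 / m * b1" "\<beta> j = \<alpha>3 / m * b2" "\<beta> k = \<alpha>4 / m * b3" using rel quot by blast+
    fix x assume x: "F x = 0" "x \<noteq> 0"
    have "pt i j k (x $ 1) (\<alpha>2 / m * x $ 2) (\<alpha>3 / m * x $ 3) (\<alpha>4 / m * x $ 4) (\<rho> / m * x $ 5) = inverse m *s (A *v x)"
      by (rule sym, rule pt_eqI[OF ijk]) (use m rel in \<open>simp_all add: Ax pt_nth[OF ijk] divide_inverse mult_ac\<close>)
    then show "f (vec.span {x}) =
      vec.span {pt i j k (x $ 1) (\<alpha>2 / m * x $ 2) (\<alpha>3 / m * x $ 3) (\<alpha>4 / m * x $ 4) (\<rho> / m * x $ 5)}"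
      using A(3)[OF x] m by (simp add: span_scale_eq)
  qed
qed

end

section \<open>The tetrahedral action\<close>

text \<open>The signed permutations of the coordinates 2, 3, 4 with an even number of signs act as the
  symmetric group on the vertices of a regular tetrahedron. In terms of the four linear forms
  given by the vertices, whose sum is zero, the cubic is symmetric up to its linear part.\<close>

definition vtx :: "nat \<Rightarrow> 5 \<Rightarrow> 'a::comm_ring_1" where
  "vtx n l = (if n = 4 \<or> (n = 1 \<and> l = 2) \<or> (n = 2 \<and> l = 3) \<or> (n = 3 \<and> l = 4) then 1 else - 1)"

definition vform :: "nat \<Rightarrow> 'a::comm_ring_1 ^ 5 \<Rightarrow> 'a" where
  "vform n x = vtx n 2 * x $ 2 + vtx n 3 * x $ 3 + vtx n 4 * x $ 4"

text \<open>Keeps the vertex label 1 from being rewritten to \<open>Suc 0\<close>.\<close>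

declare One_nat_def [simp del]

lemma I4: "{1..4::nat} = {1, 2, 3, 4}"
  by auto

lemma sum_I4: "sum f {1..4::nat} = f 1 + f 2 + f 3 + f 4"
  by (simp add: I4 add.assoc)

text \<open>The Gram matrix of a regular tetrahedron: 4 times the identity minus the all-ones
  matrix.\<close>

lemma vtx_orthogonal:
  assumes "m \<in> {1..4}" "n \<in> {1..4}"
  shows "vtx m 2 * vtx n 2 + vtx m 3 * vtx n 3 + vtx m 4 * vtx n 4 = (if m = n then 3 else - 1 :: 'a::comm_ring_1)"
  using assms unfolding I4 by (auto simp: vtx_def)

lemma vform_explicit:
  "vform 1 x = x $ 2 - x $ 3 - x $ 4" "vform 2 x = - x $ 2 + x $ 3 - x $ 4"
  "vform 3 x = - x $ 2 - x $ 3 + x $ 4" "vform 4 x = x $ 2 + x $ 3 + x $ 4"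
  by (simp_all add: vform_def vtx_def)

lemma vform_sum: "(\<Sum>n\<in>{1..4}. vform n x) = 0"
  by (simp add: sum_I4 vform_explicit)

lemma vform_determine:
  fixes x y :: "'a::field_char_0 ^ 5"
  assumes "x $ 1 = y $ 1" "x $ 5 = y $ 5" "\<And>n. n \<in> {1..4} \<Longrightarrow> vform n x = vform n y"
  shows "x = y"
proof -
  have e: "2 * z $ 2 = vform 1 z + vform 4 z" "2 * z $ 3 = vform 2 z + vform 4 z"
    "2 * z $ 4 = vform 3 z + vform 4 z" for z :: "'a ^ 5"
    by (simp_all add: vform_explicit)
  have "2 * x $ 2 = 2 * y $ 2" "2 * x $ 3 = 2 * y $ 3" "2 * x $ 4 = 2 * y $ 4"
    unfolding e using assms(3)[of 1] assms(3)[of 2] assms(3)[of 3] assms(3)[of 4] by simp_all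
  then have "x $ 2 = y $ 2" "x $ 3 = y $ 3" "x $ 4 = y $ 4" by simp_all
  then show ?thesis unfolding Finite_Cartesian_Product.vec_eq_iff using assms(1,2) exhaust_5 by metis
qed

text \<open>The linear map taking vertex \<open>n\<close> to vertex \<open>\<sigma> n\<close>, with
  the sign \<open>e\<close> on x5. Since the sum of \<open>vtx n l * vtx n l'\<close> over the
  vertices is 4 for \<open>l = l'\<close> and 0 otherwise, a vector is recovered from its four
  vertex forms with the factor 1/4.\<close>

definition act :: "'a \<Rightarrow> (nat \<Rightarrow> nat) \<Rightarrow> 'a::field ^ 5 \<Rightarrow> 'a ^ 5" where
  "act e \<sigma> x = (\<chi> l. if l = 1 then x $ 1 else if l = 5 then e * x $ 5
     else inverse 4 * (\<Sum>n\<in>{1..4}. vtx (\<sigma> n) l * vform n x))"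

lemma act_nth: "act e \<sigma> x $ 1 = x $ 1" "act e \<sigma> x $ 5 = e * x $ 5"
  by (simp_all add: act_def)

lemma act_add: "act e \<sigma> (x + y) = act e \<sigma> x + act e \<sigma> y"
  by (simp add: act_def Finite_Cartesian_Product.vec_eq_iff vform_def algebra_simps sum.distrib)

lemma act_scale: "act e \<sigma> (c *s x) = c *s act e \<sigma> x"
  by (simp add: act_def Finite_Cartesian_Product.vec_eq_iff vform_def algebra_simps sum_distrib_left)

text \<open>By the Gram matrix, the form of vertex \<open>\<sigma> m\<close> picks out 4 times the
  form of \<open>m\<close>, up to the sum of all four forms, which is zero.\<close>

lemma vform_act:
  fixes x :: "'a::field_char_0 ^ 5"
  assumes \<sigma>: "\<sigma> permutes {1..4}" and m: "m \<in> {1..4}"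
  shows "vform (\<sigma> m) (act e \<sigma> x) = vform m x"
proof -
  let ?s = "\<lambda>l. \<Sum>n\<in>{1..4}. vtx (\<sigma> n) l * vform n x"
  have "vform (\<sigma> m) (act e \<sigma> x) = inverse 4 * (vtx (\<sigma> m) 2 * ?s 2 + vtx (\<sigma> m) 3 * ?s 3 + vtx (\<sigma> m) 4 * ?s 4)"
    by (simp add: vform_def[of "\<sigma> m"] act_def algebra_simps)
  also have "vtx (\<sigma> m) 2 * ?s 2 + vtx (\<sigma> m) 3 * ?s 3 + vtx (\<sigma> m) 4 * ?s 4 =
      (\<Sum>n\<in>{1..4}. (vtx (\<sigma> m) 2 * vtx (\<sigma> n) 2 + vtx (\<sigma> m) 3 * vtx (\<sigma> n) 3 + vtx (\<sigma> m) 4 * vtx (\<sigma> n) 4) * vform n x)"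
    by (simp add: sum_distrib_left sum.distrib algebra_simps)
  also have "\<dots> = (\<Sum>n\<in>{1..4}. (if n = m then 4 * vform n x else 0) - vform n x)"
  proof (rule sum.cong[OF refl])
    fix n :: nat assume n: "n \<in> {1..4}"
    have "\<sigma> m \<in> {1..4}" "\<sigma> n \<in> {1..4}" using permutes_in_image[OF \<sigma>] m n by auto
    moreover have "\<sigma> m = \<sigma> n \<longleftrightarrow> n = m" using permutes_inj[OF \<sigma>] by (auto dest: injD)
    ultimately show "(vtx (\<sigma> m) 2 * vtx (\<sigma> n) 2 + vtx (\<sigma> m) 3 * vtx (\<sigma> n) 3 + vtx (\<sigma> m) 4 * vtx (\<sigma> n) 4) * vform n x =
        (if n = m then 4 * vform n x else 0) - vform n x"
      by (subst vtx_orthogonal) auto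
  qed
  also have "\<dots> = 4 * vform m x"
    using m unfolding sum_subtractf vform_sum by simp
  finally show ?thesis by simp
qed

lemma act_comp:
  fixes x :: "'a::field_char_0 ^ 5"
  assumes \<sigma>: "\<sigma> permutes {1..4}" and \<tau>: "\<tau> permutes {1..4}"
  shows "act e \<sigma> (act e' \<tau> x) = act (e * e') (\<sigma> \<circ> \<tau>) x"
proof (rule vform_determine)
  have \<sigma>\<tau>: "\<sigma> \<circ> \<tau> permutes {1..4}" by (rule permutes_compose[OF \<tau> \<sigma>])
  fix n :: nat assume "n \<in> {1..4}"
  then obtain m where m: "m \<in> {1..4}" "n = (\<sigma> \<circ> \<tau>) m" using permutes_image[OF \<sigma>\<tau>] by blast
  have "\<tau> m \<in> {1..4}" using permutes_in_image[OF \<tau>] m(1) by simp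
  then have "vform n (act e \<sigma> (act e' \<tau> x)) = vform m x"
    unfolding m(2) by (simp add: vform_act[OF \<sigma>] vform_act[OF \<tau> m(1)])
  then show "vform n (act e \<sigma> (act e' \<tau> x)) = vform n (act (e * e') (\<sigma> \<circ> \<tau>) x)"
    using vform_act[OF \<sigma>\<tau> m(1), of "e * e'" x] unfolding m(2) by simp
qed (simp_all add: act_nth mult.assoc)

lemma act_one: "act 1 id x = (x :: 'a::field_char_0 ^ 5)"
proof (rule vform_determine)
  fix n :: nat assume "n \<in> {1..4}"
  then show "vform n (act 1 id x) = vform n x" using vform_act[OF permutes_id, of n 1 x] by simp
qed (simp_all add: act_nth)

lemma act_eqI:
  fixes x y :: "'a::field_char_0 ^ 5"
  assumes \<sigma>: "\<sigma> permutes {1..4}" and "y $ 1 = x $ 1" "y $ 5 = e * x $ 5"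
    and "\<And>n. n \<in> {1..4} \<Longrightarrow> vform (\<sigma> n) y = vform n x"
  shows "act e \<sigma> x = y"
proof (rule vform_determine)
  fix n :: nat assume "n \<in> {1..4}"
  then obtain m where m: "m \<in> {1..4}" "n = \<sigma> m" using permutes_image[OF \<sigma>] by blast
  show "vform n (act e \<sigma> x) = vform n y"
    unfolding m(2) vform_act[OF \<sigma> m(1)] assms(4)[OF m(1)] by simp
qed (simp_all add: act_nth assms)

definition bform :: "'a::comm_ring_1 \<Rightarrow> 'a \<Rightarrow> 'a \<Rightarrow> nat \<Rightarrow> 'a" where
  "bform b1 b2 b3 n = vtx n 2 * b1 + vtx n 3 * b2 + vtx n 4 * b3"

definition stab :: "'a::comm_ring_1 \<Rightarrow> 'a \<Rightarrow> 'a \<Rightarrow> (nat \<Rightarrow> nat) set" where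
  "stab b1 b2 b3 = {\<sigma>. \<sigma> permutes {1..4} \<and> (\<forall>n\<in>{1..4}. bform b1 b2 b3 (\<sigma> n) = bform b1 b2 b3 n)}"

text \<open>Summed over the vertices, the cubes of the forms give 24 x2 x3 x4, the squares give 4
  times the sum of squares, and the products with \<open>bform\<close> give 4 times the linear form;
  24 is the common multiple.\<close>

lemma cubic_fun_vform:
  fixes a :: "'a::comm_ring_1"
  shows "24 * cubic_fun a b1 b2 b3 x = (\<Sum>n\<in>{1..4}. vform n x ^ 3) + 24 * a * (x $ 1) ^ 3 +
    6 * (x $ 1)\<^sup>2 * (\<Sum>n\<in>{1..4}. bform b1 b2 b3 n * vform n x) +
    6 * x $ 1 * (\<Sum>n\<in>{1..4}. (vform n x)\<^sup>2) - 24 * x $ 1 * (x $ 5)\<^sup>2"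
  by (simp add: sum_I4 cubic_fun_def vform_explicit bform_def vtx_def power2_eq_square power3_eq_cube algebra_simps)

lemma cubic_fun_act:
  fixes a :: "'a::field_char_0"
  assumes \<sigma>: "\<sigma> \<in> stab b1 b2 b3" and e: "e \<in> {1, -1}"
  shows "cubic_fun a b1 b2 b3 (act e \<sigma> x) = cubic_fun a b1 b2 b3 x"
proof -
  have p: "\<sigma> permutes {1..4}" and b: "\<And>n. n \<in> {1..4} \<Longrightarrow> bform b1 b2 b3 (\<sigma> n) = bform b1 b2 b3 n"
    using \<sigma> by (simp_all add: stab_def)
  have re: "(\<Sum>n\<in>{1..4}. g n) = (\<Sum>n\<in>{1..4}. g (\<sigma> n))" for g :: "nat \<Rightarrow> 'a"
    using sum.permute[OF p, of g] by (simp add: comp_def)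
  have "(\<Sum>n\<in>{1..4}. vform n (act e \<sigma> x) ^ 3) = (\<Sum>n\<in>{1..4}. vform n x ^ 3)"
    by (subst re) (rule sum.cong[OF refl], simp add: vform_act[OF p])
  moreover have "(\<Sum>n\<in>{1..4}. (vform n (act e \<sigma> x))\<^sup>2) = (\<Sum>n\<in>{1..4}. (vform n x)\<^sup>2)"
    by (subst re) (rule sum.cong[OF refl], simp add: vform_act[OF p])
  moreover have "(\<Sum>n\<in>{1..4}. bform b1 b2 b3 n * vform n (act e \<sigma> x)) = (\<Sum>n\<in>{1..4}. bform b1 b2 b3 n * vform n x)"
    by (subst re) (rule sum.cong[OF refl], simp add: vform_act[OF p] b)
  moreover have "(e * x $ 5)\<^sup>2 = (x $ 5)\<^sup>2" using e by auto
  ultimately have "24 * cubic_fun a b1 b2 b3 (act e \<sigma> x) = 24 * cubic_fun a b1 b2 b3 x"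
    unfolding cubic_fun_vform by (simp add: act_nth)
  then show ?thesis by simp
qed

lemma stab_compose: "\<sigma> \<in> stab b1 b2 b3 \<Longrightarrow> \<tau> \<in> stab b1 b2 b3 \<Longrightarrow> \<sigma> \<circ> \<tau> \<in> stab b1 b2 b3"
proof -
  assume s: "\<sigma> \<in> stab b1 b2 b3" "\<tau> \<in> stab b1 b2 b3"
  have p: "\<sigma> permutes {1..4}" "\<tau> permutes {1..4}" using s by (simp_all add: stab_def)
  have "bform b1 b2 b3 ((\<sigma> \<circ> \<tau>) n) = bform b1 b2 b3 n" if n: "n \<in> {1..4}" for n
  proof -
    have "\<tau> n \<in> {1..4}" using permutes_in_image[OF p(2)] n by simp
    then have "bform b1 b2 b3 (\<sigma> (\<tau> n)) = bform b1 b2 b3 (\<tau> n)" using s(1) unfolding stab_def by blast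
    also have "\<dots> = bform b1 b2 b3 n" using s(2) n unfolding stab_def by blast
    finally show ?thesis by simp
  qed
  then show ?thesis using permutes_compose[OF p(2,1)] by (simp add: stab_def)
qed

lemma stab_id: "id \<in> stab b1 b2 b3"
  by (simp add: stab_def permutes_id)

lemma stab_inv:
  assumes "\<sigma> \<in> stab b1 b2 b3"
  shows "Hilbert_Choice.inv \<sigma> \<in> stab b1 b2 b3"
proof -
  have p: "\<sigma> permutes {1..4}" using assms by (simp add: stab_def)
  have "bform b1 b2 b3 (Hilbert_Choice.inv \<sigma> n) = bform b1 b2 b3 n" if "n \<in> {1..4}" for n
  proof -
    have "Hilbert_Choice.inv \<sigma> n \<in> {1..4}" using permutes_in_image[OF permutes_inv[OF p]] that by simp
    then have "bform b1 b2 b3 (\<sigma> (Hilbert_Choice.inv \<sigma> n)) = bform b1 b2 b3 (Hilbert_Choice.inv \<sigma> n)" using assms by (simp add: stab_def)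
    then show ?thesis by (simp add: permutes_inverses[OF p])
  qed
  then show ?thesis using permutes_inv[OF p] by (simp add: stab_def)
qed

lemma vtx_exists:
  assumes "(i, j, k) \<in> triples" "s \<in> {1, -1}" "t \<in> {1, -1}" "r \<in> {1, -1}" "s * t * r = (1 :: 'a::field_char_0)"
  shows "\<exists>n\<in>{1..4}. vtx n i = s \<and> vtx n j = t \<and> vtx n k = r"
proof -
  note d = triples_distinct[OF assms(1)]
  have mem: "i \<in> {2, 3, 4}" "j \<in> {2, 3, 4}" "k \<in> {2, 3, 4}"
    using assms(1) unfolding triples_def by auto
  have single: "\<exists>n\<in>{1..4}. vtx n l = (1 :: 'a) \<and> (\<forall>l'\<in>{2, 3, 4}. l' \<noteq> l \<longrightarrow> vtx n l' = (- 1 :: 'a))"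
    if l: "l \<in> {2, 3, 4}" for l
  proof -
    consider "l = 2" | "l = 3" | "l = 4" using l by blast
    then show ?thesis
    proof cases
      case 1 then show ?thesis by (intro bexI[of _ 1]) (simp_all add: vtx_def)
    next
      case 2 then show ?thesis by (intro bexI[of _ 2]) (simp_all add: vtx_def)
    next
      case 3 then show ?thesis by (intro bexI[of _ 3]) (simp_all add: vtx_def)
    qed
  qed
  have r: "r = s * t"
  proof -
    have "r = (s * t) * (s * t * r)" using assms(2,3) by auto
    then show ?thesis unfolding assms(5) by simp
  qed
  consider "s = 1" "t = 1" | "s = 1" "t = - 1" | "s = - 1" "t = 1" | "s = - 1" "t = - 1"
    using assms(2,3) by blast
  then show ?thesis
  proof cases
    case 1 then show ?thesis using r by (intro bexI[of _ 4]) (simp_all add: vtx_def)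
  next
    case 2 then show ?thesis using r single[OF mem(1)] mem d by auto
  next
    case 3 then show ?thesis using r single[OF mem(2)] mem d by auto
  next
    case 4 then show ?thesis using r single[OF mem(3)] mem d by auto
  qed
qed

lemma vtx_product: "n \<in> {1..4} \<Longrightarrow> vtx n 2 * vtx n 3 * vtx n 4 = 1"
  unfolding I4 by (auto simp: vtx_def)

lemma vtx_sign: "vtx n l \<in> {1, -1}"
  by (simp add: vtx_def)

lemma vtx_inj:
  assumes "m \<in> {1..4}" "n \<in> {1..4}" "vtx m 2 = (vtx n 2 :: 'a::field_char_0)" "vtx m 3 = (vtx n 3 :: 'a)"
    "vtx m 4 = (vtx n 4 :: 'a)"
  shows "m = n"
proof (rule ccontr)
  assume "m \<noteq> n"
  then have "vtx m 2 * vtx n 2 + vtx m 3 * vtx n 3 + vtx m 4 * vtx n 4 = (- 1 :: 'a)"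
    using vtx_orthogonal[OF assms(1,2), where 'a = 'a] by simp
  moreover have "vtx n 2 * vtx n 2 + vtx n 3 * vtx n 3 + vtx n 4 * vtx n 4 = (3 :: 'a)"
    using vtx_orthogonal[OF assms(2,2), where 'a = 'a] by simp
  ultimately have "(3 :: 'a) = - 1" unfolding assms(3-5) by simp
  then have "(3 :: 'a) + 1 = 0" by simp
  then show False by simp
qed

section \<open>The automorphism group\<close>

lemma image_span_single:
  fixes g :: "'a::field ^ 'n \<Rightarrow> 'a ^ 'n"
  assumes "\<And>c x. g (c *s x) = c *s g x"
  shows "g ` vec.span {x} = vec.span {g x}"
  unfolding span_single by (simp add: image_image assms)

lemma regular_map_linear:
  fixes g :: "'a::field_char_0 ^ 'n::finite \<Rightarrow> 'a ^ 'n"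
  assumes add: "\<And>x y. g (x + y) = g x + g y" and scale: "\<And>c x. g (c *s x) = c *s g x"
    and inj: "\<And>x. x \<noteq> 0 \<Longrightarrow> g x \<noteq> 0"
    and f: "\<And>L. L \<in> hypersurface G \<Longrightarrow> f L = g ` L"
  shows "regular_map G f"
proof -
  define P :: "'n \<Rightarrow> ('n, 'a) mpoly" where
    "P i = (\<Sum>j\<in>UNIV. Poly_Mapping.single (Poly_Mapping.single j 1) (g (axis j 1) $ i))" for i
  have lin: "Vector_Spaces.linear (*s) (*s) g"
    by unfold_locales (simp_all add: add scale vec.scale_right_distrib vec.scale_left_distrib)
  have eval: "(\<chi> i. mp_eval (P i) x) = g x" for x
  proof -
    have "g x = g (\<Sum>j\<in>UNIV. x $ j *s axis j 1)" by (simp add: basis_expansion)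
    also have "\<dots> = (\<Sum>j\<in>UNIV. x $ j *s g (axis j 1))"
      by (simp add: vec.linear_sum[OF lin] scale)
    finally show ?thesis
      by (simp add: Finite_Cartesian_Product.vec_eq_iff P_def mp_eval_sum mp_eval_single mval_single mult.commute del: One_nat_def)
  qed
  have "homogeneous 1 (P i)" for i
    unfolding homogeneous_def
  proof
    fix m assume "m \<in> Poly_Mapping.keys (P i)"
    moreover have "Poly_Mapping.keys (P i) \<subseteq>
        (\<Union>j\<in>UNIV. Poly_Mapping.keys (Poly_Mapping.single (Poly_Mapping.single j 1) (g (axis j 1) $ i)))"
      unfolding P_def by (rule keys_sum)
    ultimately obtain j where "m \<in> Poly_Mapping.keys (Poly_Mapping.single (Poly_Mapping.single j 1) (g (axis j 1) $ i))"
      by blast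
    then have "m = Poly_Mapping.single j 1" by (simp split: if_splits)
    then show "(\<Sum>i\<in>UNIV. Poly_Mapping.lookup m i) = 1" by (simp add: lookup_single when_def)
  qed
  moreover have "g y \<noteq> 0 \<longrightarrow> f M = vec.span {g y}" if M: "M \<in> hypersurface G" "y \<in> M - {0}" for M y
  proof -
    obtain z where z: "M = vec.span {z}" "z \<noteq> 0"
      using M(1) unfolding hypersurface_def proj_space_iff by blast
    then obtain c where c: "y = c *s z" using M(2) by (auto simp: span_single)
    then have "c \<noteq> 0" using M(2) by auto
    then have "M = vec.span {y}" unfolding c z(1) by (simp add: span_scale_eq)
    then show ?thesis using f[OF M(1)] image_span_single[of g y] scale by simp
  qed
  ultimately show ?thesis unfolding regular_map_def
    using inj by (intro ballI exI[of _ 1] exI[of _ P]) (auto simp: eval)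
qed

locale cubic_threefold = cubic_cone a b1 b2 b3
  for a b1 b2 b3 :: "'k::{alg_closed_field, field_char_0}" +
  assumes planes: "card (planes_in (cubic a b1 b2 b3)) = 3"
begin

abbreviation G where "G \<equiv> Aut_hyp (cubic a b1 b2 b3)"
abbreviation S where "S \<equiv> stab b1 b2 b3"

definition aut :: "'k \<Rightarrow> (nat \<Rightarrow> nat) \<Rightarrow> ('k ^ 5) set \<Rightarrow> ('k ^ 5) set" where
  "aut e \<sigma> = induced (cubic a b1 b2 b3) (act e \<sigma>)"

lemma S_permutes: "\<sigma> \<in> S \<Longrightarrow> \<sigma> permutes {1..4}"
  by (simp add: stab_def)

lemma act_inv:
  assumes "\<sigma> \<in> S" "e \<in> {1, -1 :: 'k}"
  shows "act e \<sigma> (act e (Hilbert_Choice.inv \<sigma>) x) = x" "act e (Hilbert_Choice.inv \<sigma>) (act e \<sigma> x) = (x :: 'k ^ 5)"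
proof -
  note p = S_permutes[OF assms(1)]
  have "e * e = 1" using assms(2) by auto
  moreover have "\<sigma> \<circ> Hilbert_Choice.inv \<sigma> = id" "Hilbert_Choice.inv \<sigma> \<circ> \<sigma> = id" using permutes_inv_o[OF p] by auto
  ultimately show "act e \<sigma> (act e (Hilbert_Choice.inv \<sigma>) x) = x" "act e (Hilbert_Choice.inv \<sigma>) (act e \<sigma> x) = x"
    by (simp_all add: act_comp[OF p permutes_inv[OF p]] act_comp[OF permutes_inv[OF p] p] act_one)
qed

lemma act_nonzero:
  assumes "\<sigma> \<in> S" "e \<in> {1, -1 :: 'k}" "x \<noteq> 0"
  shows "act e \<sigma> x \<noteq> 0"
proof
  assume "act e \<sigma> x = 0"
  then have "act e (Hilbert_Choice.inv \<sigma>) (act e \<sigma> x) = act e (Hilbert_Choice.inv \<sigma>) (0 *s 0)" by simp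
  then show False using assms(3) unfolding act_inv[OF assms(1,2)] act_scale by simp
qed

lemma aut_span:
  assumes "x \<noteq> 0" "F x = 0"
  shows "aut e \<sigma> (vec.span {x}) = vec.span {act e \<sigma> x}"
  unfolding aut_def induced_def
  using span_in_X[OF assms] by (simp add: image_span_single[OF act_scale])

lemma aut_closed:
  assumes "\<sigma> \<in> S" "e \<in> {1, -1}" "L \<in> X"
  shows "aut e \<sigma> L \<in> X"
proof -
  obtain x where x: "x \<noteq> 0" "F x = 0" "L = vec.span {x}" using assms(3) by (auto simp: in_X_iff)
  have "F (act e \<sigma> x) = 0" using cubic_fun_act[OF assms(1,2)] x(2) by simp
  then show ?thesis unfolding x(3) aut_span[OF x(1,2)] by (rule span_in_X[OF act_nonzero[OF assms(1,2) x(1)]])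
qed

lemma aut_compose:
  assumes "\<sigma> \<in> S" "\<tau> \<in> S" "e' \<in> {1, -1}"
  shows "compose X (aut e \<sigma>) (aut e' \<tau>) = aut (e * e') (\<sigma> \<circ> \<tau>)"
proof
  fix L
  show "compose X (aut e \<sigma>) (aut e' \<tau>) L = aut (e * e') (\<sigma> \<circ> \<tau>) L"
  proof (cases "L \<in> X")
    case True
    then obtain x where x: "x \<noteq> 0" "F x = 0" "L = vec.span {x}" by (auto simp: in_X_iff)
    have "F (act e' \<tau> x) = 0" using cubic_fun_act[OF assms(2,3)] x(2) by simp
    then have "aut e \<sigma> (aut e' \<tau> L) = vec.span {act e \<sigma> (act e' \<tau> x)}"
      unfolding x(3) aut_span[OF x(1,2)] by (rule aut_span[OF act_nonzero[OF assms(2,3) x(1)]])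
    then show ?thesis using True x
      by (simp add: compose_def aut_span act_comp[OF S_permutes[OF assms(1)] S_permutes[OF assms(2)]])
  next
    case False
    then show ?thesis by (simp add: compose_def aut_def induced_def)
  qed
qed

lemma aut_id: "aut 1 id = (\<lambda>L\<in>X. L)"
proof -
  have "act 1 id = (\<lambda>x :: 'k ^ 5. x)" by (rule ext) (rule act_one)
  then show ?thesis unfolding aut_def induced_def by (simp add: restrict_def fun_eq_iff)
qed

lemma aut_inv:
  assumes "\<sigma> \<in> S" "e \<in> {1, -1}" "L \<in> X"
  shows "aut e (Hilbert_Choice.inv \<sigma>) (aut e \<sigma> L) = L" "aut e \<sigma> (aut e (Hilbert_Choice.inv \<sigma>) L) = L"
proof -
  note p = S_permutes[OF assms(1)] and i = stab_inv[OF assms(1)]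
  have e: "e * e = 1" using assms(2) by auto
  have o: "\<sigma> \<circ> Hilbert_Choice.inv \<sigma> = id" "Hilbert_Choice.inv \<sigma> \<circ> \<sigma> = id" using permutes_inv_o[OF p] by auto
  have "compose X (aut e (Hilbert_Choice.inv \<sigma>)) (aut e \<sigma>) L = L" "compose X (aut e \<sigma>) (aut e (Hilbert_Choice.inv \<sigma>)) L = L"
    using assms(3) by (simp_all add: aut_compose[OF i assms(1,2)] aut_compose[OF assms(1) i assms(2)] e o aut_id)
  then show "aut e (Hilbert_Choice.inv \<sigma>) (aut e \<sigma> L) = L" "aut e \<sigma> (aut e (Hilbert_Choice.inv \<sigma>) L) = L"
    using assms(3) by (simp_all add: compose_def)
qed

lemma aut_Bij:
  assumes "\<sigma> \<in> S" "e \<in> {1, -1}"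
  shows "aut e \<sigma> \<in> Bij X"
proof -
  have "bij_betw (aut e \<sigma>) X X"
    by (rule bij_betw_byWitness[where f' = "aut e (Hilbert_Choice.inv \<sigma>)"])
      (use aut_inv[OF assms] aut_closed[OF assms] aut_closed[OF stab_inv[OF assms(1)] assms(2)] in auto)
  then show ?thesis by (simp add: Bij_def aut_def induced_def)
qed

lemma aut_in_carrier:
  assumes "\<sigma> \<in> S" "e \<in> {1, -1}"
  shows "aut e \<sigma> \<in> carrier G"
proof -
  have "regular_map (cubic a b1 b2 b3) (aut e \<sigma>)"
    by (rule regular_map_linear[OF act_add act_scale act_nonzero[OF assms]])
      (simp_all add: aut_def induced_def)
  moreover have "regular_map (cubic a b1 b2 b3) (inv_into X (aut e \<sigma>))"
  proof (rule regular_map_linear[OF act_add act_scale act_nonzero[OF stab_inv[OF assms(1)] assms(2)]])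
    fix L assume L: "L \<in> X"
    have "inv_into X (aut e \<sigma>) L = aut e (Hilbert_Choice.inv \<sigma>) L"
    proof (rule inv_into_f_eq)
      show "inj_on (aut e \<sigma>) X" using aut_Bij[OF assms] by (auto simp: Bij_def bij_betw_def)
      show "aut e (Hilbert_Choice.inv \<sigma>) L \<in> X" by (rule aut_closed[OF stab_inv[OF assms(1)] assms(2) L])
      show "aut e \<sigma> (aut e (Hilbert_Choice.inv \<sigma>) L) = L" by (rule aut_inv[OF assms L])
    qed
    then show "inv_into X (aut e \<sigma>) L = act e (Hilbert_Choice.inv \<sigma>) ` L" using L by (simp add: aut_def induced_def)
  qed
  ultimately show ?thesis using aut_Bij[OF assms] by (simp add: Aut_hyp_def)
qed

text \<open>A signed permutation whose signs have product 1 sends sign vectors of product 1 to such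
  vectors, hence vertices to vertices. The relations between the coefficients say that this vertex
  permutation preserves the values of the linear form.\<close>

lemma automorphism_is_aut:
  assumes f: "f \<in> carrier G"
  shows "\<exists>e\<in>{1, -1}. \<exists>\<sigma>\<in>S. f = aut e \<sigma>"
proof -
  obtain i j k e2 e3 e4 e where s: "(i, j, k) \<in> triples"
    "e2 \<in> {1, -1}" "e3 \<in> {1, -1}" "e4 \<in> {1, -1}" "e \<in> {1, -1}" "e2 * e3 * e4 = 1"
    "\<beta> i = e2 * b1" "\<beta> j = e3 * b2" "\<beta> k = e4 * b3"
    and f': "\<And>x. F x = 0 \<Longrightarrow> x \<noteq> 0 \<Longrightarrow>
      f (vec.span {x}) = vec.span {pt i j k (x $ 1) (e2 * x $ 2) (e3 * x $ 3) (e4 * x $ 4) (e * x $ 5)}"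
    by (rule automorphism_signed_permutation[OF planes f]) (rule that)
  have sq: "e2 * e2 = 1" "e3 * e3 = 1" "e4 * e4 = 1" using s(2-4) by auto
  have "\<exists>m\<in>{1..4}. vtx m i = e2 * vtx n 2 \<and> vtx m j = e3 * vtx n 3 \<and> vtx m k = e4 * vtx n 4"
    if n: "n \<in> {1..4}" for n
  proof (rule vtx_exists[OF s(1)])
    show "e2 * vtx n 2 \<in> {1, -1}" "e3 * vtx n 3 \<in> {1, -1}" "e4 * vtx n 4 \<in> {1, -1}"
      using s(2-4) vtx_sign[of n 2, where 'a = 'k] vtx_sign[of n 3, where 'a = 'k] vtx_sign[of n 4, where 'a = 'k]
      by auto
    have "e2 * vtx n 2 * (e3 * vtx n 3) * (e4 * vtx n 4) = (e2 * e3 * e4) * (vtx n 2 * vtx n 3 * vtx n 4)"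
      by (simp only: mult_ac)
    then show "e2 * vtx n 2 * (e3 * vtx n 3) * (e4 * vtx n 4) = 1" by (simp only: s(6) vtx_product[OF n] mult_1)
  qed
  then obtain \<sigma>0 where \<sigma>0: "\<And>n. n \<in> {1..4} \<Longrightarrow> \<sigma>0 n \<in> {1..4}"
    "\<And>n. n \<in> {1..4} \<Longrightarrow> vtx (\<sigma>0 n) i = e2 * vtx n 2"
    "\<And>n. n \<in> {1..4} \<Longrightarrow> vtx (\<sigma>0 n) j = e3 * vtx n 3"
    "\<And>n. n \<in> {1..4} \<Longrightarrow> vtx (\<sigma>0 n) k = e4 * vtx n 4" by metis
  \<comment> \<open>Extended by the identity off the four labels, as \<open>permutes\<close>
    demands.\<close>
  define \<sigma> where "\<sigma> n = (if n \<in> {1..4} then \<sigma>0 n else n)" for n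
  have "inj_on \<sigma> {1..4}"
  proof (rule inj_onI)
    fix m n assume mn: "m \<in> {1..4}" "n \<in> {1..4}" "\<sigma> m = \<sigma> n"
    then have eq: "\<sigma>0 m = \<sigma>0 n" by (simp add: \<sigma>_def)
    have nz: "e2 \<noteq> 0" "e3 \<noteq> 0" "e4 \<noteq> 0" using s(2-4) by auto
    have "e2 * vtx m 2 = e2 * vtx n 2" "e3 * vtx m 3 = e3 * vtx n 3" "e4 * vtx m 4 = e4 * vtx n 4"
      unfolding \<sigma>0(2-4)[OF mn(1), symmetric] \<sigma>0(2-4)[OF mn(2), symmetric] eq by (rule refl)+
    then have "vtx m 2 = (vtx n 2 :: 'k)" "vtx m 3 = (vtx n 3 :: 'k)" "vtx m 4 = (vtx n 4 :: 'k)"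
      using nz by simp_all
    then show "m = n" by (rule vtx_inj[OF mn(1,2)])
  qed
  moreover have "\<sigma> ` {1..4} \<subseteq> {1..4}" using \<sigma>0(1) by (auto simp: \<sigma>_def)
  ultimately have "bij_betw \<sigma> {1..4} {1..4}"
    by (simp add: bij_betw_def endo_inj_surj)
  then have p: "\<sigma> permutes {1..4}" by (rule bij_imp_permutes) (auto simp: \<sigma>_def)
  have b: "bform b1 b2 b3 n = vtx n i * \<beta> i + vtx n j * \<beta> j + vtx n k * \<beta> k" for n
    using s(1) unfolding triples_def bform_def \<beta>_def by auto
  have "bform b1 b2 b3 (\<sigma> n) = bform b1 b2 b3 n" if n: "n \<in> {1..4}" for n
  proof -
    have "bform b1 b2 b3 (\<sigma> n) = (e2 * e2) * (vtx n 2 * b1) + (e3 * e3) * (vtx n 3 * b2) + (e4 * e4) * (vtx n 4 * b3)"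
      unfolding b[of "\<sigma> n"] s(7-9) using n by (simp add: \<sigma>_def \<sigma>0)
    then show ?thesis unfolding sq by (simp add: bform_def)
  qed
  then have \<sigma>S: "\<sigma> \<in> S" using p by (simp add: stab_def)
  have act: "act e \<sigma> x = pt i j k (x $ 1) (e2 * x $ 2) (e3 * x $ 3) (e4 * x $ 4) (e * x $ 5)" for x
  proof (rule act_eqI[OF p])
    fix n :: nat assume n: "n \<in> {1..4}"
    let ?y = "pt i j k (x $ 1) (e2 * x $ 2) (e3 * x $ 3) (e4 * x $ 4) (e * x $ 5)"
    have "vform m y = vtx m i * y $ i + vtx m j * y $ j + vtx m k * y $ k" for m and y :: "'k ^ 5"
      using s(1) unfolding triples_def vform_def by auto
    then have "vform (\<sigma> n) ?y = vtx (\<sigma> n) i * (e2 * x $ 2) + vtx (\<sigma> n) j * (e3 * x $ 3) + vtx (\<sigma> n) k * (e4 * x $ 4)"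
      by (simp add: pt_nth[OF s(1)])
    also have "\<dots> = (e2 * e2) * (vtx n 2 * x $ 2) + (e3 * e3) * (vtx n 3 * x $ 3) + (e4 * e4) * (vtx n 4 * x $ 4)"
      using n by (simp add: \<sigma>_def \<sigma>0)
    also have "\<dots> = vform n x" unfolding sq by (simp add: vform_def)
    finally show "vform (\<sigma> n) ?y = vform n x" .
  qed (simp_all add: pt_nth[OF s(1)])
  have "f L = aut e \<sigma> L" for L
  proof (cases "L \<in> X")
    case True
    then obtain x where x: "x \<noteq> 0" "F x = 0" "L = vec.span {x}" by (auto simp: in_X_iff)
    show ?thesis unfolding x(3) aut_span[OF x(1,2)] f'[OF x(2,1)] act ..
  next
    case False
    have "f \<in> extensional X" using f by (simp add: Aut_hyp_def Bij_def)
    then show ?thesis using False by (simp add: extensional_def aut_def induced_def)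
  qed
  then show ?thesis using \<sigma>S s(5) by blast
qed

text \<open>At points with x1 = 1 the scalar between the two images is 1. The sign is then read off
  at a point with x5 nonzero, and the permutation at a point whose four vertex forms are
  distinct.\<close>

lemma aut_inj:
  assumes "\<sigma> \<in> S" "\<tau> \<in> S" "aut e \<sigma> = aut e' \<tau>"
  shows "e = e' \<and> \<sigma> = \<tau>"
proof -
  have same: "act e \<sigma> x = act e' \<tau> x" if x: "F x = 0" "x $ 1 = 1" for x
  proof -
    have "x \<noteq> 0" using x(2) by auto
    then have "vec.span {act e \<sigma> x} = vec.span {act e' \<tau> x}"
      using assms(3) aut_span[OF _ x(1)] by metis
    then obtain c where c: "act e \<sigma> x = c *s act e' \<tau> x" by (rule span_eq_imp_scaled)
    have "c = 1" using arg_cong[OF c, of "\<lambda>v. v $ 1"] x(2) by (simp add: act_nth)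
    then show ?thesis using c by simp
  qed
  note nth = pt_nth[OF triple_234]
  have ex: "\<exists>w. F (pt 2 3 4 1 p q r w) = 0 \<and> w\<^sup>2 = p * q * r + a + b1 * p + b2 * q + b3 * r + p\<^sup>2 + q\<^sup>2 + r\<^sup>2" for p q r
  proof -
    define g where "g = p * q * r + a + b1 * p + b2 * q + b3 * r + p\<^sup>2 + q\<^sup>2 + r\<^sup>2"
    obtain w where "1 * w\<^sup>2 + 0 * w + (- g) = 0" using quadratic_root[of 1 0 "- g"] by auto
    then show ?thesis by (intro exI[of _ w]) (simp add: F_pt[OF triple_234] \<beta>_def g_def algebra_simps)
  qed
  have "e = e'"
  proof -
    have "\<exists>t. a + b1 * t + t\<^sup>2 \<noteq> 0"
    proof (rule ccontr)
      assume "\<not> ?thesis"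
      then have 0: "a + b1 * t + t\<^sup>2 = 0" for t by blast
      \<comment> \<open>The second difference of a monic quadratic polynomial is 2, so the
        polynomial is not identically zero.\<close>
      have "(a + b1 * 1 + 1\<^sup>2) + (a + b1 * (- 1) + (- 1)\<^sup>2) - 2 * (a + b1 * 0 + 0\<^sup>2) = 2" by simp
      then show False unfolding 0 by simp
    qed
    then obtain t where t: "a + b1 * t + t\<^sup>2 \<noteq> 0" by blast
    obtain w where w: "F (pt 2 3 4 1 t 0 0 w) = 0" "w\<^sup>2 = a + b1 * t + t\<^sup>2" using ex[of t 0 0] by auto
    have "w \<noteq> 0" using w(2) t by auto
    moreover have "e * w = e' * w"
      using arg_cong[OF same[OF w(1)], of "\<lambda>v. v $ 5"] by (simp add: nth act_nth)
    ultimately show ?thesis by simp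
  qed
  moreover have "\<sigma> n = \<tau> n" for n
  proof (cases "n \<in> {1..4}")
    case True
    \<comment> \<open>These coordinates give the vertex forms 2, 4, 6 and -12, distinct in
      characteristic 0.\<close>
    obtain w where w: "F (pt 2 3 4 1 (-5) (-4) (-3) w) = 0" using ex by blast
    define x where "x = (pt 2 3 4 1 (-5) (-4) (-3) w :: 'k ^ 5)"
    define y where "y = act e \<sigma> x"
    have y: "y = act e' \<tau> x" unfolding y_def x_def by (rule same[OF w]) (simp add: nth)
    have d: "vform 1 x = 2" "vform 2 x = 4" "vform 3 x = 6" "vform 4 x = - 12"
      by (simp_all add: vform_explicit x_def nth)
    have "(2 :: 'k) + 12 \<noteq> 0" "(4 :: 'k) + 12 \<noteq> 0" "(6 :: 'k) + 12 \<noteq> 0" by simp_all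
    then have "(2 :: 'k) \<noteq> - 12" "(4 :: 'k) \<noteq> - 12" "(6 :: 'k) \<noteq> - 12" by (metis add.left_inverse)+
    then have inj: "m = l" if "m \<in> {1..4}" "l \<in> {1..4}" "vform m x = vform l x" for m l
      using that unfolding I4 by (elim insertE) (auto simp: d dest: sym)
    have "\<sigma> n \<in> {1..4}" using permutes_in_image[OF S_permutes[OF assms(1)]] True by simp
    then obtain m where m: "m \<in> {1..4}" "\<sigma> n = \<tau> m"
      using permutes_image[OF S_permutes[OF assms(2)]] by blast
    have "vform n x = vform (\<sigma> n) y" unfolding y_def by (rule vform_act[OF S_permutes[OF assms(1)] True, symmetric])
    also have "\<dots> = vform m x" unfolding m(2) y by (rule vform_act[OF S_permutes[OF assms(2)] m(1)])
    finally have "n = m" by (rule inj[OF True m(1)])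
    then show ?thesis using m(2) by simp
  next
    case False
    then show ?thesis using S_permutes[OF assms(1)] S_permutes[OF assms(2)] by (simp add: permutes_not_in)
  qed
  ultimately show ?thesis by blast
qed

lemma mult_G:
  assumes "\<sigma> \<in> S" "\<tau> \<in> S" "e \<in> {1, -1}" "e' \<in> {1, -1}"
  shows "aut e \<sigma> \<otimes>\<^bsub>G\<^esub> aut e' \<tau> = aut (e * e') (\<sigma> \<circ> \<tau>)"
  using aut_Bij assms by (simp add: Aut_hyp_def BijGroup_def aut_compose)

lemma one_G: "\<one>\<^bsub>G\<^esub> = aut 1 id"
  by (simp add: Aut_hyp_def BijGroup_def aut_id)

text \<open>Closure and inverses are read off from the description of every automorphism by a sign
  and a permutation.\<close>

lemma group_G: "group G"
proof (rule groupI)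
  show "x \<otimes>\<^bsub>G\<^esub> y \<in> carrier G" if xy: "x \<in> carrier G" "y \<in> carrier G" for x y
  proof -
    obtain e \<sigma> e' \<tau> where "e \<in> {1, -1}" "\<sigma> \<in> S" "x = aut e \<sigma>" "e' \<in> {1, -1}" "\<tau> \<in> S" "y = aut e' \<tau>"
      using automorphism_is_aut[OF xy(1)] automorphism_is_aut[OF xy(2)] by blast
    note * = this
    have "e * e' \<in> {1, -1}" using *(1,4) by auto
    then show ?thesis unfolding *(3,6) mult_G[OF *(2,5,1,4)] by (intro aut_in_carrier stab_compose *)
  qed
  show "\<one>\<^bsub>G\<^esub> \<in> carrier G" unfolding one_G by (rule aut_in_carrier[OF stab_id]) simp
  show "x \<otimes>\<^bsub>G\<^esub> y \<otimes>\<^bsub>G\<^esub> z = x \<otimes>\<^bsub>G\<^esub> (y \<otimes>\<^bsub>G\<^esub> z)"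
    if xyz: "x \<in> carrier G" "y \<in> carrier G" "z \<in> carrier G" for x y z
  proof -
    obtain e \<sigma> e' \<tau> e'' \<rho> where *: "e \<in> {1, -1}" "\<sigma> \<in> S" "x = aut e \<sigma>" "e' \<in> {1, -1}" "\<tau> \<in> S" "y = aut e' \<tau>"
      "e'' \<in> {1, -1}" "\<rho> \<in> S" "z = aut e'' \<rho>"
      using automorphism_is_aut[OF xyz(1)] automorphism_is_aut[OF xyz(2)] automorphism_is_aut[OF xyz(3)] by blast
    have "e * e' \<in> {1, -1}" "e' * e'' \<in> {1, -1}" using * by auto
    then show ?thesis unfolding * using * by (simp add: mult_G stab_compose mult.assoc comp_assoc)
  qed
  show "\<one>\<^bsub>G\<^esub> \<otimes>\<^bsub>G\<^esub> x = x" if x: "x \<in> carrier G" for x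
  proof -
    obtain e \<sigma> where *: "e \<in> {1, -1}" "\<sigma> \<in> S" "x = aut e \<sigma>" using automorphism_is_aut[OF x] by blast
    show ?thesis unfolding one_G *(3) using mult_G[OF stab_id *(2) _ *(1), of 1] by simp
  qed
  show "\<exists>y\<in>carrier G. y \<otimes>\<^bsub>G\<^esub> x = \<one>\<^bsub>G\<^esub>" if x: "x \<in> carrier G" for x
  proof -
    obtain e \<sigma> where *: "e \<in> {1, -1}" "\<sigma> \<in> S" "x = aut e \<sigma>" using automorphism_is_aut[OF x] by blast
    have "e * e = 1" using *(1) by auto
    then have "aut e (Hilbert_Choice.inv \<sigma>) \<otimes>\<^bsub>G\<^esub> x = \<one>\<^bsub>G\<^esub>"
      unfolding *(3) mult_G[OF stab_inv[OF *(2)] *(2,1,1)] one_G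
      using permutes_inv_o[OF S_permutes[OF *(2)]] by simp
    then show ?thesis using aut_in_carrier[OF stab_inv[OF *(2)] *(1)] by blast
  qed
qed

end

section \<open>The generators as tetrahedral permutations\<close>

lemma vector_5:
  "(vector [x1, x2, x3, x4, x5] :: 'a::zero ^ 5) $ 1 = x1"
  "(vector [x1, x2, x3, x4, x5] :: 'a::zero ^ 5) $ 2 = x2"
  "(vector [x1, x2, x3, x4, x5] :: 'a::zero ^ 5) $ 3 = x3"
  "(vector [x1, x2, x3, x4, x5] :: 'a::zero ^ 5) $ 4 = x4"
  "(vector [x1, x2, x3, x4, x5] :: 'a::zero ^ 5) $ 5 = x5"
  unfolding vector_def by simp_all

abbreviation swap :: "nat \<Rightarrow> nat \<Rightarrow> nat \<Rightarrow> nat" where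
  "swap \<equiv> Transposition.transpose"

text \<open>The vertex permutation of \<open>sigma234\<close>. The two double transpositions defined
  next are those of \<open>iota34\<close> and \<open>iota24\<close>, while \<open>sigma34\<close>
  exchanges the vertices 2 and 3.\<close>

definition rot :: "nat \<Rightarrow> nat" where
  "rot n = (if n = 1 then 3 else if n = 2 then 1 else if n = 3 then 2 else n)"

definition double1 :: "nat \<Rightarrow> nat" where "double1 = swap 1 4 \<circ> swap 2 3"
definition double2 :: "nat \<Rightarrow> nat" where "double2 = swap 2 4 \<circ> swap 1 3"

lemma swap_permutes: "m \<in> {1..4} \<Longrightarrow> n \<in> {1..4} \<Longrightarrow> swap m n permutes {1..4}"
  by (rule permutes_swap_id)

lemma rot_permutes3: "rot permutes {1..3}"
proof (rule bij_imp_permutes)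
  have I3: "{1..3::nat} = {1, 2, 3}" by auto
  show "bij_betw rot {1..3} {1..3}"
    unfolding I3 bij_betw_def by (auto simp: inj_on_def rot_def)
qed (auto simp: rot_def)

lemma rot_permutes: "rot permutes {1..4}"
  by (rule permutes_subset[OF rot_permutes3]) auto

lemma double_permutes: "double1 permutes {1..4}" "double2 permutes {1..4}"
  unfolding double1_def double2_def by (intro permutes_compose swap_permutes; simp)+

lemma double_values:
  "double1 1 = 4" "double1 2 = 3" "double1 3 = 2" "double1 4 = 1"
  "double2 1 = 3" "double2 2 = 4" "double2 3 = 1" "double2 4 = 2"
  by (simp_all add: double1_def double2_def Transposition.transpose_def)

lemma I4_cases:
  assumes "n \<in> {1..4::nat}"
  obtains "n = 1" | "n = 2" | "n = 3" | "n = 4"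
  using assms unfolding I4 by blast

lemma iota5_act: "iota5 = (act (- 1) id :: 'a::field_char_0 ^ 5 \<Rightarrow> 'a ^ 5)"
proof (rule ext, rule sym, rule act_eqI[OF permutes_id])
  fix x :: "'a ^ 5" and n :: nat
  show "vform (id n) (iota5 x) = vform n x" by (simp add: vform_def iota5_def vector_5)
qed (simp_all add: iota5_def vector_5)

lemma sigma34_act: "sigma34 = (act 1 (swap 2 3) :: 'a::field_char_0 ^ 5 \<Rightarrow> 'a ^ 5)"
proof (rule ext, rule sym, rule act_eqI)
  fix x :: "'a ^ 5" and n :: nat assume "n \<in> {1..4}"
  then show "vform (swap 2 3 n) (sigma34 x) = vform n x"
    by (cases rule: I4_cases) (simp_all add: Transposition.transpose_def vform_explicit sigma34_def vector_5)
qed (simp_all add: swap_permutes sigma34_def vector_5)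

lemma sigma234_act: "sigma234 = (act 1 rot :: 'a::field_char_0 ^ 5 \<Rightarrow> 'a ^ 5)"
proof (rule ext, rule sym, rule act_eqI[OF rot_permutes])
  fix x :: "'a ^ 5" and n :: nat assume "n \<in> {1..4}"
  then show "vform (rot n) (sigma234 x) = vform n x"
    by (cases rule: I4_cases) (simp_all add: rot_def vform_explicit sigma234_def vector_5)
qed (simp_all add: sigma234_def vector_5)

lemma iota34_act: "iota34 = (act 1 double1 :: 'a::field_char_0 ^ 5 \<Rightarrow> 'a ^ 5)"
proof (rule ext, rule sym, rule act_eqI[OF double_permutes(1)])
  fix x :: "'a ^ 5" and n :: nat assume "n \<in> {1..4}"
  then show "vform (double1 n) (iota34 x) = vform n x"
    by (cases rule: I4_cases)
      (simp_all add: double1_def Transposition.transpose_def vform_explicit iota34_def vector_5)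
qed (simp_all add: iota34_def vector_5)

lemma iota24_act: "iota24 = (act 1 double2 :: 'a::field_char_0 ^ 5 \<Rightarrow> 'a ^ 5)"
proof (rule ext, rule sym, rule act_eqI[OF double_permutes(2)])
  fix x :: "'a ^ 5" and n :: nat assume "n \<in> {1..4}"
  then show "vform (double2 n) (iota24 x) = vform n x"
    by (cases rule: I4_cases)
      (simp_all add: double2_def Transposition.transpose_def vform_explicit iota24_def vector_5)
qed (simp_all add: iota24_def vector_5)

lemma permutes4_eqI:
  assumes "\<sigma> permutes {1..4::nat}" "\<tau> permutes {1..4}" "\<sigma> 1 = \<tau> 1" "\<sigma> 2 = \<tau> 2" "\<sigma> 3 = \<tau> 3" "\<sigma> 4 = \<tau> 4"
  shows "\<sigma> = \<tau>"
proof
  fix n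
  show "\<sigma> n = \<tau> n"
  proof (cases "n \<in> {1..4}")
    case True then show ?thesis using assms(3-6) by (cases rule: I4_cases) simp_all
  next
    case False then show ?thesis using assms(1,2) by (simp add: permutes_not_in)
  qed
qed

text \<open>The six permutations written as words in the two generators, for the proof of
  generation.\<close>

lemma permutes3_cases:
  assumes "\<sigma> permutes {1..3::nat}"
  shows "\<sigma> \<in> {id, swap 2 3, rot, rot \<circ> rot, swap 2 3 \<circ> rot, rot \<circ> swap 2 3}"
proof -
  have p: "\<sigma> permutes {1..4}" by (rule permutes_subset[OF assms]) auto
  have I3: "{1..3::nat} = {1, 2, 3}" by auto
  have m: "\<sigma> 1 \<in> {1, 2, 3}" "\<sigma> 2 \<in> {1, 2, 3}" "\<sigma> 3 \<in> {1, 2, 3}"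
    using permutes_in_image[OF assms] unfolding I3 by blast+
  have "inj \<sigma>" by (rule permutes_inj[OF p])
  then have d: "\<sigma> 1 \<noteq> \<sigma> 2" "\<sigma> 1 \<noteq> \<sigma> 3" "\<sigma> 2 \<noteq> \<sigma> 3" by (simp_all add: inj_eq)
  have fix4: "\<sigma> 4 = 4" using assms by (rule permutes_not_in) simp
  note q = permutes_id swap_permutes[of 2 3] rot_permutes permutes_compose[OF rot_permutes rot_permutes]
    permutes_compose[OF rot_permutes swap_permutes[of 2 3]] permutes_compose[OF swap_permutes[of 2 3] rot_permutes]
  consider "\<sigma> 1 = 1" "\<sigma> 2 = 2" "\<sigma> 3 = 3" | "\<sigma> 1 = 1" "\<sigma> 2 = 3" "\<sigma> 3 = 2" | "\<sigma> 1 = 3" "\<sigma> 2 = 1" "\<sigma> 3 = 2"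
    | "\<sigma> 1 = 2" "\<sigma> 2 = 3" "\<sigma> 3 = 1" | "\<sigma> 1 = 2" "\<sigma> 2 = 1" "\<sigma> 3 = 3" | "\<sigma> 1 = 3" "\<sigma> 2 = 2" "\<sigma> 3 = 1"
    using m d by (elim insertE emptyE) simp_all
  then show ?thesis
  proof cases
    case 1
    have "\<sigma> = id" by (rule permutes4_eqI[OF p q(1)]) (simp_all add: 1 fix4)
    then show ?thesis by simp
  next
    case 2
    have "\<sigma> = swap 2 3" by (rule permutes4_eqI[OF p q(2)]) (simp_all add: 2 fix4 Transposition.transpose_def)
    then show ?thesis by simp
  next
    case 3
    have "\<sigma> = rot" by (rule permutes4_eqI[OF p q(3)]) (simp_all add: 3 fix4 rot_def)
    then show ?thesis by simp
  next
    case 4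
    have "\<sigma> = rot \<circ> rot" by (rule permutes4_eqI[OF p q(4)]) (simp_all add: 4 fix4 rot_def)
    then show ?thesis by simp
  next
    case 5
    have "\<sigma> = swap 2 3 \<circ> rot"
      by (rule permutes4_eqI[OF p q(5)]) (simp_all add: 5 fix4 rot_def Transposition.transpose_def)
    then show ?thesis by simp
  next
    case 6
    have "\<sigma> = rot \<circ> swap 2 3"
      by (rule permutes4_eqI[OF p q(6)]) (simp_all add: 6 fix4 rot_def Transposition.transpose_def)
    then show ?thesis by simp
  qed
qed

text \<open>The Klein four-group is simply transitive on the vertices: one of its involutions brings
  \<open>\<sigma> 4\<close> back to 4, and what remains permutes 1, 2, 3.\<close>

lemma permutes4_factor:
  assumes p: "\<sigma> permutes {1..4::nat}"
  obtains \<kappa> \<tau> where "\<kappa> \<in> {id, double1, double2, double1 \<circ> double2}" "\<tau> permutes {1..3}" "\<sigma> = \<kappa> \<circ> \<tau>"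
proof -
  have d12: "double1 \<circ> double2 permutes {1..4}" by (intro permutes_compose double_permutes)
  have "\<sigma> 4 \<in> {1..4}" using permutes_in_image[OF p] by simp
  then have "\<exists>\<kappa>\<in>{id, double1, double2, double1 \<circ> double2}. \<kappa> permutes {1..4} \<and> \<kappa> (\<sigma> 4) = 4 \<and> \<kappa> \<circ> \<kappa> = id"
  proof (cases rule: I4_cases)
    case 1
    have "double1 \<circ> double1 = id"
      by (rule permutes4_eqI[OF permutes_compose[OF double_permutes(1,1)] permutes_id]) (simp_all add: double_values)
    moreover have "double1 (\<sigma> 4) = 4" by (simp only: 1 double_values)
    ultimately show ?thesis using double_permutes(1) by blast
  next
    case 2
    have "double2 \<circ> double2 = id"
      by (rule permutes4_eqI[OF permutes_compose[OF double_permutes(2,2)] permutes_id]) (simp_all add: double_values)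
    moreover have "double2 (\<sigma> 4) = 4" by (simp only: 2 double_values)
    ultimately show ?thesis using double_permutes(2) by blast
  next
    case 3
    have "(double1 \<circ> double2) \<circ> (double1 \<circ> double2) = id"
      by (rule permutes4_eqI[OF permutes_compose[OF d12 d12] permutes_id]) (simp_all add: double_values)
    moreover have "(double1 \<circ> double2) (\<sigma> 4) = 4" by (simp only: 3 comp_apply double_values)
    ultimately show ?thesis using d12 by blast
  next
    case 4
    moreover have "id \<circ> id = (id :: nat \<Rightarrow> nat)" by simp
    ultimately show ?thesis using permutes_id[of "{1..4}"] by (metis id_apply insertI1)
  qed
  then obtain \<kappa> where \<kappa>: "\<kappa> \<in> {id, double1, double2, double1 \<circ> double2}" "\<kappa> permutes {1..4}"
    "\<kappa> (\<sigma> 4) = 4" "\<kappa> \<circ> \<kappa> = id" by blast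
  have "\<kappa> \<circ> \<sigma> permutes {1..3}"
  proof (rule permutes_superset[OF permutes_compose[OF p \<kappa>(2)]])
    fix n assume "n \<in> {1..4} - {1..3::nat}"
    then have "n = 4" by auto
    then show "(\<kappa> \<circ> \<sigma>) n = n" using \<kappa>(3) by simp
  qed
  moreover have "\<sigma> = \<kappa> \<circ> (\<kappa> \<circ> \<sigma>)" unfolding comp_assoc[symmetric] \<kappa>(4) by simp
  ultimately show ?thesis using \<kappa>(1) that by blast
qed

section \<open>The four types\<close>

definition sgn2 :: "int \<Rightarrow> 'a::field_char_0" where
  "sgn2 z = (if z = 0 then 1 else - 1)"

lemma C2_carrier: "carrier (integer_mod_group 2) = {0, 1}"
  by (auto simp: carrier_integer_mod_group)

context cubic_threefold
begin

text \<open>The sign of x5 contributes the factor of order 2 and commutes with the vertex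
  permutations, so only the stabiliser has to be identified with \<open>K\<close>.\<close>

lemma G_iso:
  assumes K: "group K" and bij: "bij_betw \<theta> (carrier K) S"
    and hom: "\<And>x y. x \<in> carrier K \<Longrightarrow> y \<in> carrier K \<Longrightarrow> \<theta> (x \<otimes>\<^bsub>K\<^esub> y) = \<theta> x \<circ> \<theta> y"
  shows "G \<cong> integer_mod_group 2 \<times>\<times> K"
proof -
  define h where "h = (\<lambda>(z, x). aut (sgn2 z) (\<theta> x))"
  have sg: "sgn2 z \<in> {1, -1 :: 'k}" for z by (simp add: sgn2_def)
  have \<theta>S: "\<theta> x \<in> S" if "x \<in> carrier K" for x using bij that by (rule bij_betw_apply)
  have "h \<in> hom (integer_mod_group 2 \<times>\<times> K) G"
  proof (rule homI)
    fix x assume "x \<in> carrier (integer_mod_group 2 \<times>\<times> K)"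
    then show "h x \<in> carrier G" using aut_in_carrier[OF \<theta>S sg] by (auto simp: h_def)
  next
    fix x y assume "x \<in> carrier (integer_mod_group 2 \<times>\<times> K)" "y \<in> carrier (integer_mod_group 2 \<times>\<times> K)"
    then obtain z u w v where xy: "x = (z, u)" "y = (w, v)" "z \<in> {0, 1}" "w \<in> {0, 1}" "u \<in> carrier K" "v \<in> carrier K"
      by (auto simp: C2_carrier)
    have "sgn2 ((z + w) mod 2) = sgn2 z * (sgn2 w :: 'k)" using xy(3,4) by (auto simp: sgn2_def)
    then show "h (x \<otimes>\<^bsub>integer_mod_group 2 \<times>\<times> K\<^esub> y) = h x \<otimes>\<^bsub>G\<^esub> h y"
      using mult_G[OF \<theta>S[OF xy(5)] \<theta>S[OF xy(6)] sg sg, of z w] hom[OF xy(5,6)] by (simp add: xy(1,2) h_def)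
  qed
  moreover have "bij_betw h (carrier (integer_mod_group 2 \<times>\<times> K)) (carrier G)"
    unfolding bij_betw_def
  proof
    show "inj_on h (carrier (integer_mod_group 2 \<times>\<times> K))"
    proof (rule inj_onI)
      fix x y assume "x \<in> carrier (integer_mod_group 2 \<times>\<times> K)" "y \<in> carrier (integer_mod_group 2 \<times>\<times> K)" "h x = h y"
      then obtain z u w v where xy: "x = (z, u)" "y = (w, v)" "z \<in> {0, 1}" "w \<in> {0, 1}" "u \<in> carrier K" "v \<in> carrier K"
        and eq: "aut (sgn2 z) (\<theta> u) = aut (sgn2 w) (\<theta> v)"
        by (auto simp: C2_carrier h_def)
      have "sgn2 z = (sgn2 w :: 'k)" "\<theta> u = \<theta> v" using aut_inj[OF \<theta>S[OF xy(5)] \<theta>S[OF xy(6)] eq] by simp_all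
      then have "z = w" "u = v"
        using xy bij by (auto simp: sgn2_def bij_betw_def inj_on_def split: if_splits)
      then show "x = y" by (simp add: xy)
    qed
    show "h ` carrier (integer_mod_group 2 \<times>\<times> K) = carrier G"
    proof
      show "h ` carrier (integer_mod_group 2 \<times>\<times> K) \<subseteq> carrier G"
        using aut_in_carrier[OF \<theta>S sg] by (auto simp: h_def)
      show "carrier G \<subseteq> h ` carrier (integer_mod_group 2 \<times>\<times> K)"
      proof
        fix f assume "f \<in> carrier G"
        then obtain e \<sigma> where f: "e \<in> {1, -1}" "\<sigma> \<in> S" "f = aut e \<sigma>" using automorphism_is_aut by blast
        obtain x where x: "x \<in> carrier K" "\<sigma> = \<theta> x" using bij f(2) by (auto simp: bij_betw_def)
        have "\<exists>z\<in>{0, 1}. e = sgn2 z" using f(1) by (auto simp: sgn2_def)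
        then obtain z where "z \<in> {0, 1}" "e = sgn2 z" by blast
        then show "f \<in> h ` carrier (integer_mod_group 2 \<times>\<times> K)"
          using x f(3) by (intro image_eqI[of _ _ "(z, x)"]) (simp_all add: h_def C2_carrier)
      qed
    qed
  qed
  ultimately have "h \<in> iso (integer_mod_group 2 \<times>\<times> K) G" by (simp add: iso_def)
  then have "integer_mod_group 2 \<times>\<times> K \<cong> G" by (rule is_isoI)
  then show ?thesis
    by (rule group.iso_sym[OF DirProd_group[OF group_integer_mod_group K]])
qed

text \<open>Every automorphism is one with trivial sign, possibly composed with
  \<open>iota5\<close>.\<close>

lemma generatedI:
  assumes mem: "induced (cubic a b1 b2 b3) ` gs \<subseteq> carrier G" and iota5: "iota5 \<in> gs"
    and gen: "\<And>\<sigma>. \<sigma> \<in> S \<Longrightarrow> aut 1 \<sigma> \<in> generate G (induced (cubic a b1 b2 b3) ` gs)"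
  shows "Aut_generated_by (cubic a b1 b2 b3) gs"
proof -
  let ?I = "induced (cubic a b1 b2 b3) ` gs"
  have "generate G ?I \<subseteq> carrier G" by (rule group.generate_incl[OF group_G mem])
  moreover have "carrier G \<subseteq> generate G ?I"
  proof
    fix f assume "f \<in> carrier G"
    then obtain e \<sigma> where f: "e \<in> {1, -1}" "\<sigma> \<in> S" "f = aut e \<sigma>" using automorphism_is_aut by blast
    have "aut (- 1) id \<in> generate G ?I"
      unfolding aut_def iota5_act[symmetric] by (rule generate.incl) (use iota5 in blast)
    moreover have "aut 1 id \<in> generate G ?I" by (rule gen[OF stab_id])
    ultimately have "aut e id \<in> generate G ?I" using f(1) by auto
    then have "aut e id \<otimes>\<^bsub>G\<^esub> aut 1 \<sigma> \<in> generate G ?I" by (rule generate.eng[OF _ gen[OF f(2)]])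
    then show "f \<in> generate G ?I" using mult_G[OF stab_id f(2,1), of 1] by (simp add: f(3))
  qed
  ultimately show ?thesis using mem unfolding Aut_generated_by_def by blast
qed

lemma generate_comp:
  assumes "aut 1 \<sigma> \<in> generate G H" "aut 1 \<tau> \<in> generate G H" "\<sigma> \<in> S" "\<tau> \<in> S"
  shows "aut 1 (\<sigma> \<circ> \<tau>) \<in> generate G H"
  using generate.eng[OF assms(1,2)] mult_G[OF assms(3,4), of 1 1] by simp

lemma generate_id: "aut 1 id \<in> generate G H"
  using generate.one[of G H] by (simp add: one_G)

section \<open>The stabiliser in each of the four cases\<close>

lemma bform_values:
  "bform b1 b2 b3 1 = b1 - b2 - b3" "bform b1 b2 b3 2 = - b1 + b2 - b3"
  "bform b1 b2 b3 3 = - b1 - b2 + b3" "bform b1 b2 b3 4 = b1 + b2 + b3"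
  by (simp_all add: bform_def vtx_def)

lemma stabI:
  assumes "\<sigma> permutes {1..4}" "bform b1 b2 b3 (\<sigma> 1) = bform b1 b2 b3 1" "bform b1 b2 b3 (\<sigma> 2) = bform b1 b2 b3 2"
    "bform b1 b2 b3 (\<sigma> 3) = bform b1 b2 b3 3" "bform b1 b2 b3 (\<sigma> 4) = bform b1 b2 b3 4"
  shows "\<sigma> \<in> S"
  using assms unfolding stab_def I4 by simp

lemma stabD:
  assumes "\<sigma> \<in> S" "n \<in> {1..4}"
  shows "\<sigma> n \<in> {1, 2, 3, 4}" "bform b1 b2 b3 (\<sigma> n) = bform b1 b2 b3 n"
proof -
  show "\<sigma> n \<in> {1, 2, 3, 4}" using assms(2) permutes_in_image[OF S_permutes[OF assms(1)], of n] unfolding I4 by simp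
  show "bform b1 b2 b3 (\<sigma> n) = bform b1 b2 b3 n" using assms unfolding stab_def by blast
qed

lemma S_neq: "\<sigma> \<in> S \<Longrightarrow> m \<noteq> n \<Longrightarrow> \<sigma> m \<noteq> \<sigma> n"
  using permutes_inj[OF S_permutes] by (simp add: inj_eq)

text \<open>The vertices 2 and 3 share the value \<open>- b1\<close>, and the values at 1 and 4
  differ from it and from each other. For \<open>b1 = - b2\<close> vertex 4 would join 2 and 3; that
  cubic is of the third type after two sign changes and is therefore excluded.\<close>

lemma type1I:
  assumes "b1 \<noteq> b2" "b1 \<noteq> - b2" "b2 = b3" "b2 \<noteq> 0"
  shows "type1 a b1 b2 b3"
proof -
  have v: "bform b1 b2 b3 1 = b1 - 2 * b2" "bform b1 b2 b3 2 = - b1" "bform b1 b2 b3 3 = - b1"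
    "bform b1 b2 b3 4 = b1 + 2 * b2"
    using bform_values by (simp_all add: assms(3))
  have "b1 - b2 \<noteq> 0" "b1 + b2 \<noteq> 0" using assms(1,2) by (simp_all add: eq_neg_iff_add_eq_0)
  then have "2 * (b1 - b2) \<noteq> 0" "2 * (b1 + b2) \<noteq> 0" "4 * b2 \<noteq> 0"
    using assms(4) by (simp_all only: mult_eq_0_iff simp_thms rel_simps)
  then have ne: "b1 - 2 * b2 \<noteq> - b1" "b1 + 2 * b2 \<noteq> - b1" "b1 + 2 * b2 \<noteq> b1 - 2 * b2"
    by (simp_all add: eq_diff_eq diff_eq_eq eq_neg_iff_add_eq_0 algebra_simps)
  have sw: "swap 2 3 \<in> S"
    by (rule stabI) (simp_all add: swap_permutes Transposition.transpose_def v)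
  have "\<sigma> = id \<or> \<sigma> = swap 2 3" if \<sigma>: "\<sigma> \<in> S" for \<sigma>
  proof -
    have 1: "\<sigma> 1 = 1" using stabD[OF \<sigma>, of 1] ne by (auto simp: v)
    have 4: "\<sigma> 4 = 4" using stabD[OF \<sigma>, of 4] ne by (auto simp: v)
    have "\<sigma> 2 \<in> {2, 3}" "\<sigma> 3 \<in> {2, 3}"
      using stabD(1)[OF \<sigma>, of 2] stabD(1)[OF \<sigma>, of 3] S_neq[OF \<sigma>, of 2 1] S_neq[OF \<sigma>, of 2 4]
        S_neq[OF \<sigma>, of 3 1] S_neq[OF \<sigma>, of 3 4] 1 4 by auto
    moreover have "\<sigma> 2 \<noteq> \<sigma> 3" by (rule S_neq[OF \<sigma>]) simp
    ultimately have "\<sigma> 2 = 2 \<and> \<sigma> 3 = 3 \<or> \<sigma> 2 = 3 \<and> \<sigma> 3 = 2" by auto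
    then show ?thesis
    proof
      assume "\<sigma> 2 = 2 \<and> \<sigma> 3 = 3"
      then have "\<sigma> = id" using 1 4 by (intro permutes4_eqI[OF S_permutes[OF \<sigma>] permutes_id]) simp_all
      then show ?thesis ..
    next
      assume "\<sigma> 2 = 3 \<and> \<sigma> 3 = 2"
      then have "\<sigma> = swap 2 3" using 1 4
        by (intro permutes4_eqI[OF S_permutes[OF \<sigma>] S_permutes[OF sw]]) (simp_all add: Transposition.transpose_def)
      then show ?thesis ..
    qed
  qed
  then have S: "S = {id, swap 2 3}" using stab_id sw by blast
  have ne': "id \<noteq> swap 2 3" by (metis id_apply n_not_Suc_n numeral_3_eq_3 numeral_2_eq_2 transpose_apply_first)
  define \<theta> where "\<theta> z = (if z = 0 then id else swap 2 3)" for z :: int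
  have "G \<cong> integer_mod_group 2 \<times>\<times> integer_mod_group 2"
  proof (rule G_iso[of _ \<theta>])
    show "bij_betw \<theta> (carrier (integer_mod_group 2)) S"
      unfolding S C2_carrier bij_betw_def using ne' by (auto simp: \<theta>_def inj_on_def)
    show "\<theta> (x \<otimes>\<^bsub>integer_mod_group 2\<^esub> y) = \<theta> x \<circ> \<theta> y"
      if "x \<in> carrier (integer_mod_group 2)" "y \<in> carrier (integer_mod_group 2)" for x y
      using that unfolding C2_carrier by (auto simp: \<theta>_def)
  qed simp
  moreover have "Aut_generated_by (cubic a b1 b2 b3) {iota5, sigma34}"
  proof (rule generatedI)
    show "induced (cubic a b1 b2 b3) ` {iota5, sigma34} \<subseteq> carrier G"
      using aut_in_carrier[OF stab_id, of "- 1"] aut_in_carrier[OF sw, of 1]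
      by (simp add: iota5_act sigma34_act aut_def)
    fix \<sigma> assume "\<sigma> \<in> S"
    moreover have "aut 1 (swap 2 3) \<in> generate G (induced (cubic a b1 b2 b3) ` {iota5, sigma34})"
      unfolding aut_def sigma34_act[symmetric] by (rule generate.incl) blast
    ultimately show "aut 1 \<sigma> \<in> generate G (induced (cubic a b1 b2 b3) ` {iota5, sigma34})"
      unfolding S using generate_id by blast
  qed simp
  ultimately show ?thesis using assms unfolding type1_def by blast
qed

text \<open>The values coincide on the pairs 1, 4 and 2, 3, so the stabiliser is generated by the
  two disjoint transpositions. \<open>iota34\<close> is their product, and together with
  \<open>sigma34\<close> it gives the transposition of 1 and 4.\<close>

lemma type2I:
  assumes "b1 \<noteq> 0" "b2 = 0" "b3 = 0"
  shows "type2 a b1 b2 b3"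
proof -
  have v: "bform b1 b2 b3 1 = b1" "bform b1 b2 b3 2 = - b1" "bform b1 b2 b3 3 = - b1" "bform b1 b2 b3 4 = b1"
    using bform_values by (simp_all add: assms(2,3))
  have ne: "b1 \<noteq> - b1"
  proof
    assume "b1 = - b1"
    then have "2 * b1 = 0" by (simp add: eq_neg_iff_add_eq_0)
    then show False using assms(1) by simp
  qed
  have p: "swap 2 3 permutes {1..4}" "swap 1 4 permutes {1..4}" by (simp_all add: swap_permutes)
  have sw: "swap 2 3 \<in> S" "swap 1 4 \<in> S"
    by (rule stabI; simp add: p Transposition.transpose_def v)+
  have d1: "double1 \<in> S" unfolding double1_def by (rule stab_compose[OF sw(2,1)])
  have S: "S = {id, swap 2 3, swap 1 4, swap 1 4 \<circ> swap 2 3}"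
  proof
    show "S \<subseteq> {id, swap 2 3, swap 1 4, swap 1 4 \<circ> swap 2 3}"
    proof
      fix \<sigma> assume \<sigma>: "\<sigma> \<in> S"
      note q = S_permutes[OF \<sigma>]
      have m: "\<sigma> 1 \<in> {1, 4}" "\<sigma> 4 \<in> {1, 4}" "\<sigma> 2 \<in> {2, 3}" "\<sigma> 3 \<in> {2, 3}"
        using stabD[OF \<sigma>, of 1] stabD[OF \<sigma>, of 2] stabD[OF \<sigma>, of 3] stabD[OF \<sigma>, of 4] ne ne[symmetric]
        by (auto simp: v)
      have d: "\<sigma> 1 \<noteq> \<sigma> 4" "\<sigma> 2 \<noteq> \<sigma> 3" using S_neq[OF \<sigma>] by simp_all
      consider "\<sigma> 1 = 1" "\<sigma> 4 = 4" "\<sigma> 2 = 2" "\<sigma> 3 = 3" | "\<sigma> 1 = 1" "\<sigma> 4 = 4" "\<sigma> 2 = 3" "\<sigma> 3 = 2"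
        | "\<sigma> 1 = 4" "\<sigma> 4 = 1" "\<sigma> 2 = 2" "\<sigma> 3 = 3" | "\<sigma> 1 = 4" "\<sigma> 4 = 1" "\<sigma> 2 = 3" "\<sigma> 3 = 2"
        using m d by (elim insertE emptyE) simp_all
      then show "\<sigma> \<in> {id, swap 2 3, swap 1 4, swap 1 4 \<circ> swap 2 3}"
      proof cases
        case 1
        then have "\<sigma> = id" by (intro permutes4_eqI[OF q permutes_id]) simp_all
        then show ?thesis by simp
      next
        case 2
        then have "\<sigma> = swap 2 3" by (intro permutes4_eqI[OF q p(1)]) (simp_all add: Transposition.transpose_def)
        then show ?thesis by simp
      next
        case 3
        then have "\<sigma> = swap 1 4" by (intro permutes4_eqI[OF q p(2)]) (simp_all add: Transposition.transpose_def)
        then show ?thesis by simp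
      next
        case 4
        then have "\<sigma> = swap 1 4 \<circ> swap 2 3"
          by (intro permutes4_eqI[OF q permutes_compose[OF p]]) (simp_all add: Transposition.transpose_def)
        then show ?thesis by simp
      qed
    qed
    show "{id, swap 2 3, swap 1 4, swap 1 4 \<circ> swap 2 3} \<subseteq> S"
      using stab_id sw stab_compose[OF sw(2,1)] by blast
  qed
  define \<theta> where "\<theta> = (\<lambda>(z :: int, w :: int). (if z = 0 then id else swap 1 4) \<circ> (if w = 0 then id else swap 2 3))"
  have comm: "swap 2 3 \<circ> swap 1 4 = swap 1 4 \<circ> (swap 2 3 :: nat \<Rightarrow> nat)"
    by (simp add: fun_eq_iff Transposition.transpose_def)
  have invol: "swap 2 3 (swap 2 3 n) = n" "swap 1 4 (swap 1 4 n) = n" "swap 2 3 (swap 1 4 n) = swap 1 4 (swap 2 3 n)" for n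
    using fun_cong[OF comm, of n] by simp_all
  have at: "\<theta> (z, w) 1 = (if z = 0 then 1 else 4)" "\<theta> (z, w) 2 = (if w = 0 then 2 else 3)" for z w
    by (simp_all add: \<theta>_def Transposition.transpose_def)
  have "G \<cong> integer_mod_group 2 \<times>\<times> integer_mod_group 2 \<times>\<times> integer_mod_group 2"
  proof (rule G_iso[of _ \<theta>])
    show "group (integer_mod_group 2 \<times>\<times> integer_mod_group 2)"
      by (intro DirProd_group group_integer_mod_group)
    show "bij_betw \<theta> (carrier (integer_mod_group 2 \<times>\<times> integer_mod_group 2)) S"
      unfolding bij_betw_def
    proof
      show "inj_on \<theta> (carrier (integer_mod_group 2 \<times>\<times> integer_mod_group 2))"
      proof (rule inj_onI)
        fix x y assume xy: "x \<in> carrier (integer_mod_group 2 \<times>\<times> integer_mod_group 2)"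
          "y \<in> carrier (integer_mod_group 2 \<times>\<times> integer_mod_group 2)" "\<theta> x = \<theta> y"
        then have "\<theta> x 1 = \<theta> y 1" "\<theta> x 2 = \<theta> y 2" by simp_all
        then show "x = y" using xy(1,2) unfolding carrier_DirProd C2_carrier
          by (cases x; cases y) (auto simp: at split: if_splits)
      qed
      show "\<theta> ` carrier (integer_mod_group 2 \<times>\<times> integer_mod_group 2) = S"
        unfolding carrier_DirProd C2_carrier S by (auto simp: \<theta>_def)
    qed
    show "\<theta> (x \<otimes>\<^bsub>integer_mod_group 2 \<times>\<times> integer_mod_group 2\<^esub> y) = \<theta> x \<circ> \<theta> y"
      if "x \<in> carrier (integer_mod_group 2 \<times>\<times> integer_mod_group 2)"
        "y \<in> carrier (integer_mod_group 2 \<times>\<times> integer_mod_group 2)" for x y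
      using that unfolding carrier_DirProd C2_carrier by (auto simp: \<theta>_def fun_eq_iff invol)
  qed
  moreover have "Aut_generated_by (cubic a b1 b2 b3) {iota5, sigma34, iota34}"
  proof (rule generatedI)
    let ?H = "induced (cubic a b1 b2 b3) ` {iota5, sigma34, iota34}"
    show "?H \<subseteq> carrier G"
      using aut_in_carrier[OF stab_id, of "- 1"] aut_in_carrier[OF sw(1), of 1] aut_in_carrier[OF d1, of 1]
      by (simp add: iota5_act sigma34_act iota34_act aut_def)
    have 1: "aut 1 (swap 2 3) \<in> generate G ?H"
      unfolding aut_def sigma34_act[symmetric] by (rule generate.incl) blast
    have 2: "aut 1 double1 \<in> generate G ?H"
      unfolding aut_def iota34_act[symmetric] by (rule generate.incl) blast
    have "double1 \<circ> swap 2 3 = swap 1 4" by (simp add: double1_def fun_eq_iff invol)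
    then have 3: "aut 1 (swap 1 4) \<in> generate G ?H" using generate_comp[OF 2 1 d1 sw(1)] by simp
    fix \<sigma> assume "\<sigma> \<in> S"
    then show "aut 1 \<sigma> \<in> generate G ?H"
      using generate_id 1 2 3 unfolding S double1_def by blast
  qed simp
  ultimately show ?thesis using assms unfolding type2_def by blast
qed

lemma generate_permutes3:
  assumes "\<sigma> permutes {1..3}" "swap 2 3 \<in> S" "rot \<in> S"
    and "aut 1 (swap 2 3) \<in> generate G H" "aut 1 rot \<in> generate G H"
  shows "aut 1 \<sigma> \<in> generate G H"
  using permutes3_cases[OF assms(1)] generate_id[of H] assms(4,5)
    generate_comp[OF assms(5,5,3,3)] generate_comp[OF assms(4,5,2,3)] generate_comp[OF assms(5,4,3,2)]
  by blast

text \<open>Vertex 4 has the value \<open>3 * b3\<close> and the others have \<open>- b3\<close>, so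
  the stabiliser consists of all permutations of 1, 2, 3.\<close>

lemma type3I:
  assumes "b1 = b2" "b2 = b3" "b3 \<noteq> 0"
  shows "type3 a b1 b2 b3"
proof -
  have v: "bform b1 b2 b3 1 = - b3" "bform b1 b2 b3 2 = - b3" "bform b1 b2 b3 3 = - b3" "bform b1 b2 b3 4 = 3 * b3"
    using bform_values by (simp_all add: assms(1,2))
  have ne: "- b3 \<noteq> 3 * b3"
  proof
    assume "- b3 = 3 * b3"
    then have "4 * b3 = 0" by (simp add: neg_eq_iff_add_eq_0)
    then show False using assms(3) by simp
  qed
  have S: "S = {\<sigma>. \<sigma> permutes {1..3}}"
  proof
    show "S \<subseteq> {\<sigma>. \<sigma> permutes {1..3}}"
    proof
      fix \<sigma> assume \<sigma>: "\<sigma> \<in> S"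
      have 4: "\<sigma> 4 = 4" using stabD[OF \<sigma>, of 4] ne by (auto simp: v)
      have "\<sigma> permutes {1..3}"
      proof (rule permutes_superset[OF S_permutes[OF \<sigma>]])
        fix n assume "n \<in> {1..4} - {1..3::nat}"
        then have "n = 4" by auto
        then show "\<sigma> n = n" using 4 by simp
      qed
      then show "\<sigma> \<in> {\<sigma>. \<sigma> permutes {1..3}}" by simp
    qed
    show "{\<sigma>. \<sigma> permutes {1..3}} \<subseteq> S"
    proof
      fix \<sigma> assume "\<sigma> \<in> {\<sigma>. \<sigma> permutes {1..3::nat}}"
      then have p: "\<sigma> permutes {1..3}" by simp
      have "\<sigma> 4 = 4" using p by (rule permutes_not_in) simp
      have I3: "{1..3::nat} = {1, 2, 3}" by auto
      have "\<sigma> 1 \<in> {1, 2, 3}" "\<sigma> 2 \<in> {1, 2, 3}" "\<sigma> 3 \<in> {1, 2, 3}"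
        using permutes_in_image[OF p] unfolding I3 by blast+
      then have "bform b1 b2 b3 (\<sigma> 1) = - b3" "bform b1 b2 b3 (\<sigma> 2) = - b3" "bform b1 b2 b3 (\<sigma> 3) = - b3"
        using v by auto
      then show "\<sigma> \<in> S" using v \<open>\<sigma> 4 = 4\<close>
        by (intro stabI permutes_subset[OF p]) auto
    qed
  qed
  have sw: "swap 2 3 \<in> S" unfolding S by (auto intro: permutes_swap_id)
  have r: "rot \<in> S" unfolding S using rot_permutes3 by simp
  have "G \<cong> integer_mod_group 2 \<times>\<times> sym_group 3"
    by (rule G_iso[OF sym_group_is_group, of id]) (auto simp: S sym_group_def bij_betw_def)
  moreover have "Aut_generated_by (cubic a b1 b2 b3) {iota5, sigma34, sigma234}"
  proof (rule generatedI)
    let ?H = "induced (cubic a b1 b2 b3) ` {iota5, sigma34, sigma234}"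
    show "?H \<subseteq> carrier G"
      using aut_in_carrier[OF stab_id, of "- 1"] aut_in_carrier[OF sw, of 1] aut_in_carrier[OF r, of 1]
      by (simp add: iota5_act sigma34_act sigma234_act aut_def)
    fix \<sigma> assume "\<sigma> \<in> S"
    then have "\<sigma> permutes {1..3}" unfolding S by simp
    then show "aut 1 \<sigma> \<in> generate G ?H"
    proof (rule generate_permutes3[OF _ sw r])
      show "aut 1 (swap 2 3) \<in> generate G ?H"
        unfolding aut_def sigma34_act[symmetric] by (rule generate.incl) blast
      show "aut 1 rot \<in> generate G ?H"
        unfolding aut_def sigma234_act[symmetric] by (rule generate.incl) blast
    qed
  qed simp
  ultimately show ?thesis using assms unfolding type3_def by blast
qed

text \<open>The linear form is zero and the stabiliser is everything; for generation,
  \<open>iota34\<close> and \<open>iota24\<close> supply the Klein four-group and the other two the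
  permutations fixing vertex 4.\<close>

lemma type4I:
  assumes "b1 = 0" "b2 = 0" "b3 = 0"
  shows "type4 a b1 b2 b3"
proof -
  have S: "S = {\<sigma>. \<sigma> permutes {1..4}}"
    by (simp add: stab_def bform_def assms)
  have mem: "swap 2 3 \<in> S" "rot \<in> S" "double1 \<in> S" "double2 \<in> S"
    unfolding S using swap_permutes[of 2 3] rot_permutes double_permutes by simp_all
  have "G \<cong> integer_mod_group 2 \<times>\<times> sym_group 4"
    by (rule G_iso[OF sym_group_is_group, of id]) (auto simp: S sym_group_def bij_betw_def)
  moreover have "Aut_generated_by (cubic a b1 b2 b3) {iota5, sigma34, sigma234, iota34, iota24}"
  proof (rule generatedI)
    let ?H = "induced (cubic a b1 b2 b3) ` {iota5, sigma34, sigma234, iota34, iota24}"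
    show "?H \<subseteq> carrier G"
      using aut_in_carrier[OF stab_id, of "- 1"] aut_in_carrier[OF mem(1), of 1] aut_in_carrier[OF mem(2), of 1]
        aut_in_carrier[OF mem(3), of 1] aut_in_carrier[OF mem(4), of 1]
      by (simp add: iota5_act sigma34_act sigma234_act iota34_act iota24_act aut_def)
    have g: "aut 1 (swap 2 3) \<in> generate G ?H" "aut 1 rot \<in> generate G ?H"
      "aut 1 double1 \<in> generate G ?H" "aut 1 double2 \<in> generate G ?H"
      unfolding aut_def sigma34_act[symmetric] sigma234_act[symmetric] iota34_act[symmetric] iota24_act[symmetric]
      by (rule generate.incl, blast)+
    fix \<sigma> assume "\<sigma> \<in> S"
    then have "\<sigma> permutes {1..4}" unfolding S by simp
    then obtain \<kappa> \<tau> where \<kappa>: "\<kappa> \<in> {id, double1, double2, double1 \<circ> double2}" "\<tau> permutes {1..3}" "\<sigma> = \<kappa> \<circ> \<tau>"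
      by (rule permutes4_factor)
    have "\<tau> \<in> S" unfolding S using permutes_subset[OF \<kappa>(2)] by auto
    moreover have "\<kappa> \<in> S" using \<kappa>(1) stab_id mem(3,4) stab_compose[OF mem(3,4)] by blast
    moreover have "aut 1 \<tau> \<in> generate G ?H" by (rule generate_permutes3[OF \<kappa>(2) mem(1,2) g(1,2)])
    moreover have "aut 1 \<kappa> \<in> generate G ?H"
      using \<kappa>(1) generate_id g(3,4) generate_comp[OF g(3,4) mem(3,4)] by blast
    ultimately show "aut 1 \<sigma> \<in> generate G ?H" unfolding \<kappa>(3) by (intro generate_comp)
  qed simp
  ultimately show ?thesis using assms unfolding type4_def by blast
qed

text \<open>A nontrivial element of the stabiliser moves some vertex to another one with the same
  value, and the values at two vertices differ by twice a sum or difference of two coefficients, up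
  to sign.\<close>

lemma more_automorphisms_imp_equal_squares:
  assumes "carrier G \<noteq> generate G {induced (cubic a b1 b2 b3) iota5}"
  obtains i j k where "(i, j, k) \<in> triples" "\<beta> j = \<beta> k \<or> \<beta> j = - \<beta> k"
proof -
  have "S \<noteq> {id}"
  proof
    assume S: "S = {id}"
    have "Aut_generated_by (cubic a b1 b2 b3) {iota5}"
    proof (rule generatedI)
      show "induced (cubic a b1 b2 b3) ` {iota5} \<subseteq> carrier G"
        using aut_in_carrier[OF stab_id, of "- 1"] by (simp add: iota5_act aut_def)
    qed (simp_all add: S generate_id)
    then show False using assms by (simp add: Aut_generated_by_def)
  qed
  then obtain \<sigma> where \<sigma>: "\<sigma> \<in> S" "\<sigma> \<noteq> id" using stab_id by blast
  have "\<exists>n\<in>{1..4}. \<sigma> n \<noteq> n"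
  proof (rule ccontr)
    assume "\<not> ?thesis"
    then have "\<sigma> = id" by (intro permutes4_eqI[OF S_permutes[OF \<sigma>(1)] permutes_id]) simp_all
    then show False using \<sigma>(2) by simp
  qed
  then obtain n where n: "n \<in> {1..4}" "\<sigma> n \<noteq> n" by blast
  have halve: "x = y" if "(x - y) + (x - y) = 0" for x y :: 'k
  proof -
    have "2 * (x - y) = 0" using that by (simp only: mult_2)
    then show ?thesis by simp
  qed
  have eq: "b1 = b2 \<or> b1 = - b2 \<or> b1 = b3 \<or> b1 = - b3 \<or> b2 = b3 \<or> b2 = - b3"
    if "m \<in> {1, 2, 3, 4}" "l \<in> {1, 2, 3, 4}" "m < l" "bform b1 b2 b3 m = bform b1 b2 b3 l" for m l :: nat
  proof -
    consider "m = 1" "l = 2" | "m = 1" "l = 3" | "m = 1" "l = 4" | "m = 2" "l = 3" | "m = 2" "l = 4" | "m = 3" "l = 4"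
      using \<open>m \<in> {1, 2, 3, 4}\<close> \<open>l \<in> {1, 2, 3, 4}\<close> \<open>m < l\<close> by (elim insertE emptyE) simp_all
    then show ?thesis
    proof cases
      case 1
      then have "b1 = b2" using that(4) by - (rule halve, simp add: bform_values algebra_simps)
      then show ?thesis by blast
    next
      case 2
      then have "b1 = b3" using that(4) by - (rule halve, simp add: bform_values algebra_simps)
      then show ?thesis by blast
    next
      case 3
      then have "b2 = - b3" using that(4) by - (rule halve, simp add: bform_values algebra_simps)
      then show ?thesis by blast
    next
      case 4
      then have "b2 = b3" using that(4) by - (rule halve, simp add: bform_values algebra_simps)
      then show ?thesis by blast
    next
      case 5
      then have "b1 = - b3" using that(4) by - (rule halve, simp add: bform_values algebra_simps)
      then show ?thesis by blast
    next
      case 6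
      then have "b1 = - b2" using that(4) by - (rule halve, simp add: bform_values algebra_simps)
      then show ?thesis by blast
    qed
  qed
  have "n \<in> {1, 2, 3, 4}" using n(1) unfolding I4 .
  moreover have "\<sigma> n < n \<or> n < \<sigma> n" using n(2) by auto
  ultimately have "b1 = b2 \<or> b1 = - b2 \<or> b1 = b3 \<or> b1 = - b3 \<or> b2 = b3 \<or> b2 = - b3"
    using eq[of n "\<sigma> n"] eq[of "\<sigma> n" n] stabD[OF \<sigma>(1) n(1)] by metis
  then consider "b1 = b2 \<or> b1 = - b2" | "b1 = b3 \<or> b1 = - b3" | "b2 = b3 \<or> b2 = - b3" by blast
  then show ?thesis
  proof cases
    case 1 then show ?thesis by (intro that[of 4 2 3]) (simp_all add: triples_def \<beta>_def)
  next
    case 2 then show ?thesis by (intro that[of 3 2 4]) (simp_all add: triples_def \<beta>_def)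
  next
    case 3 then show ?thesis by (intro that[of 2 3 4]) (simp_all add: triples_def \<beta>_def)
  qed
qed

end

section \<open>Normalising the coefficients\<close>

lemma nonsingular_swap12: "nonsingular a b1 b2 b3 \<Longrightarrow> nonsingular a b2 b1 b3"
  unfolding nonsingular_def
proof (elim contrapos_nn exE conjE)
  fix x y z
  assume "x * y * z + x\<^sup>2 + y\<^sup>2 + z\<^sup>2 + b2 * x + b1 * y + b3 * z + a = 0"
    "y * z + 2 * x + b2 = 0" "x * z + 2 * y + b1 = 0" "x * y + 2 * z + b3 = 0"
  then show "\<exists>x y z. x * y * z + x\<^sup>2 + y\<^sup>2 + z\<^sup>2 + b1 * x + b2 * y + b3 * z + a = 0 \<and>
     y * z + 2 * x + b1 = 0 \<and> x * z + 2 * y + b2 = 0 \<and> x * y + 2 * z + b3 = 0"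
    by (intro exI[of _ y] exI[of _ x] exI[of _ z]) (simp add: ac_simps)
qed

lemma nonsingular_neg12: "nonsingular a b1 b2 b3 \<Longrightarrow> nonsingular a (- b1) (- b2) b3"
  unfolding nonsingular_def
proof (elim contrapos_nn exE conjE)
  fix x y z
  assume 0: "x * y * z + x\<^sup>2 + y\<^sup>2 + z\<^sup>2 + - b1 * x + - b2 * y + b3 * z + a = 0"
    "y * z + 2 * x + - b1 = 0" "x * z + 2 * y + - b2 = 0" "x * y + 2 * z + b3 = 0"
  show "\<exists>x y z. x * y * z + x\<^sup>2 + y\<^sup>2 + z\<^sup>2 + b1 * x + b2 * y + b3 * z + a = 0 \<and>
     y * z + 2 * x + b1 = 0 \<and> x * z + 2 * y + b2 = 0 \<and> x * y + 2 * z + b3 = 0"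
    using 0 by - (rule exI[of _ "- x"], rule exI[of _ "- y"], rule exI[of _ z], simp add: algebra_simps)
qed

lemma signs_cases:
  fixes e2 e3 e4 :: "'a::field_char_0"
  assumes "e2 \<in> {1, -1}" "e3 \<in> {1, -1}" "e4 \<in> {1, -1}" "e2 * e3 * e4 = 1"
  obtains "e2 = 1" "e3 = 1" "e4 = 1" | "e2 = - 1" "e3 = - 1" "e4 = 1"
    | "e2 = - 1" "e3 = 1" "e4 = - 1" | "e2 = 1" "e3 = - 1" "e4 = - 1"
  using assms by auto

lemma nonsingular_signs:
  fixes a :: "'a::field_char_0"
  assumes ns: "nonsingular a b1 b2 b3"
    and e: "e2 \<in> {1, -1}" "e3 \<in> {1, -1}" "e4 \<in> {1, -1}" "e2 * e3 * e4 = 1"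
  shows "nonsingular a (e2 * b1) (e3 * b2) (e4 * b3)"
proof (cases rule: signs_cases[OF e])
  case 1 then show ?thesis using ns by simp
next
  case 2 then show ?thesis using nonsingular_neg12[OF ns] by simp
next
  case 3 then show ?thesis
    using nonsingular_swap23[OF nonsingular_neg12[OF nonsingular_swap23[OF ns]]] by simp
next
  case 4 then show ?thesis
    using nonsingular_swap12[OF nonsingular_swap23[OF nonsingular_neg12[OF nonsingular_swap23[OF nonsingular_swap12[OF ns]]]]]
    by simp
qed

lemma permute_signs_in_coord_changes:
  fixes e2 e3 e4 :: "'a::field_char_0"
  assumes t: "(i, j, k) \<in> triples"
    and e: "e2 \<in> {1, -1}" "e3 \<in> {1, -1}" "e4 \<in> {1, -1}" "e2 * e3 * e4 = 1"
  shows "(\<lambda>x. pt 2 3 4 (x $ 1) (e2 * x $ i) (e3 * x $ j) (e4 * x $ k) (x $ 5)) \<in> coord_changes"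
proof -
  have t234: "(2, 3, 4) \<in> triples" by (simp add: triples_def)
  define \<pi> :: "5 \<Rightarrow> 5" where "\<pi> l = (if l = 2 then i else if l = 3 then j else if l = 4 then k else l)" for l
  have v: "\<pi> 1 = 1" "\<pi> 2 = i" "\<pi> 3 = j" "\<pi> 4 = k" "\<pi> 5 = 5" by (simp_all add: \<pi>_def)
  have ijk: "{i, j, k} = {2, 3, 4}" using t by (auto simp: triples_def)
  have "\<pi> permutes {2, 3, 4}"
  proof (rule bij_imp_permutes)
    show "bij_betw \<pi> {2, 3, 4} {2, 3, 4}"
      using ijk triples_distinct[OF t] by (simp add: bij_betw_def inj_on_def v)
  qed (simp add: \<pi>_def)
  moreover have "\<exists>N \<subseteq> {2, 3, 4}. card N \<in> {0, 2} \<and>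
    (\<forall>x :: 'a ^ 5. pt 2 3 4 (x $ 1) (e2 * x $ i) (e3 * x $ j) (e4 * x $ k) (x $ 5) =
      (\<chi> l. if l \<in> N then - x $ \<pi> l else x $ \<pi> l))"
  proof (cases rule: signs_cases[OF e])
    case 1 then show ?thesis
      by (intro exI[of _ "{}"] conjI allI pt_eqI[symmetric, OF t234]) (simp_all add: v)
  next
    case 2 then show ?thesis
      by (intro exI[of _ "{2, 3}"] conjI allI pt_eqI[symmetric, OF t234]) (simp_all add: v)
  next
    case 3 then show ?thesis
      by (intro exI[of _ "{2, 4}"] conjI allI pt_eqI[symmetric, OF t234]) (simp_all add: v)
  next
    case 4 then show ?thesis
      by (intro exI[of _ "{3, 4}"] conjI allI pt_eqI[symmetric, OF t234]) (simp_all add: v)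
  qed
  ultimately show ?thesis unfolding coord_changes_def by (simp add: fun_eq_iff) blast
qed

lemma card_planes_in_linear:
  fixes T :: "'a::field ^ 'n \<Rightarrow> 'a ^ 'n"
  assumes lin: "Vector_Spaces.linear (*s) (*s) T" and inj: "inj T"
    and eval: "\<And>x. mp_eval P (T x) = mp_eval Q x"
  shows "card (planes_in P) = card (planes_in Q)"
proof -
  have surj: "surj T" by (rule vec.linear_inj_imp_surj[OF lin inj])
  have dim: "vec.dim (T ` W) = vec.dim W" for W
    by (rule vec.dim_image_eq[OF lin inj_on_subset[OF inj subset_UNIV]])
  have "(`) T ` planes_in Q = planes_in P"
  proof
    show "(`) T ` planes_in Q \<subseteq> planes_in P"
      by (auto simp: planes_in_def eval dim intro: vec.linear_subspace_image[OF lin])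
    show "planes_in P \<subseteq> (`) T ` planes_in Q"
    proof
      fix W assume W: "W \<in> planes_in P"
      have eq: "T ` (T -` W) = W" by (rule surj_image_vimage_eq[OF surj])
      have "vec.dim (T -` W) = 3" using dim[of "T -` W"] W unfolding eq by (simp add: planes_in_def)
      then have "T -` W \<in> planes_in Q"
        using W by (auto simp: planes_in_def eval[symmetric] intro: vec.linear_subspace_vimage[OF lin])
      then show "W \<in> (`) T ` planes_in Q" using eq by blast
    qed
  qed
  moreover have "inj_on ((`) T) (planes_in Q)" using inj by (simp add: inj_on_def inj_image_eq_iff)
  ultimately show ?thesis by (metis card_image)
qed

context cubic_threefold
begin

lemma nonsingular_triple:
  assumes "(i, j, k) \<in> triples"
  shows "nonsingular a (\<beta> i) (\<beta> j) (\<beta> k)"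
proof -
  note s = nonsingular_swap12 nonsingular_swap23
  have "nonsingular a b1 b3 b2" "nonsingular a b2 b1 b3" "nonsingular a b2 b3 b1"
    "nonsingular a b3 b1 b2" "nonsingular a b3 b2 b1"
    using s(2)[OF ns] s(1)[OF ns] s(2)[OF s(1)[OF ns]] s(1)[OF s(2)[OF ns]] s(2)[OF s(1)[OF s(2)[OF ns]]] by simp_all
  then show ?thesis using assms ns by (auto simp: triples_def \<beta>_def)
qed

text \<open>\<open>T\<close> puts coordinate \<open>i\<close> in position 2 and so on, and the
  coefficients follow. The hypotheses are carried along so that the results on automorphisms apply
  to the normalised cubic.\<close>

lemma coord_change:
  assumes t: "(i, j, k) \<in> triples"
    and e: "e2 \<in> {1, -1}" "e3 \<in> {1, -1}" "e4 \<in> {1, -1}" "e2 * e3 * e4 = 1"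
  obtains T where "T \<in> coord_changes"
    "\<And>x. mp_eval (cubic a (e2 * \<beta> i) (e3 * \<beta> j) (e4 * \<beta> k)) (T x) = mp_eval (cubic a b1 b2 b3) x"
    "cubic_threefold a (e2 * \<beta> i) (e3 * \<beta> j) (e4 * \<beta> k)"
proof -
  define T where "T = (\<lambda>x :: 'k ^ 5. pt 2 3 4 (x $ 1) (e2 * x $ i) (e3 * x $ j) (e4 * x $ k) (x $ 5))"
  have T: "T x $ 1 = x $ 1" "T x $ 2 = e2 * x $ i" "T x $ 3 = e3 * x $ j" "T x $ 4 = e4 * x $ k" "T x $ 5 = x $ 5" for x
    unfolding T_def by (simp_all add: pt_nth[OF triple_234])
  have eval: "mp_eval (cubic a (e2 * \<beta> i) (e3 * \<beta> j) (e4 * \<beta> k)) (T x) = mp_eval (cubic a b1 b2 b3) x" for x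
    unfolding mp_eval_cubic F_triple[OF t] unfolding cubic_fun_def T
    by (cases rule: signs_cases[OF e]) simp_all
  have "T (x + y) = T x + T y" "T (c *s x) = c *s T x" for x y c
    unfolding T_def
    by (rule pt_eqI[symmetric, OF triple_234]; simp add: pt_nth[OF triple_234] distrib_left)+
  then have "Vector_Spaces.linear (*s) (*s) T"
    by unfold_locales (simp_all add: vec.scale_right_distrib vec.scale_left_distrib)
  moreover have "inj T"
  proof (rule injI)
    fix x y assume "T x = T y"
    then have q: "T x $ l = T y $ l" for l by simp
    have "e2 \<noteq> 0" "e3 \<noteq> 0" "e4 \<noteq> 0" using e(4) by auto
    then have "x $ 1 = y $ 1" "x $ i = y $ i" "x $ j = y $ j" "x $ k = y $ k" "x $ 5 = y $ 5"
      using q[of 1] q[of 2] q[of 3] q[of 4] q[of 5] unfolding T by simp_all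
    then show "x = y" using triples_cover[OF t] unfolding Finite_Cartesian_Product.vec_eq_iff by metis
  qed
  ultimately have "card (planes_in (cubic a (e2 * \<beta> i) (e3 * \<beta> j) (e4 * \<beta> k))) = 3"
    using planes by (simp only: card_planes_in_linear[OF _ _ eval])
  then have "cubic_threefold a (e2 * \<beta> i) (e3 * \<beta> j) (e4 * \<beta> k)"
    using nonsingular_signs[OF nonsingular_triple[OF t] e] by unfold_locales
  moreover have "T \<in> coord_changes" unfolding T_def by (rule permute_signs_in_coord_changes[OF t e])
  ultimately show ?thesis using that eval by blast
qed

text \<open>The split is by whether all three coefficients are nonzero and agree up to sign, which
  is the third type. Otherwise some two agree up to sign, and the type depends on whether they and
  the remaining coefficient are zero.\<close>

theorem classification:
  assumes "carrier G \<noteq> generate G {induced (cubic a b1 b2 b3) iota5}"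
  shows "\<exists>T \<in> coord_changes. \<exists>c1 c2 c3.
    (\<forall>x. mp_eval (cubic a c1 c2 c3) (T x) = mp_eval (cubic a b1 b2 b3) x) \<and>
    (type1 a c1 c2 c3 \<or> type2 a c1 c2 c3 \<or> type3 a c1 c2 c3 \<or> type4 a c1 c2 c3)"
proof (cases "b1 \<noteq> 0 \<and> b2 \<in> {b1, - b1} \<and> b3 \<in> {b1, - b1}")
  case True
  define s2 s3 where "s2 = (if b2 = b1 then 1 else - 1 :: 'k)" and "s3 = (if b3 = b1 then 1 else - 1 :: 'k)"
  have s: "s2 \<in> {1, -1}" "s3 \<in> {1, -1}" "s2 * b2 = b1" "s3 * b3 = b1"
    using True by (auto simp: s2_def s3_def)
  \<comment> \<open>The signs 1, \<open>s2\<close>, \<open>s3\<close> equalise the coefficients but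
    may have product -1; multiplying all three by \<open>e\<close> makes the product 1 and the
    common coefficient \<open>e * b1\<close>.\<close>
  define e where "e = s2 * s3"
  have e: "e \<in> {1, -1}" "e * s2 \<in> {1, -1}" "e * s3 \<in> {1, -1}" "e * (e * s2) * (e * s3) = 1"
    using s(1,2) by (auto simp: e_def)
  have v: "e * \<beta> 2 = e * b1" "e * s2 * \<beta> 3 = e * b1" "e * s3 * \<beta> 4 = e * b1"
    using s(3,4) by (simp_all add: \<beta>_def mult.assoc)
  obtain T where T: "T \<in> coord_changes"
    "\<And>x. mp_eval (cubic a (e * b1) (e * b1) (e * b1)) (T x) = mp_eval (cubic a b1 b2 b3) x"
    "cubic_threefold a (e * b1) (e * b1) (e * b1)"
    using coord_change[OF triple_234 e] unfolding v by blast
  interpret c: cubic_threefold a "e * b1" "e * b1" "e * b1" by (rule T(3))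
  have "type3 a (e * b1) (e * b1) (e * b1)" using True e(1) by (intro c.type3I) auto
  then show ?thesis using T(1,2) by blast
next
  case False
  obtain i j k where t: "(i, j, k) \<in> triples" and jk: "\<beta> j = \<beta> k \<or> \<beta> j = - \<beta> k"
    using more_automorphisms_imp_equal_squares[OF assms] by blast
  \<comment> \<open>Signs can only be changed in pairs: making the coefficients of \<open>j\<close>
    and \<open>k\<close> equal may cost a sign on that of \<open>i\<close>.\<close>
  define e where "e = (if \<beta> j = \<beta> k then 1 else - 1 :: 'k)"
  have e: "e \<in> {1, -1}" "1 \<in> {1, -1 :: 'k}" "e * 1 * e = 1" "e * \<beta> k = \<beta> j"
    using jk by (auto simp: e_def)
  obtain T where T: "T \<in> coord_changes"
    "\<And>x. mp_eval (cubic a (e * \<beta> i) (\<beta> j) (\<beta> j)) (T x) = mp_eval (cubic a b1 b2 b3) x"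
    "cubic_threefold a (e * \<beta> i) (\<beta> j) (\<beta> j)"
    using coord_change[OF t e(1,2,1,3)] unfolding mult_1_left e(4) by blast
  interpret c: cubic_threefold a "e * \<beta> i" "\<beta> j" "\<beta> j" by (rule T(3))
  have "type1 a (e * \<beta> i) (\<beta> j) (\<beta> j) \<or> type2 a (e * \<beta> i) (\<beta> j) (\<beta> j) \<or> type4 a (e * \<beta> i) (\<beta> j) (\<beta> j)"
  proof (cases "\<beta> j = 0")
    case True
    then show ?thesis using c.type2I c.type4I by blast
  next
    case nz: False
    \<comment> \<open>Otherwise all three coefficients would be nonzero and equal up to sign, the
      case already treated.\<close>
    have "\<beta> i \<noteq> \<beta> j" "\<beta> i \<noteq> - \<beta> j"
      using False nz jk t by (auto simp: triples_def \<beta>_def)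
    then have "e * \<beta> i \<noteq> \<beta> j" "e * \<beta> i \<noteq> - \<beta> j" using e(1) minus_equation_iff[of "\<beta> i" "\<beta> j"] by auto
    then show ?thesis using c.type1I nz by blast
  qed
  then show ?thesis using T(1,2) by blast
qed

end

theorem proposition7p11:
  fixes a b1 b2 b3 :: "'k::{alg_closed_field, field_char_0}"
  assumes six_nodes: "card (sing_locus (cubic a b1 b2 b3)) = 6"
      "\<forall>L \<in> sing_locus (cubic a b1 b2 b3). is_node (cubic a b1 b2 b3) L"
    and three_planes: "card (planes_in (cubic a b1 b2 b3)) = 3"
    and more_auts: "carrier (Aut_hyp (cubic a b1 b2 b3)) \<noteq>
      generate (Aut_hyp (cubic a b1 b2 b3)) {induced (cubic a b1 b2 b3) iota5}"
  shows "\<exists>T \<in> coord_changes. \<exists>c1 c2 c3.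
           (\<forall>x. mp_eval (cubic a c1 c2 c3) (T x) = mp_eval (cubic a b1 b2 b3) x) \<and>
           (type1 a c1 c2 c3 \<or> type2 a c1 c2 c3 \<or> type3 a c1 c2 c3 \<or> type4 a c1 c2 c3)"
proof -
  interpret cubic_threefold a b1 b2 b3
    using six_singular_points_imp_nonsingular[OF six_nodes(1)] three_planes by unfold_locales
  show ?thesis by (rule classification[OF more_auts])
qed

end
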